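(* (Two-round point-to-point.) The set of triples $(R_0,R_X,R_Y)$ in the rate region of the function computation problem with $R_X>H(X)$ equals the set of triples with $R_X> H(X)$ and \begin{align*} R_0\ge I(X;U|Y),\qquad R_Y\ge I(Y;W|X,U), \end{align*} for some random variables $U,W$ with finite alphabets $\mathcal U,\mathcal W$ jointly distributed with $(X,Y)$ such that $U-X-Y$ and $X-(U,Y)-W$ are Markov chains and $(U,Y)\in W\in\mathrm M(\Gamma(G_{U,Y|X,U}))$; moreover one may restrict to $|\mathcal U|\le|\mathcal X|+2$ and $|\mathcal W|\le(|\mathcal X|+2)|\mathcal Y|+1$.
   Context: Setup: $\mathcal X,\mathcal Y,\mathcal F$ finite, $(X_i,Y_i)_{i\ge1}$ i.i.d. copies of $(X,Y)\sim p(x,y)$, $f:\mathcal X\times\mathcal Y\to\mathcal F$ applied componentwise to sequences. An $(n,R_0,R_X,R_Y)$ code consists of encoders $\varphi_0:\mathcal X^n\to\{1,\dots,2^{nR_0}\}$, $\varphi_X:\mathcal X^n\to\{1,\dots,2^{nR_X}\}$, $\varphi_Y:\mathcal Y^n\times\{1,\dots,2^{nR_0}\}\to\{1,\dots,2^{nR_Y}\}$ and a decoder $\psi:\{1,\dots,2^{nR_X}\}\times\{1,\dots,2^{nR_Y}\}\to\mathcal F^n$, with error probability $P(\psi(\varphi_X(\mathbf X),\varphi_Y(\varphi_0(\mathbf X),\mathbf Y))\ne f(\mathbf X,\mathbf Y))$. A triple is achievable if for every $\varepsilon>0$ and all large $n$ a code with error probability $\le\varepsilon$ exists; the rate region is the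 closure of the achievable set. Generalized conditional characteristic graph: for jointly distributed $(L,K,S)\sim p(l,k,s)$ and a function $f$ of $S$ with $H(f(S)|L,K)=0$, $G_{L|K}$ has vertex set $\mathcal L$ and $l_1,l_2$ adjacent iff there exist $s_1,s_2,k$ with $p(l_1,k,s_1)p(l_2,k,s_2)>0$ and $f(s_1)\ne f(s_2)$. Here $G_{U,Y|X,U}$ uses $L=(U,Y)$, $K=(X,U)$, $S=(X,Y)$ with function $f(X,Y)$. $\Gamma(G)$ is the set of independent sets of $G$; $Z\in W\in\mathrm M(\Gamma(G))$ means $W$ is a random variable each of whose values is an independent set of $G$ (distinct values may be the same set) and $P(Z\in W)=1$. *)

theory Defs
  imports "HOL-Analysis.Analysis" "HOL-Probability.Probability"
begin

definition entropy_pmf :: "'a pmf \<Rightarrow> real" where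
  "entropy_pmf M = - (\<Sum>a\<in>set_pmf M. pmf M a * log 2 (pmf M a))"

definition cond_mi_pmf :: "('a \<times> 'b \<times> 'c) pmf \<Rightarrow> real" where
  "cond_mi_pmf M =
     entropy_pmf (map_pmf (\<lambda>(a,b,c). (a,c)) M)
   + entropy_pmf (map_pmf (\<lambda>(a,b,c). (b,c)) M)
   - entropy_pmf M
   - entropy_pmf (map_pmf (\<lambda>(a,b,c). c) M)"

definition markov_chain_pmf :: "('a \<times> 'b \<times> 'c) pmf \<Rightarrow> bool" where
  "markov_chain_pmf M \<longleftrightarrow> (\<forall>a b c.
     pmf M (a,b,c) * pmf (map_pmf (\<lambda>(a,b,c). b) M) b
     = pmf (map_pmf (\<lambda>(a,b,c). (a,b)) M) (a,b) * pmf (map_pmf (\<lambda>(a,b,c). (b,c)) M) (b,c))"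

definition char_graph_adj :: "('l \<times> 'k \<times> 's) pmf \<Rightarrow> ('s \<Rightarrow> 'f) \<Rightarrow> 'l \<Rightarrow> 'l \<Rightarrow> bool" where
  "char_graph_adj M g l1 l2 \<longleftrightarrow>
     (\<exists>k s1 s2. pmf M (l1,k,s1) * pmf M (l2,k,s2) > 0 \<and> g s1 \<noteq> g s2)"

definition independent_set :: "'l set \<Rightarrow> ('l \<Rightarrow> 'l \<Rightarrow> bool) \<Rightarrow> 'l set \<Rightarrow> bool" where
  "independent_set V adj S \<longleftrightarrow> S \<subseteq> V \<and> (\<forall>a\<in>S. \<forall>b\<in>S. \<not> adj a b)"

fun iid_pmf :: "nat \<Rightarrow> 'a pmf \<Rightarrow> 'a list pmf" where
  "iid_pmf 0 p = return_pmf []"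
| "iid_pmf (Suc n) p = bind_pmf p (\<lambda>a. map_pmf (\<lambda>as. a # as) (iid_pmf n p))"

definition num_msgs :: "nat \<Rightarrow> real \<Rightarrow> nat" where
  "num_msgs n R = nat \<lfloor>2 powr (real n * R)\<rfloor>"

definition is_code ::
  "nat \<Rightarrow> real \<Rightarrow> real \<Rightarrow> real \<Rightarrow> ('x list \<Rightarrow> nat) \<Rightarrow> ('x list \<Rightarrow> nat) \<Rightarrow> ('y list \<Rightarrow> nat \<Rightarrow> nat) \<Rightarrow> bool" where
  "is_code n R0 RX RY \<phi>0 \<phi>X \<phi>Y \<longleftrightarrow>
     (\<forall>xs. length xs = n \<longrightarrow> \<phi>0 xs < num_msgs n R0 \<and> \<phi>X xs < num_msgs n RX) \<and>
     (\<forall>ys m. length ys = n \<longrightarrow> m < num_msgs n R0 \<longrightarrow> \<phi>Y ys m < num_msgs n RY)"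

definition code_error ::
  "('x \<times> 'y) pmf \<Rightarrow> ('x \<Rightarrow> 'y \<Rightarrow> 'f) \<Rightarrow> nat \<Rightarrow> ('x list \<Rightarrow> nat) \<Rightarrow> ('x list \<Rightarrow> nat)
    \<Rightarrow> ('y list \<Rightarrow> nat \<Rightarrow> nat) \<Rightarrow> (nat \<Rightarrow> nat \<Rightarrow> 'f list) \<Rightarrow> real" where
  "code_error p f n \<phi>0 \<phi>X \<phi>Y \<psi> =
     measure_pmf.prob (iid_pmf n p)
       {xys. \<psi> (\<phi>X (map fst xys)) (\<phi>Y (map snd xys) (\<phi>0 (map fst xys)))
               \<noteq> map (\<lambda>(x,y). f x y) xys}"

definition achievable :: "('x \<times> 'y) pmf \<Rightarrow> ('x \<Rightarrow> 'y \<Rightarrow> 'f) \<Rightarrow> real \<times> real \<times> real \<Rightarrow> bool" where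
  "achievable p f r \<longleftrightarrow> (case r of (R0, RX, RY) \<Rightarrow>
     (\<forall>\<epsilon>>0. \<exists>N. \<forall>n\<ge>N. \<exists>\<phi>0 \<phi>X \<phi>Y \<psi>.
        is_code n R0 RX RY \<phi>0 \<phi>X \<phi>Y \<and> code_error p f n \<phi>0 \<phi>X \<phi>Y \<psi> \<le> \<epsilon>))"

definition rate_region :: "('x \<times> 'y) pmf \<Rightarrow> ('x \<Rightarrow> 'y \<Rightarrow> 'f) \<Rightarrow> (real \<times> real \<times> real) set" where
  "rate_region p f = closure {r. achievable p f r}"

text \<open>q is a joint pmf of (X,Y,U,W); U takes values in {0..<ku}, W in {0..<kw};
  the value w of W stands for the independent set \<sigma> w (distinct labels may
  denote the same set).\<close>
definition valid_aux ::
  "('x \<times> 'y) pmf \<Rightarrow> ('x \<Rightarrow> 'y \<Rightarrow> 'f) \<Rightarrow> nat \<Rightarrow> nat \<Rightarrow> ('x \<times> 'y \<times> nat \<times> nat) pmf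
     \<Rightarrow> (nat \<Rightarrow> (nat \<times> 'y) set) \<Rightarrow> bool" where
  "valid_aux p f ku kw q \<sigma> \<longleftrightarrow>
     map_pmf (\<lambda>(x,y,u,w). (x,y)) q = p \<and>
     (\<forall>(x,y,u,w)\<in>set_pmf q. u < ku \<and> w < kw) \<and>
     markov_chain_pmf (map_pmf (\<lambda>(x,y,u,w). (u,x,y)) q) \<and>
     markov_chain_pmf (map_pmf (\<lambda>(x,y,u,w). (x,(u,y),w)) q) \<and>
     (\<forall>w<kw. independent_set ({..<ku} \<times> UNIV)
        (char_graph_adj (map_pmf (\<lambda>(x,y,u,w). ((u,y),(x,u),(x,y))) q) (\<lambda>(x,y). f x y))
        (\<sigma> w)) \<and>
     (\<forall>(x,y,u,w)\<in>set_pmf q. (u,y) \<in> \<sigma> w)"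

definition region_char ::
  "('x \<times> 'y) pmf \<Rightarrow> ('x \<Rightarrow> 'y \<Rightarrow> 'f) \<Rightarrow> nat \<Rightarrow> nat \<Rightarrow> (real \<times> real \<times> real) set" where
  "region_char p f bu bw = {(R0, RX, RY).
     RX > entropy_pmf (map_pmf fst p) \<and>
     (\<exists>ku kw q \<sigma>. ku \<le> bu \<and> kw \<le> bw \<and> valid_aux p f ku kw q \<sigma> \<and>
        R0 \<ge> cond_mi_pmf (map_pmf (\<lambda>(x,y,u,w). (x,u,y)) q) \<and>
        RY \<ge> cond_mi_pmf (map_pmf (\<lambda>(x,y,u,w). (y,w,(x,u))) q))}"

end

theory Submission
  imports Defs
begin

text \<open>
  Achievability. The auxiliary words are produced by two Wyner--Ziv codes, the first describing a word
  \<open>u\<close> for \<open>X\<^sup>n\<close> with side information \<open>Y\<^sup>n\<close>, the second a word \<open>w\<close> for \<open>(u, Y\<^sup>n)\<close> with side information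
  \<open>(X\<^sup>n, u)\<close>; since \<open>R\<^sub>X > H(X)\<close>, the decoder knows \<open>X\<^sup>n\<close> and hence \<open>u\<close>, and reads \<open>f\<close> off \<open>(X\<^sup>n, u, w)\<close>.
  Instead of typical sequences, a one-shot bound based on soft covering is used: it compares the
  law of the coded words with the ideal product law, so that any event of small ideal probability
  (in particular a failure of the second code) stays improbable for the first code.

  Converse. The usual single-letterization produces auxiliary variables for which \<open>f(X,Y)\<close> is
  only nearly determined by \<open>(X,U,W)\<close>. Reweighting the values of \<open>U\<close>, and then of \<open>W\<close>, by a sparse
  solution of a linear program preserves the source law and the information quantities, does not
  increase the error of the best estimator, and bounds the alphabets. A limit point of these
  distributions, for codes with vanishing error, determines \<open>f(X,Y)\<close> exactly, and by the Markov
  condition \<open>X - (U,Y) - W\<close> the set of \<open>(u,y)\<close> compatible with a value \<open>w\<close> is then independent.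
\<close>

section \<open>Entropy of finite random variables\<close>

text \<open>The two codes meet an obstacle: the second is designed for words \<open>u\<close> that
  follow the product law, but the first outputs a deterministic function of the source word, whose
  joint law with the source is not a product. Hence the coding theorem is stated for an arbitrary
  event \<open>Bad\<close>, whose probability under the coded law exceeds the ideal one by at most
  epsilon. The second code is fixed first, and its failure set becomes the event \<open>Bad\<close>
  of the first.

  In the converse, the alphabets must be bounded independently of the block length before the limit
  is taken, since only then do the distributions range over a compact set. The error stays a
  probability throughout: it is the cost of the linear program and so occupies no constraint. The
  constraints for \<open>U\<close> are the |X| atoms of the law of \<open>X\<close> (which contain
  the normalization) and one functional for each mutual information, hence |X| + 2. Those for
  \<open>W\<close> are the atoms of the law of \<open>(U,Y)\<close> and a single functional, hence
  |U||Y| + 1.\<close>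

abbreviation joint_rv :: "('o \<Rightarrow> 'a) \<Rightarrow> ('o \<Rightarrow> 'b) \<Rightarrow> 'o \<Rightarrow> 'a \<times> 'b" (infixr "\<bowtie>" 65) where
  "A \<bowtie> B \<equiv> \<lambda>\<omega>. (A \<omega>, B \<omega>)"

text \<open>Random variables are functions on one common distribution, so that joint and marginal
  entropies are values of a single functional and information identities become linear relations
  between them.\<close>

definition rv_entropy :: "'o pmf \<Rightarrow> ('o \<Rightarrow> 'a) \<Rightarrow> real" where
  "rv_entropy M A = entropy_pmf (map_pmf A M)"

lemma pmf_map_sum:
  assumes "finite (set_pmf M)"
  shows "pmf (map_pmf A M) a = (\<Sum>\<omega>\<in>{\<omega>\<in>set_pmf M. A \<omega> = a}. pmf M \<omega>)"
proof -
  have "pmf (map_pmf A M) a = measure M (A -` {a} \<inter> set_pmf M)"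
    by (simp add: pmf_map measure_Int_set_pmf)
  also have "A -` {a} \<inter> set_pmf M = {\<omega>\<in>set_pmf M. A \<omega> = a}" by auto
  finally show ?thesis using assms by (simp add: measure_measure_pmf_finite)
qed

lemma sum_map_pmf:
  fixes h :: "'a \<Rightarrow> real"
  assumes "finite (set_pmf M)"
  shows "(\<Sum>a\<in>A ` set_pmf M. pmf (map_pmf A M) a * h a) = (\<Sum>\<omega>\<in>set_pmf M. pmf M \<omega> * h (A \<omega>))"
proof -
  have "(\<Sum>\<omega>\<in>set_pmf M. pmf M \<omega> * h (A \<omega>))
      = (\<Sum>a\<in>A ` set_pmf M. \<Sum>\<omega>\<in>{\<omega>\<in>set_pmf M. A \<omega> = a}. pmf M \<omega> * h (A \<omega>))"
    by (rule sum.image_gen[OF assms])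
  also have "\<dots> = (\<Sum>a\<in>A ` set_pmf M. pmf (map_pmf A M) a * h a)"
    by (intro sum.cong refl) (simp add: pmf_map_sum[OF assms] sum_distrib_right)
  finally show ?thesis by simp
qed

lemma rv_entropy_eq_sum:
  assumes "finite (set_pmf M)"
  shows "rv_entropy M A = - (\<Sum>\<omega>\<in>set_pmf M. pmf M \<omega> * log 2 (pmf (map_pmf A M) (A \<omega>)))"
  using sum_map_pmf[OF assms, of A "\<lambda>a. log 2 (pmf (map_pmf A M) a)"]
  by (simp add: rv_entropy_def entropy_pmf_def)

lemma pmf_map_pos: "\<omega> \<in> set_pmf M \<Longrightarrow> pmf (map_pmf A M) (A \<omega>) > 0"
  by (simp add: pmf_positive)

text \<open>Each fibre of \<open>A\<close> lies inside a fibre of \<open>A'\<close>, so the atoms of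
  \<open>A'\<close> are larger. The dependence is asked for on the support only, because it often
  rests on facts such as the length of a source word.\<close>

lemma rv_entropy_mono:
  assumes fin: "finite (set_pmf M)"
    and det: "\<And>\<omega> \<omega>'. \<omega> \<in> set_pmf M \<Longrightarrow> \<omega>' \<in> set_pmf M \<Longrightarrow> A \<omega> = A \<omega>' \<Longrightarrow> A' \<omega> = A' \<omega>'"
  shows "rv_entropy M A' \<le> rv_entropy M A"
proof -
  have "pmf (map_pmf A M) (A \<omega>) \<le> pmf (map_pmf A' M) (A' \<omega>)" if "\<omega> \<in> set_pmf M" for \<omega>
    unfolding pmf_map_sum[OF fin]
  proof (rule sum_mono2)
    show "{\<omega>' \<in> set_pmf M. A \<omega>' = A \<omega>} \<subseteq> {\<omega>' \<in> set_pmf M. A' \<omega>' = A' \<omega>}"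
      using det[OF _ that] by blast
  qed (use fin in auto)
  then show ?thesis
    unfolding rv_entropy_eq_sum[OF fin]
    by (intro le_imp_neg_le sum_mono mult_left_mono log_mono) (auto simp: pmf_map_pos)
qed

text \<open>Entropy sees only the partition into fibres. This is the device for reordering tuples
  and for dropping components that the others determine.\<close>

lemma rv_entropy_cong:
  assumes "finite (set_pmf M)"
    and "\<And>\<omega> \<omega>'. \<omega> \<in> set_pmf M \<Longrightarrow> \<omega>' \<in> set_pmf M \<Longrightarrow> A \<omega> = A \<omega>' \<longleftrightarrow> A' \<omega> = A' \<omega>'"
  shows "rv_entropy M A = rv_entropy M A'"
proof (rule antisym)
  show "rv_entropy M A \<le> rv_entropy M A'"
    by (rule rv_entropy_mono[OF assms(1)]) (use assms(2) in blast)
  show "rv_entropy M A' \<le> rv_entropy M A"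
    by (rule rv_entropy_mono[OF assms(1)]) (use assms(2) in blast)
qed

lemma sum_pmf_marginal:
  assumes "finite (set_pmf M)"
  shows "(\<Sum>a\<in>A ` set_pmf M. pmf (map_pmf (A \<bowtie> C) M) (a,c)) = pmf (map_pmf C M) c"
proof -
  have "pmf (map_pmf C M) c = (\<Sum>\<omega>\<in>{\<omega>\<in>set_pmf M. C \<omega> = c}. pmf M \<omega>)"
    by (rule pmf_map_sum[OF assms])
  also have "\<dots> = (\<Sum>a\<in>A ` set_pmf M. \<Sum>\<omega>\<in>{\<omega>\<in>{\<omega>\<in>set_pmf M. C \<omega> = c}. A \<omega> = a}. pmf M \<omega>)"
    using assms by (intro sum.group[symmetric]) auto
  also have "\<dots> = (\<Sum>a\<in>A ` set_pmf M. pmf (map_pmf (A \<bowtie> C) M) (a,c))"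
    unfolding pmf_map_sum[OF assms] by (intro sum.cong refl) auto
  finally show ?thesis by simp
qed

lemma ln_le_log2: "z > 0 \<Longrightarrow> log 2 z \<le> (z - 1) / ln 2"
  using ln_le_minus_one[of z] by (simp add: log_def divide_right_mono)

text \<open>Nonnegativity of conditional mutual information. The function \<open>z\<close> is the
  likelihood ratio between the law that makes \<open>A\<close> and \<open>B\<close> independent
  given \<open>C\<close> and the true law; its mean is at most 1, and the logarithm lies below its
  tangent at 1.\<close>

lemma rv_entropy_submodular:
  assumes fin: "finite (set_pmf M)"
  shows "rv_entropy M (A \<bowtie> B \<bowtie> C) + rv_entropy M C
       \<le> rv_entropy M (A \<bowtie> C) + rv_entropy M (B \<bowtie> C)"
proof -
  let ?\<Omega> = "set_pmf M"
  let ?abc = "A \<bowtie> B \<bowtie> C" and ?ac = "A \<bowtie> C" and ?bc = "B \<bowtie> C"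
  let ?P = "pmf (map_pmf ?abc M)" and ?Q = "pmf (map_pmf ?ac M)"
    and ?R = "pmf (map_pmf ?bc M)" and ?S = "pmf (map_pmf C M)"
  define z where "z = (\<lambda>(a,b,c). ?Q (a,c) * ?R (b,c) / (?P (a,b,c) * ?S c))"
  have pos: "?P (?abc \<omega>) > 0" "?Q (?ac \<omega>) > 0" "?R (?bc \<omega>) > 0" "?S (C \<omega>) > 0" if "\<omega> \<in> ?\<Omega>" for \<omega>
    using that pmf_map_pos[of \<omega> M] by auto
  have "rv_entropy M ?abc + rv_entropy M C - rv_entropy M ?ac - rv_entropy M ?bc
      = (\<Sum>\<omega>\<in>?\<Omega>. pmf M \<omega> * (log 2 (?Q (?ac \<omega>)) + log 2 (?R (?bc \<omega>))
            - log 2 (?P (?abc \<omega>)) - log 2 (?S (C \<omega>))))"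
    unfolding rv_entropy_eq_sum[OF fin]
    by (simp add: algebra_simps sum_subtractf sum.distrib)
  also have "\<dots> = (\<Sum>\<omega>\<in>?\<Omega>. pmf M \<omega> * log 2 (z (?abc \<omega>)))"
  proof (intro sum.cong refl)
    fix \<omega> assume "\<omega> \<in> ?\<Omega>"
    from pos[OF this] show "pmf M \<omega> * (log 2 (?Q (?ac \<omega>)) + log 2 (?R (?bc \<omega>))
            - log 2 (?P (?abc \<omega>)) - log 2 (?S (C \<omega>))) = pmf M \<omega> * log 2 (z (?abc \<omega>))"
      by (simp add: z_def log_mult log_divide)
  qed
  also have "\<dots> \<le> (\<Sum>\<omega>\<in>?\<Omega>. pmf M \<omega> * ((z (?abc \<omega>) - 1) / ln 2))"
    using pos by (intro sum_mono mult_left_mono ln_le_log2) (auto simp: z_def)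
  also have "\<dots> = ((\<Sum>\<omega>\<in>?\<Omega>. pmf M \<omega> * z (?abc \<omega>)) - 1) / ln 2"
    using sum_pmf_eq_1[OF fin order_refl]
    by (simp add: sum_divide_distrib[symmetric] right_diff_distrib sum_subtractf
        diff_divide_distrib[symmetric])
  also have "(\<Sum>\<omega>\<in>?\<Omega>. pmf M \<omega> * z (?abc \<omega>)) = (\<Sum>t\<in>?abc ` ?\<Omega>. ?P t * z t)"
    by (rule sum_map_pmf[OF fin, symmetric])
  also have "\<dots> = (\<Sum>t\<in>?abc ` ?\<Omega>. (\<lambda>(a,b,c). ?Q (a,c) * ?R (b,c) / ?S c) t)"
    using pos by (intro sum.cong refl) (auto simp: z_def less_imp_neq[symmetric])
  \<comment> \<open>Passing from the support of the triple to the full grid can only add mass; on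
    the grid the sum factors and equals 1.\<close>
  also have "\<dots> \<le> (\<Sum>t\<in>A ` ?\<Omega> \<times> B ` ?\<Omega> \<times> C ` ?\<Omega>. (\<lambda>(a,b,c). ?Q (a,c) * ?R (b,c) / ?S c) t)"
    using fin by (intro sum_mono2) auto
  also have "\<dots> = (\<Sum>a\<in>A ` ?\<Omega>. \<Sum>b\<in>B ` ?\<Omega>. \<Sum>c\<in>C ` ?\<Omega>. ?Q (a,c) * ?R (b,c) / ?S c)"
    by (simp add: sum.cartesian_product)
  also have "\<dots> = (\<Sum>a\<in>A ` ?\<Omega>. \<Sum>c\<in>C ` ?\<Omega>. \<Sum>b\<in>B ` ?\<Omega>. ?Q (a,c) * ?R (b,c) / ?S c)"
    by (intro sum.cong refl sum.swap)
  also have "\<dots> = (\<Sum>a\<in>A ` ?\<Omega>. \<Sum>c\<in>C ` ?\<Omega>. ?Q (a,c))"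
  proof (intro sum.cong refl)
    fix a c assume "c \<in> C ` ?\<Omega>"
    have "(\<Sum>b\<in>B ` ?\<Omega>. ?Q (a,c) * ?R (b,c) / ?S c) = ?Q (a,c) * (\<Sum>b\<in>B ` ?\<Omega>. ?R (b,c)) / ?S c"
      by (simp add: sum_distrib_left sum_divide_distrib)
    also have "\<dots> = ?Q (a,c)"
      using \<open>c \<in> C ` ?\<Omega>\<close> pos(4) by (auto simp: sum_pmf_marginal[OF fin] less_imp_neq[symmetric])
    finally show "(\<Sum>b\<in>B ` ?\<Omega>. ?Q (a,c) * ?R (b,c) / ?S c) = ?Q (a,c)" .
  qed
  also have "\<dots> = (\<Sum>c\<in>C ` ?\<Omega>. ?S c)"
    by (subst sum.swap) (simp add: sum_pmf_marginal[OF fin])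
  also have "\<dots> = 1"
    using fin by (intro sum_pmf_eq_1) auto
  finally show ?thesis by (simp add: divide_right_mono)
qed

lemma rv_entropy_const: "rv_entropy M (\<lambda>_. c) = 0"
  by (simp add: rv_entropy_def entropy_pmf_def map_pmf_const)

lemma rv_entropy_subadditive:
  assumes "finite (set_pmf M)"
  shows "rv_entropy M (A \<bowtie> B) \<le> rv_entropy M A + rv_entropy M B"
proof -
  have "rv_entropy M (A \<bowtie> B) = rv_entropy M (\<lambda>\<omega>. (A \<omega>, B \<omega>, ()))"
    by (rule rv_entropy_cong[OF assms]) auto
  moreover have "rv_entropy M (\<lambda>\<omega>. (A \<omega>, ())) = rv_entropy M A"
    by (rule rv_entropy_cong[OF assms]) auto
  moreover have "rv_entropy M (\<lambda>\<omega>. (B \<omega>, ())) = rv_entropy M B"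
    by (rule rv_entropy_cong[OF assms]) auto
  ultimately show ?thesis
    using rv_entropy_submodular[OF assms, of A B "\<lambda>_. ()"] by (simp add: rv_entropy_const)
qed

text \<open>Again the tangent bound for the logarithm, now against the uniform law on
  \<open>K\<close>. For an encoder output, \<open>K\<close> is the whole message set.\<close>

lemma entropy_pmf_le_log_card:
  assumes "finite K" "set_pmf N \<subseteq> K"
  shows "entropy_pmf N \<le> log 2 (real (card K))"
proof -
  let ?n = "real (card K)"
  have fin: "finite (set_pmf N)" using assms finite_subset by blast
  have n: "?n > 0" using assms set_pmf_not_empty[of N] by (auto simp: card_gt_0_iff)
  have one: "(\<Sum>a\<in>set_pmf N. pmf N a) = 1" using fin by (intro sum_pmf_eq_1) auto
  have "entropy_pmf N - log 2 ?n = (\<Sum>a\<in>set_pmf N. pmf N a * (- log 2 (pmf N a) - log 2 ?n))"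
    using one by (simp add: entropy_pmf_def right_diff_distrib sum_subtractf sum_negf
        sum_distrib_right[symmetric])
  also have "\<dots> = (\<Sum>a\<in>set_pmf N. pmf N a * log 2 (1 / (pmf N a * ?n)))"
    using n by (intro sum.cong refl) (simp add: log_divide log_mult pmf_positive)
  also have "\<dots> \<le> (\<Sum>a\<in>set_pmf N. pmf N a * ((1 / (pmf N a * ?n) - 1) / ln 2))"
    using n by (intro sum_mono mult_left_mono ln_le_log2) (auto simp: pmf_positive)
  also have "\<dots> = (\<Sum>a\<in>set_pmf N. (1 / ?n - pmf N a) / ln 2)"
    using n by (intro sum.cong refl) (auto simp: field_simps set_pmf_iff)
  also have "\<dots> = (real (card (set_pmf N)) / ?n - 1) / ln 2"
    using one by (simp add: sum_divide_distrib[symmetric] sum_subtractf)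
  also have "\<dots> \<le> 0"
    using n card_mono[OF assms] by (simp add: divide_le_0_iff)
  finally show ?thesis by simp
qed

text \<open>The logarithm of the Markov factorization, averaged over the support. It turns a
  conditional mutual information into the difference of two unconditional ones, the form in which
  covering and binning produce rates.\<close>

lemma rv_entropy_markov:
  assumes fin: "finite (set_pmf M)"
    and "markov_chain_pmf (map_pmf (A \<bowtie> B \<bowtie> C) M)"
  shows "rv_entropy M (A \<bowtie> B \<bowtie> C) + rv_entropy M B
       = rv_entropy M (A \<bowtie> B) + rv_entropy M (B \<bowtie> C)"
proof -
  let ?\<Omega> = "set_pmf M"
  let ?abc = "A \<bowtie> B \<bowtie> C" and ?ab = "A \<bowtie> B" and ?bc = "B \<bowtie> C"
  let ?P = "pmf (map_pmf ?abc M)" and ?Q = "pmf (map_pmf ?ab M)"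
    and ?R = "pmf (map_pmf ?bc M)" and ?S = "pmf (map_pmf B M)"
  have eq: "?P (a,b,c) * ?S b = ?Q (a,b) * ?R (b,c)" for a b c
    using assms(2) by (simp add: markov_chain_pmf_def map_pmf_comp)
  have "log 2 (?P (?abc \<omega>)) + log 2 (?S (B \<omega>)) = log 2 (?Q (?ab \<omega>)) + log 2 (?R (?bc \<omega>))"
    if "\<omega> \<in> ?\<Omega>" for \<omega>
  proof -
    have "?P (?abc \<omega>) > 0" "?Q (?ab \<omega>) > 0" "?R (?bc \<omega>) > 0" "?S (B \<omega>) > 0"
      using that pmf_map_pos[of \<omega> M] by auto
    then show ?thesis
      using arg_cong[OF eq[of "A \<omega>" "B \<omega>" "C \<omega>"], of "log 2"] by (simp add: log_mult)
  qed
  then have "(\<Sum>\<omega>\<in>?\<Omega>. pmf M \<omega> * (log 2 (?P (?abc \<omega>)) + log 2 (?S (B \<omega>))))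
     = (\<Sum>\<omega>\<in>?\<Omega>. pmf M \<omega> * (log 2 (?Q (?ab \<omega>)) + log 2 (?R (?bc \<omega>))))"
    by (intro sum.cong) auto
  then show ?thesis
    unfolding rv_entropy_eq_sum[OF fin] by (simp add: distrib_left sum.distrib)
qed

lemma cond_mi_pmf_map:
  "cond_mi_pmf (map_pmf (A \<bowtie> B \<bowtie> C) M)
   = rv_entropy M (A \<bowtie> C) + rv_entropy M (B \<bowtie> C)
     - rv_entropy M (A \<bowtie> B \<bowtie> C) - rv_entropy M C"
  by (simp add: cond_mi_pmf_def rv_entropy_def map_pmf_comp)

lemma cond_mi_pmf_nonneg:
  assumes "finite (set_pmf M)"
  shows "cond_mi_pmf M \<ge> 0"
  using rv_entropy_submodular[OF assms, of "\<lambda>(a,b,c). a" "\<lambda>(a,b,c). b" "\<lambda>(a,b,c). c"]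
    cond_mi_pmf_map[of "\<lambda>(a,b,c). a" "\<lambda>(a,b,c). b" "\<lambda>(a,b,c). c" M]
  by (simp add: case_prod_beta)

section \<open>Expectations over finitely supported distributions\<close>

text \<open>A finite sum instead of an integral: all distributions in play have finite support, and
  linearity then carries no integrability conditions.\<close>

definition pexp :: "'a pmf \<Rightarrow> ('a \<Rightarrow> real) \<Rightarrow> real" where
  "pexp M h = (\<Sum>\<omega>\<in>set_pmf M. pmf M \<omega> * h \<omega>)"

lemma pexp_map: "finite (set_pmf M) \<Longrightarrow> pexp (map_pmf A M) h = pexp M (\<lambda>\<omega>. h (A \<omega>))"
  using sum_map_pmf[of M A h] by (simp add: pexp_def)

lemma pexp_cong: "(\<And>\<omega>. \<omega> \<in> set_pmf M \<Longrightarrow> h \<omega> = h' \<omega>) \<Longrightarrow> pexp M h = pexp M h'"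
  unfolding pexp_def by (intro sum.cong) auto

lemma pexp_mono: "(\<And>\<omega>. \<omega> \<in> set_pmf M \<Longrightarrow> h \<omega> \<le> h' \<omega>) \<Longrightarrow> pexp M h \<le> pexp M h'"
  unfolding pexp_def by (intro sum_mono mult_left_mono) auto

lemma pexp_nonneg: "(\<And>\<omega>. \<omega> \<in> set_pmf M \<Longrightarrow> h \<omega> \<ge> 0) \<Longrightarrow> pexp M h \<ge> 0"
  unfolding pexp_def by (intro sum_nonneg mult_nonneg_nonneg) auto

lemma pexp_add: "pexp M (\<lambda>\<omega>. h \<omega> + h' \<omega>) = pexp M h + pexp M h'"
  by (simp add: pexp_def distrib_left sum.distrib)

lemma pexp_diff: "pexp M (\<lambda>\<omega>. h \<omega> - h' \<omega>) = pexp M h - pexp M h'"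
  by (simp add: pexp_def right_diff_distrib sum_subtractf)

lemma pexp_cmult: "pexp M (\<lambda>\<omega>. c * h \<omega>) = c * pexp M h"
  by (simp add: pexp_def sum_distrib_left mult.left_commute)

lemma pexp_minus: "pexp M (\<lambda>\<omega>. - h \<omega>) = - pexp M h"
  by (simp add: pexp_def sum_negf)

lemma pexp_multc: "pexp M (\<lambda>\<omega>. h \<omega> * c) = pexp M h * c"
  by (simp add: pexp_def sum_distrib_right mult.assoc)

lemma pexp_sum: "pexp M (\<lambda>\<omega>. \<Sum>i\<in>I. h i \<omega>) = (\<Sum>i\<in>I. pexp M (h i))"
  unfolding pexp_def by (subst sum.swap) (simp add: sum_distrib_left)

lemma pexp_const: "finite (set_pmf M) \<Longrightarrow> pexp M (\<lambda>_. c) = c"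
  using sum_pmf_eq_1[of "set_pmf M" M] by (simp add: pexp_def sum_distrib_right[symmetric])

lemma pexp_pair:
  "finite (set_pmf M) \<Longrightarrow> finite (set_pmf N) \<Longrightarrow>
    pexp (pair_pmf M N) h = pexp M (\<lambda>a. pexp N (\<lambda>b. h (a, b)))"
  by (simp add: pexp_def sum.cartesian_product' pmf_pair sum_distrib_left mult.assoc)

lemma pexp_joint:
  assumes fin: "finite (set_pmf M)"
  shows "pexp M (\<lambda>\<omega>. F (A \<omega>) (B \<omega>))
     = (\<Sum>a\<in>A ` set_pmf M. \<Sum>b\<in>B ` set_pmf M. pmf (map_pmf (A \<bowtie> B) M) (a, b) * F a b)"
proof -
  have "pexp M (\<lambda>\<omega>. F (A \<omega>) (B \<omega>))
     = (\<Sum>z\<in>(A \<bowtie> B) ` set_pmf M. pmf (map_pmf (A \<bowtie> B) M) z * (case z of (a, b) \<Rightarrow> F a b))"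
    using sum_map_pmf[OF fin, of "A \<bowtie> B" "\<lambda>(a, b). F a b"] by (simp add: pexp_def)
  also have "\<dots> = (\<Sum>z\<in>A ` set_pmf M \<times> B ` set_pmf M. pmf (map_pmf (A \<bowtie> B) M) z * (case z of (a, b) \<Rightarrow> F a b))"
    using fin by (intro sum.mono_neutral_left) (auto intro!: pmf_map_outside)
  finally show ?thesis by (simp add: sum.cartesian_product case_prod_beta)
qed

lemma pexp_joint3:
  assumes fin: "finite (set_pmf M)"
  shows "pexp M (\<lambda>\<omega>. F (A \<omega>) (B \<omega>) (C \<omega>)) = (\<Sum>a\<in>A ` set_pmf M. \<Sum>b\<in>B ` set_pmf M.
     \<Sum>c\<in>C ` set_pmf M. pmf (map_pmf (A \<bowtie> B \<bowtie> C) M) (a, b, c) * F a b c)"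
proof -
  have "pexp M (\<lambda>\<omega>. F (A \<omega>) (B \<omega>) (C \<omega>)) = (\<Sum>a\<in>A ` set_pmf M. \<Sum>z\<in>(B \<bowtie> C) ` set_pmf M.
       pmf (map_pmf (A \<bowtie> B \<bowtie> C) M) (a, z) * (case z of (b, c) \<Rightarrow> F a b c))"
    using pexp_joint[OF fin, of "\<lambda>a (b, c). F a b c" A "B \<bowtie> C"] by simp
  also have "\<dots> = (\<Sum>a\<in>A ` set_pmf M. \<Sum>z\<in>B ` set_pmf M \<times> C ` set_pmf M.
       pmf (map_pmf (A \<bowtie> B \<bowtie> C) M) (a, z) * (case z of (b, c) \<Rightarrow> F a b c))"
    using fin by (intro sum.cong refl sum.mono_neutral_left) (auto intro!: pmf_map_outside)
  finally show ?thesis by (simp add: sum.cartesian_product case_prod_beta)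
qed

lemma prob_eq_pexp:
  assumes "finite (set_pmf M)"
  shows "measure_pmf.prob M {\<omega>. P \<omega>} = pexp M (\<lambda>\<omega>. of_bool (P \<omega>))"
proof -
  have "measure_pmf.prob M {\<omega>. P \<omega>} = measure_pmf.prob M ({\<omega>. P \<omega>} \<inter> set_pmf M)"
    by (simp add: measure_Int_set_pmf)
  also have "\<dots> = (\<Sum>\<omega>\<in>{\<omega>. P \<omega>} \<inter> set_pmf M. pmf M \<omega>)"
    using assms by (simp add: measure_measure_pmf_finite)
  also have "\<dots> = pexp M (\<lambda>\<omega>. of_bool (P \<omega>))"
    unfolding pexp_def using assms
    by (intro sum.mono_neutral_cong_left) auto
  finally show ?thesis .
qed

lemma pexp_le_const:
  assumes "finite (set_pmf M)" "\<And>\<omega>. \<omega> \<in> set_pmf M \<Longrightarrow> h \<omega> \<le> c"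
  shows "pexp M h \<le> c"
  using pexp_mono[of M h "\<lambda>_. c"] assms by (simp add: pexp_const)

text \<open>The probabilistic method: some codebook performs at least as well as the average
  one.\<close>

lemma pexp_attained:
  assumes "finite (set_pmf M)"
  obtains \<omega> where "\<omega> \<in> set_pmf M" "h \<omega> \<le> pexp M h"
proof (rule ccontr)
  assume "\<not> thesis"
  then have less: "\<And>\<omega>. \<omega> \<in> set_pmf M \<Longrightarrow> pexp M h < h \<omega>" using that by force
  have "(\<Sum>\<omega>\<in>set_pmf M. pmf M \<omega> * pexp M h) < (\<Sum>\<omega>\<in>set_pmf M. pmf M \<omega> * h \<omega>)"
    using assms less set_pmf_not_empty
    by (intro sum_strict_mono mult_strict_left_mono) (auto simp: pmf_positive)
  then have "pexp M (\<lambda>_. pexp M h) < pexp M h" by (simp add: pexp_def)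
  then show False using assms by (simp add: pexp_const)
qed

text \<open>The variance of the absolute value is nonnegative.\<close>

lemma pexp_abs_le_sqrt:
  assumes "finite (set_pmf M)"
  shows "pexp M (\<lambda>\<omega>. \<bar>h \<omega>\<bar>) \<le> sqrt (pexp M (\<lambda>\<omega>. (h \<omega>)\<^sup>2))"
proof (rule real_le_rsqrt)
  let ?m = "pexp M (\<lambda>\<omega>. \<bar>h \<omega>\<bar>)"
  have "0 \<le> pexp M (\<lambda>\<omega>. (\<bar>h \<omega>\<bar> - ?m)\<^sup>2)" by (intro pexp_nonneg) auto
  also have "(\<lambda>\<omega>. (\<bar>h \<omega>\<bar> - ?m)\<^sup>2) = (\<lambda>\<omega>. ((h \<omega>)\<^sup>2 - 2 * ?m * \<bar>h \<omega>\<bar>) + ?m\<^sup>2)"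
    by (auto simp: power2_eq_square algebra_simps)
  also have "pexp M \<dots> = pexp M (\<lambda>\<omega>. (h \<omega>)\<^sup>2) - 2 * ?m * ?m + ?m\<^sup>2"
    using assms by (simp add: pexp_add pexp_diff pexp_cmult pexp_const)
  finally show "?m\<^sup>2 \<le> pexp M (\<lambda>\<omega>. (h \<omega>)\<^sup>2)" by (simp add: power2_eq_square)
qed

lemma entropy_pmf_eq_pexp: "entropy_pmf M = pexp M (\<lambda>a. - log 2 (pmf M a))"
  by (simp add: entropy_pmf_def pexp_def sum_negf)

lemma rv_entropy_eq_pexp:
  "finite (set_pmf M) \<Longrightarrow> rv_entropy M A = pexp M (\<lambda>\<omega>. - log 2 (pmf (map_pmf A M) (A \<omega>)))"
  by (simp add: rv_entropy_eq_sum pexp_def sum_negf)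

section \<open>Memoryless sources\<close>

lemma iid_pmf_Suc_pair: "iid_pmf (Suc n) p = map_pmf (\<lambda>(a, as). a # as) (pair_pmf p (iid_pmf n p))"
  by (simp add: pair_pmf_def map_bind_pmf map_pmf_def bind_assoc_pmf bind_return_pmf)

lemma set_iid_pmf: "set_pmf (iid_pmf n p) = {xs. length xs = n \<and> set xs \<subseteq> set_pmf p}"
proof (induction n)
  case (Suc n)
  show ?case
    unfolding iid_pmf_Suc_pair set_map_pmf set_pair_pmf Suc
    by (auto simp: image_iff length_Suc_conv)
qed auto

lemma finite_set_iid_pmf: "finite (set_pmf p) \<Longrightarrow> finite (set_pmf (iid_pmf n p))"
  using finite_lists_length_eq[of "set_pmf p" n] by (simp add: set_iid_pmf conj_commute)

lemma pmf_iid_pmf_Cons: "pmf (iid_pmf (Suc n) p) (x # xs) = pmf p x * pmf (iid_pmf n p) xs"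
proof -
  have "inj (\<lambda>(a, as). a # as)" by (auto simp: inj_def)
  from pmf_map_inj'[OF this, of _ "(x, xs)"] show ?thesis
    unfolding iid_pmf_Suc_pair by (simp add: pmf_pair)
qed

lemma pmf_iid_pmf: "length xs = n \<Longrightarrow> pmf (iid_pmf n p) xs = (\<Prod>i<n. pmf p (xs ! i))"
proof (induction n arbitrary: xs)
  case (Suc n)
  then obtain y ys where "xs = y # ys" "length ys = n" by (auto simp: length_Suc_conv)
  with Suc.IH[of ys] show ?case
    by (simp only: pmf_iid_pmf_Cons prod.lessThan_Suc_shift) simp
qed auto

lemma map_iid_pmf: "map_pmf (map h) (iid_pmf n p) = iid_pmf n (map_pmf h p)"
proof (induction n)
  case (Suc n)
  show ?case by (simp add: map_bind_pmf bind_map_pmf map_pmf_comp flip: Suc)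
qed simp

text \<open>Separates one letter from its past and its future as independent parts, which is what
  the single-letter converse exploits.\<close>

lemma iid_pmf_split:
  "iid_pmf (i + Suc j) p
   = map_pmf (\<lambda>(as, x, bs). as @ x # bs) (pair_pmf (iid_pmf i p) (pair_pmf p (iid_pmf j p)))"
proof (induction i)
  case 0
  show ?case by (simp add: iid_pmf_Suc_pair pair_return_pmf1 map_pmf_comp case_prod_unfold del: iid_pmf.simps(2))
next
  case (Suc i)
  have "iid_pmf (Suc i + Suc j) p = map_pmf (\<lambda>(a, as). a # as) (pair_pmf p (iid_pmf (i + Suc j) p))"
    by (simp add: iid_pmf_Suc_pair del: iid_pmf.simps(2))
  also have "\<dots> = map_pmf (\<lambda>(as, x, bs). as @ x # bs) (pair_pmf (iid_pmf (Suc i) p) (pair_pmf p (iid_pmf j p)))"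
    unfolding Suc iid_pmf_Suc_pair[of i]
    by (simp add: pair_map_pmf1 pair_map_pmf2 map_pmf_comp pair_pair_pmf case_prod_beta apfst_def apsnd_def map_prod_def)
  finally show ?case .
qed

lemma entropy_iid_pmf:
  assumes "finite (set_pmf p)"
  shows "entropy_pmf (iid_pmf n p) = real n * entropy_pmf p"
proof (induction n)
  case 0
  show ?case by (simp add: entropy_pmf_def)
next
  case (Suc n)
  note fin = finite_set_iid_pmf[OF assms, of n]
  have "entropy_pmf (iid_pmf (Suc n) p)
      = pexp (pair_pmf p (iid_pmf n p)) (\<lambda>(a,as). - log 2 (pmf p a) + - log 2 (pmf (iid_pmf n p) as))"
    unfolding entropy_pmf_eq_pexp[of "iid_pmf (Suc n) p"]
    unfolding iid_pmf_Suc_pair[of n p] using assms fin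
    by (subst pexp_map, simp, intro pexp_cong)
       (auto simp flip: iid_pmf_Suc_pair simp: pmf_iid_pmf_Cons log_mult set_pmf_iff simp del: iid_pmf.simps)
  also have "\<dots> = entropy_pmf p + entropy_pmf (iid_pmf n p)"
    using assms fin by (simp add: pexp_pair pexp_add pexp_diff pexp_minus pexp_const entropy_pmf_eq_pexp del: iid_pmf.simps)
  finally show ?case using Suc by (simp add: algebra_simps)
qed

text \<open>Both moments are carried through one induction, because the cross term in the step for
  the square vanishes by the claim about the mean.\<close>

lemma iid_pmf_second_moment:
  assumes fin: "finite (set_pmf p)" and mean: "pexp p h = 0"
  shows "pexp (iid_pmf n p) (\<lambda>xs. (\<Sum>x\<leftarrow>xs. h x)\<^sup>2) = real n * pexp p (\<lambda>x. (h x)\<^sup>2)"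
    and "pexp (iid_pmf n p) (\<lambda>xs. \<Sum>x\<leftarrow>xs. h x) = 0"
proof (induction n)
  case 0
  { case 1 show ?case by (simp add: pexp_def) }
  { case 2 show ?case by (simp add: pexp_def) }
next
  case (Suc n)
  note fin' = finite_set_iid_pmf[OF fin, of n]
  { case 1
    have "pexp (iid_pmf (Suc n) p) (\<lambda>xs. (\<Sum>x\<leftarrow>xs. h x)\<^sup>2)
        = pexp (pair_pmf p (iid_pmf n p)) (\<lambda>(x,xs). (h x)\<^sup>2 + (2 * h x * (\<Sum>x\<leftarrow>xs. h x) + (\<Sum>x\<leftarrow>xs. h x)\<^sup>2))"
      unfolding iid_pmf_Suc_pair using fin fin'
      by (subst pexp_map, simp, intro pexp_cong)
         (auto simp: power2_eq_square algebra_simps)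
    also have "\<dots> = pexp p (\<lambda>x. (h x)\<^sup>2) + pexp (iid_pmf n p) (\<lambda>xs. (\<Sum>x\<leftarrow>xs. h x)\<^sup>2)"
      using fin fin' Suc(2) by (simp add: pexp_pair pexp_add pexp_const pexp_cmult del: iid_pmf.simps)
    finally show ?case using Suc(1) by (simp add: algebra_simps) }
  { case 2
    have "pexp (iid_pmf (Suc n) p) (\<lambda>xs. \<Sum>x\<leftarrow>xs. h x)
        = pexp (pair_pmf p (iid_pmf n p)) (\<lambda>(x,xs). h x + (\<Sum>x\<leftarrow>xs. h x))"
      unfolding iid_pmf_Suc_pair using fin fin'
      by (subst pexp_map, simp, intro pexp_cong) auto
    then show ?case
      using fin fin' Suc(2) mean by (simp add: pexp_pair pexp_add pexp_const del: iid_pmf.simps) }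
qed

text \<open>Chebyshev's inequality for the centred sum, whose second moment grows only linearly in
  \<open>n\<close>.\<close>

lemma iid_pmf_weak_law:
  assumes fin: "finite (set_pmf p)" and "\<delta> > 0" "\<epsilon> > 0"
  shows "\<exists>N. \<forall>n\<ge>N. measure_pmf.prob (iid_pmf n p)
           {xs. \<bar>(\<Sum>x\<leftarrow>xs. h x) - real n * pexp p h\<bar> \<ge> real n * \<delta>} \<le> \<epsilon>"
proof -
  define k where "k x = h x - pexp p h" for x
  define v where "v = pexp p (\<lambda>x. (k x)\<^sup>2)"
  have mean: "pexp p k = 0" using fin by (simp add: k_def[abs_def] pexp_diff pexp_const)
  obtain N0 where N0: "real N0 \<ge> v / (\<delta>\<^sup>2 * \<epsilon>)" using real_arch_simple by blast
  have "measure_pmf.prob (iid_pmf n p)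
      {xs. \<bar>(\<Sum>x\<leftarrow>xs. h x) - real n * pexp p h\<bar> \<ge> real n * \<delta>} \<le> \<epsilon>" if n: "n \<ge> max 1 N0" for n
  proof -
    note fin' = finite_set_iid_pmf[OF fin, of n]
    have pos: "real n * \<delta> > 0" using n assms by simp
    have "measure_pmf.prob (iid_pmf n p) {xs. \<bar>(\<Sum>x\<leftarrow>xs. h x) - real n * pexp p h\<bar> \<ge> real n * \<delta>}
       = pexp (iid_pmf n p) (\<lambda>xs. of_bool (\<bar>(\<Sum>x\<leftarrow>xs. h x) - real n * pexp p h\<bar> \<ge> real n * \<delta>))"
      using fin' by (rule prob_eq_pexp)
    also have "\<dots> \<le> pexp (iid_pmf n p) (\<lambda>xs. (\<Sum>x\<leftarrow>xs. k x)\<^sup>2 / (real n * \<delta>)\<^sup>2)"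
    proof (intro pexp_mono)
      fix xs assume "xs \<in> set_pmf (iid_pmf n p)"
      then have "length xs = n" by (simp add: set_iid_pmf)
      then have eq: "(\<Sum>x\<leftarrow>xs. k x) = (\<Sum>x\<leftarrow>xs. h x) - real n * pexp p h"
        by (simp add: k_def sum_list_subtractf sum_list_triv)
      show "of_bool (\<bar>(\<Sum>x\<leftarrow>xs. h x) - real n * pexp p h\<bar> \<ge> real n * \<delta>)
          \<le> (\<Sum>x\<leftarrow>xs. k x)\<^sup>2 / (real n * \<delta>)\<^sup>2"
      proof (cases "\<bar>(\<Sum>x\<leftarrow>xs. h x) - real n * pexp p h\<bar> \<ge> real n * \<delta>")
        case True
        then have "(real n * \<delta>)\<^sup>2 \<le> (\<Sum>x\<leftarrow>xs. k x)\<^sup>2"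
          unfolding eq using pos by (metis abs_le_square_iff abs_of_pos)
        then show ?thesis using pos n assms by (simp add: le_divide_eq)
      qed auto
    qed
    also have "\<dots> = real n * v / (real n * \<delta>)\<^sup>2"
      using iid_pmf_second_moment(1)[OF fin mean, of n]
      by (simp only: divide_inverse pexp_multc v_def)
    also have "\<dots> = v / \<delta>\<^sup>2 / real n" using n by (simp add: power2_eq_square)
    also have "\<dots> \<le> \<epsilon>"
    proof -
      have "v / (\<delta>\<^sup>2 * \<epsilon>) \<le> real n" using N0 n by (smt (verit) max.boundedE of_nat_mono)
      then have "v / \<delta>\<^sup>2 \<le> real n * \<epsilon>" using assms by (simp add: field_simps)
      moreover have "real n > 0" using n by simp
      ultimately show ?thesis by (simp only: pos_divide_le_eq mult.commute)
    qed
    finally show ?thesis .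
  qed
  then show ?thesis by blast
qed

section \<open>Covering and binning\<close>

lemma pexp_of_bool_eq: "finite (set_pmf M) \<Longrightarrow> pexp M (\<lambda>\<omega>. of_bool (\<omega> = a)) = pmf M a"
  using prob_eq_pexp[of M "\<lambda>\<omega>. \<omega> = a"] by (simp add: measure_pmf_single)

section \<open>Random codebooks and soft covering\<close>

lemma finite_set_Pi_pmf:
  assumes "finite I" "finite (set_pmf r)"
  shows "finite (set_pmf (Pi_pmf I d (\<lambda>_. r)))"
  using assms by (intro finite_subset[OF set_Pi_pmf_subset'] finite_PiE_dflt) auto

text \<open>Pairwise independence of codewords drives both later estimates: the variance of an
  empirical mean and the collision of two words in one bin.\<close>

lemma Pi_pmf_two_components:
  assumes "finite I" "i \<in> I" "j \<in> I" "i \<noteq> j"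
  shows "map_pmf (\<lambda>c. (c i, c j)) (Pi_pmf I d (\<lambda>_. r)) = pair_pmf r r"
proof -
  let ?I = "I - {i}"
  have I: "I = insert i ?I" "finite ?I" "i \<notin> ?I" "j \<in> ?I" using assms by auto
  have "map_pmf (\<lambda>c. (c i, c j)) (Pi_pmf (insert i ?I) d (\<lambda>_. r))
      = map_pmf (\<lambda>(y, c). (y, c j)) (pair_pmf r (Pi_pmf ?I d (\<lambda>_. r)))"
    unfolding Pi_pmf_insert[OF I(2,3)] map_pmf_comp
    using assms by (intro map_pmf_cong refl) auto
  also have "\<dots> = pair_pmf (map_pmf (\<lambda>y. y) r) (map_pmf (\<lambda>c. c j) (Pi_pmf ?I d (\<lambda>_. r)))"
    by (rule map_pair)
  also have "\<dots> = pair_pmf r r"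
    using I by (simp add: Pi_pmf_component)
  finally show ?thesis using I(1) by simp
qed

lemma pexp_Pi_component:
  assumes "finite I" "i \<in> I" "finite (set_pmf r)"
  shows "pexp (Pi_pmf I d (\<lambda>_. r)) (\<lambda>c. h (c i)) = pexp r h"
proof -
  have "pexp r h = pexp (map_pmf (\<lambda>c. c i) (Pi_pmf I d (\<lambda>_. r))) h"
    using assms by (simp add: Pi_pmf_component)
  then show ?thesis
    using pexp_map[OF finite_set_Pi_pmf[OF assms(1,3)], of "\<lambda>c. c i" d h] by simp
qed

lemma pexp_Pi_two_components:
  assumes "finite I" "i \<in> I" "j \<in> I" "i \<noteq> j" "finite (set_pmf r)"
  shows "pexp (Pi_pmf I d (\<lambda>_. r)) (\<lambda>c. h (c i) (c j)) = pexp r (\<lambda>a. pexp r (h a))"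
proof -
  have "pexp r (\<lambda>a. pexp r (h a)) = pexp (pair_pmf r r) (\<lambda>(a,b). h a b)"
    using assms by (simp add: pexp_pair)
  also have "\<dots> = pexp (map_pmf (\<lambda>c. (c i, c j)) (Pi_pmf I d (\<lambda>_. r))) (\<lambda>(a,b). h a b)"
    using assms by (simp add: Pi_pmf_two_components)
  finally show ?thesis
    using assms by (simp add: pexp_map finite_set_Pi_pmf)
qed

text \<open>The off-diagonal products of centred terms have mean zero, which leaves \<open>K\<close>
  variances over the square of \<open>K\<close>; a variance is at most the second moment.\<close>

lemma empirical_mean_variance:
  fixes a :: "'w \<Rightarrow> real"
  assumes fin: "finite (set_pmf r)" and K: "K > 0"
  shows "pexp (Pi_pmf {..<K} d (\<lambda>_. r)) (\<lambda>c. ((\<Sum>m<K. a (c m)) / real K - pexp r a)\<^sup>2)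
       \<le> pexp r (\<lambda>w. (a w)\<^sup>2) / real K"
proof -
  let ?C = "Pi_pmf {..<K} d (\<lambda>_. r)"
  define b where "b w = a w - pexp r a" for w
  have mean: "pexp r b = 0" using fin by (simp add: b_def[abs_def] pexp_diff pexp_const)
  have var: "pexp r (\<lambda>w. (b w)\<^sup>2) \<le> pexp r (\<lambda>w. (a w)\<^sup>2)"
  proof -
    have "(\<lambda>w. (b w)\<^sup>2) = (\<lambda>w. ((a w)\<^sup>2 - 2 * pexp r a * a w) + (pexp r a)\<^sup>2)"
      by (auto simp: b_def power2_eq_square algebra_simps)
    then have "pexp r (\<lambda>w. (b w)\<^sup>2) = pexp r (\<lambda>w. (a w)\<^sup>2) - 2 * pexp r a * pexp r a + (pexp r a)\<^sup>2"
      using fin by (simp add: pexp_add pexp_diff pexp_cmult pexp_const)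
    also have "\<dots> = pexp r (\<lambda>w. (a w)\<^sup>2) - (pexp r a)\<^sup>2" by (simp add: power2_eq_square)
    finally show ?thesis by simp
  qed
  have cross: "pexp ?C (\<lambda>c. b (c m) * b (c m')) = (if m = m' then pexp r (\<lambda>w. (b w)\<^sup>2) else 0)"
    if "m < K" "m' < K" for m m'
    using that fin mean pexp_Pi_component[of "{..<K}" m r d "\<lambda>w. (b w)\<^sup>2"]
      pexp_Pi_two_components[of "{..<K}" m m' r d "\<lambda>w w'. b w * b w'"]
    by (auto simp: power2_eq_square pexp_cmult pexp_multc pexp_const)
  have "(\<Sum>m<K. a (c m)) / real K - pexp r a = (\<Sum>m<K. b (c m)) / real K" for c
    using K by (simp add: b_def sum_subtractf field_simps)
  then have "pexp ?C (\<lambda>c. ((\<Sum>m<K. a (c m)) / real K - pexp r a)\<^sup>2)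
      = pexp ?C (\<lambda>c. (\<Sum>m<K. \<Sum>m'<K. b (c m) * b (c m')) / (real K)\<^sup>2)"
    by (simp add: power_divide power2_eq_square sum_product)
  also have "\<dots> = (\<Sum>m<K. \<Sum>m'<K. pexp ?C (\<lambda>c. b (c m) * b (c m'))) / (real K)\<^sup>2"
    by (simp add: divide_inverse pexp_multc pexp_sum)
  also have "\<dots> = (\<Sum>m<K. \<Sum>m'<K. if m = m' then pexp r (\<lambda>w. (b w)\<^sup>2) else 0) / (real K)\<^sup>2"
    by (simp add: cross)
  also have "\<dots> = pexp r (\<lambda>w. (b w)\<^sup>2) / real K"
    by (simp add: power2_eq_square)
  also have "\<dots> \<le> pexp r (\<lambda>w. (a w)\<^sup>2) / real K"
    using var by (simp add: divide_right_mono)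
  finally show ?thesis .
qed

text \<open>If a word is picked uniformly from the codebook and the source is drawn from its
  conditional law, the source law is an empirical mean with expectation \<open>pA\<close>. Only the
  missing mass is estimated. Cutting off pairs of density ratio above \<open>G\<close> bounds the
  second moment at \<open>s\<close> by \<open>G\<close> times the square of \<open>pA s\<close>, so
  the standard deviations sum to \<open>sqrt (G / real K)\<close>; the mass cut off is the
  probability in the bound. The map \<open>V\<close> allows codewords to carry further data, later a
  bin label.\<close>

lemma soft_covering:
  fixes A :: "'o \<Rightarrow> 's" and C :: "'o \<Rightarrow> 'v" and V :: "'w \<Rightarrow> 'v"
  assumes fin: "finite (set_pmf \<Omega>)" and finr: "finite (set_pmf r)" and K: "K > 0" and G: "G > 0"
    and r: "map_pmf V r = map_pmf C \<Omega>"
  defines "pA \<equiv> pmf (map_pmf A \<Omega>)" and "pC \<equiv> pmf (map_pmf C \<Omega>)"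
    and "pAC \<equiv> pmf (map_pmf (A \<bowtie> C) \<Omega>)"
  shows "pexp (Pi_pmf {..<K} d (\<lambda>_. r))
       (\<lambda>c. \<Sum>s\<in>A ` set_pmf \<Omega>. max 0 (pA s - (\<Sum>m<K. pAC (s, V (c m)) / pC (V (c m))) / real K))
     \<le> measure_pmf.prob \<Omega> {\<omega>. pAC (A \<omega>, C \<omega>) > G * pA (A \<omega>) * pC (C \<omega>)} + sqrt (G / real K)"
proof -
  let ?C = "Pi_pmf {..<K} d (\<lambda>_. r)"
  define ok where "ok s v \<longleftrightarrow> pAC (s,v) \<le> G * pA s * pC v" for s v
  define k where "k s v = pAC (s,v) / pC v" for s v
  \<comment> \<open>The conditional probability \<open>k\<close> truncated at the density ratio
    \<open>G\<close>; without the cut its second moment is not controlled.\<close>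
  define k1 where "k1 s v = (if ok s v then k s v else 0)" for s v
  have nn: "k s v \<ge> 0" for s v by (simp add: k_def pAC_def pC_def)
  have pC0: "pC v \<ge> 0" "pA s \<ge> 0" for v s by (simp_all add: pC_def pA_def)
  have k1: "0 \<le> k1 s v" "k1 s v \<le> k s v" for s v using nn by (auto simp: k1_def)
  have k1G: "k1 s v \<le> G * pA s" for s v
  proof (cases "ok s v \<and> pC v > 0")
    case True
    then show ?thesis by (simp add: k1_def k_def ok_def pos_divide_le_eq)
  next
    case False
    then show ?thesis using pC0(1)[of v] pC0(2)[of s] G
      by (auto simp: k1_def k_def dest: antisym)
  qed
  have finC: "finite (set_pmf ?C)" using finr by (intro finite_set_Pi_pmf) auto
  have mean_r: "pexp r (\<lambda>w. h (V w)) = (\<Sum>v\<in>C ` set_pmf \<Omega>. pC v * h v)" for h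
    using pexp_map[OF finr, of V h] by (simp add: r pexp_def pC_def)
  have pC_pos: "pC v > 0" if "v \<in> C ` set_pmf \<Omega>" for v
    using that pmf_map_pos unfolding pC_def by fastforce
  have mean_k: "pexp r (\<lambda>w. k s (V w)) = pA s" for s
  proof -
    have "pexp r (\<lambda>w. k s (V w)) = (\<Sum>v\<in>C ` set_pmf \<Omega>. pAC (s,v))"
      unfolding mean_r using pC_pos by (intro sum.cong refl) (auto simp: k_def less_imp_neq[symmetric])
    also have "\<dots> = (\<Sum>v\<in>C ` set_pmf \<Omega>. pmf (map_pmf (C \<bowtie> A) \<Omega>) (v,s))"
      unfolding pAC_def pmf_map by (intro sum.cong refl arg_cong[of _ _ "measure_pmf.prob \<Omega>"]) auto
    also have "\<dots> = pA s" unfolding pA_def by (rule sum_pmf_marginal[OF fin])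
    finally show ?thesis .
  qed
  define gap where "gap s = (\<Sum>v\<in>C ` set_pmf \<Omega>. pAC (s,v) * of_bool (\<not> ok s v))" for s
  have mean_k1: "pexp r (\<lambda>w. k1 s (V w)) = pA s - gap s" for s
  proof -
    have "pexp r (\<lambda>w. k s (V w)) - pexp r (\<lambda>w. k1 s (V w)) = gap s"
      unfolding mean_r gap_def sum_subtractf[symmetric] using pC_pos
      by (intro sum.cong refl) (auto simp: k_def k1_def less_imp_neq[symmetric])
    then show ?thesis by (simp add: mean_k)
  qed
  have gap_sum: "(\<Sum>s\<in>A ` set_pmf \<Omega>. gap s) = measure_pmf.prob \<Omega> {\<omega>. pAC (A \<omega>, C \<omega>) > G * pA (A \<omega>) * pC (C \<omega>)}"
    using pexp_joint[OF fin, of "\<lambda>s v. of_bool (\<not> ok s v)" A C]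
    by (simp add: gap_def pAC_def prob_eq_pexp[OF fin] ok_def not_le)
  have dev: "pexp ?C (\<lambda>c. \<bar>(\<Sum>m<K. k1 s (V (c m))) / real K - (pA s - gap s)\<bar>) \<le> pA s * sqrt (G / real K)" for s
  proof -
    \<comment> \<open>One factor of the square is bounded by \<open>G * pA s\<close>, the other is
      averaged to \<open>pA s\<close>.\<close>
    have "pexp r (\<lambda>w. (k1 s (V w))\<^sup>2) \<le> pexp r (\<lambda>w. (G * pA s) * k s (V w))"
      unfolding power2_eq_square using k1 k1G G pC0
      by (intro pexp_mono mult_mono) auto
    also have "\<dots> = G * (pA s)\<^sup>2" by (simp add: pexp_cmult mean_k power2_eq_square)
    finally have sq: "pexp r (\<lambda>w. (k1 s (V w))\<^sup>2) \<le> G * (pA s)\<^sup>2" .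
    have "pexp ?C (\<lambda>c. \<bar>(\<Sum>m<K. k1 s (V (c m))) / real K - (pA s - gap s)\<bar>)
       \<le> sqrt (pexp ?C (\<lambda>c. ((\<Sum>m<K. k1 s (V (c m))) / real K - (pA s - gap s))\<^sup>2))"
      by (rule pexp_abs_le_sqrt[OF finC])
    also have "\<dots> \<le> sqrt (pexp r (\<lambda>w. (k1 s (V w))\<^sup>2) / real K)"
      using empirical_mean_variance[OF finr K, of d "\<lambda>w. k1 s (V w)"] by (simp add: mean_k1)
    also have "\<dots> \<le> sqrt (G * (pA s)\<^sup>2 / real K)"
      using sq by (simp add: divide_right_mono)
    also have "\<dots> = pA s * sqrt (G / real K)"
      using pC0 by (simp add: real_sqrt_mult real_sqrt_divide)
    finally show ?thesis .
  qed
  \<comment> \<open>Truncation only lowers the empirical mean, so the missing mass is at most the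
    deviation of the truncated mean plus the mass \<open>gap s\<close> cut off.\<close>
  have "pexp ?C (\<lambda>c. \<Sum>s\<in>A ` set_pmf \<Omega>. max 0 (pA s - (\<Sum>m<K. k s (V (c m))) / real K))
     \<le> pexp ?C (\<lambda>c. \<Sum>s\<in>A ` set_pmf \<Omega>. \<bar>(\<Sum>m<K. k1 s (V (c m))) / real K - (pA s - gap s)\<bar> + gap s)"
  proof (intro pexp_mono sum_mono)
    fix c s
    have "(\<Sum>m<K. k1 s (V (c m))) / real K \<le> (\<Sum>m<K. k s (V (c m))) / real K"
      by (intro divide_right_mono sum_mono k1) auto
    moreover have "gap s \<ge> 0" unfolding gap_def by (intro sum_nonneg) (auto simp: pAC_def)
    ultimately show "max 0 (pA s - (\<Sum>m<K. k s (V (c m))) / real K)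
        \<le> \<bar>(\<Sum>m<K. k1 s (V (c m))) / real K - (pA s - gap s)\<bar> + gap s" by linarith
  qed
  also have "\<dots> = (\<Sum>s\<in>A ` set_pmf \<Omega>. pexp ?C (\<lambda>c. \<bar>(\<Sum>m<K. k1 s (V (c m))) / real K - (pA s - gap s)\<bar>))
      + (\<Sum>s\<in>A ` set_pmf \<Omega>. gap s)"
    using finC by (simp add: pexp_sum pexp_add pexp_const sum.distrib)
  also have "\<dots> \<le> (\<Sum>s\<in>A ` set_pmf \<Omega>. pA s * sqrt (G / real K)) + (\<Sum>s\<in>A ` set_pmf \<Omega>. gap s)"
    by (intro add_mono sum_mono dev order_refl)
  also have "(\<Sum>s\<in>A ` set_pmf \<Omega>. pA s * sqrt (G / real K)) = sqrt (G / real K)"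
    using sum_pmf_eq_1[of "A ` set_pmf \<Omega>" "map_pmf A \<Omega>"] fin
    by (simp add: sum_distrib_right[symmetric] pA_def)
  finally show ?thesis by (simp add: gap_sum k_def add.commute)
qed

text \<open>
  Encoder and decoder share a codebook of \<open>K\<close> words with random bin labels. Given a source
  value, the encoder transmits only the bin of the best word. Soft covering shows that this
  is as good as if the word were drawn first and the source then generated from it, and under that
  law the triple (source, side information, word) has exactly the target distribution.
\<close>

lemma one_shot_covering_binning:
  fixes A :: "'o \<Rightarrow> 's" and B :: "'o \<Rightarrow> 't" and C :: "'o \<Rightarrow> 'v"
  assumes fin: "finite (set_pmf \<Omega>)" and K: "K > 0" and N: "N > 0" and G1: "G1 > 0" and G2: "G2 > 0"
  defines "pA \<equiv> pmf (map_pmf A \<Omega>)" and "pB \<equiv> pmf (map_pmf B \<Omega>)" and "pC \<equiv> pmf (map_pmf C \<Omega>)"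
    and "pAC \<equiv> pmf (map_pmf (A \<bowtie> C) \<Omega>)"
    and "pAB \<equiv> pmf (map_pmf (A \<bowtie> B) \<Omega>)"
    and "pCB \<equiv> pmf (map_pmf (C \<bowtie> B) \<Omega>)"
    and "pABC \<equiv> pmf (map_pmf (A \<bowtie> B \<bowtie> C) \<Omega>)"
  assumes markov: "\<And>s t v. pABC (s,t,v) * pA s = pAB (s,t) * pAC (s,v)"
  shows "\<exists>enc bin dec. (\<forall>s. bin s < N) \<and>
     measure_pmf.prob \<Omega> {\<omega>. dec (bin (A \<omega>)) (B \<omega>) \<noteq> enc (A \<omega>) \<or> Bad (A \<omega>) (B \<omega>) (enc (A \<omega>))}
     \<le> measure_pmf.prob \<Omega> {\<omega>. Bad (A \<omega>) (B \<omega>) (C \<omega>)}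
       + measure_pmf.prob \<Omega> {\<omega>. pAC (A \<omega>, C \<omega>) > G1 * pA (A \<omega>) * pC (C \<omega>)} + sqrt (G1 / real K)
       + measure_pmf.prob \<Omega> {\<omega>. pCB (C \<omega>, B \<omega>) \<le> G2 * pC (C \<omega>) * pB (B \<omega>)} + real K / (real N * G2)"
    (is "\<exists>enc bin dec. _ \<and> _ \<le> ?bad + ?cov + _ + ?low + _")
proof -
  let ?SA = "A ` set_pmf \<Omega>" and ?SB = "B ` set_pmf \<Omega>" and ?SC = "C ` set_pmf \<Omega>"
  \<comment> \<open>A codeword together with an independent uniform bin label.\<close>
  define r where "r = pair_pmf (map_pmf C \<Omega>) (pmf_of_set {..<N})"
  define Cb where "Cb = Pi_pmf {..<K} undefined (\<lambda>_. r)"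
  have Nne: "{..<N} \<noteq> {}" using N by auto
  have setr: "set_pmf r = ?SC \<times> {..<N}" using Nne by (simp add: r_def)
  have finr: "finite (set_pmf r)" using fin by (simp add: setr)
  have finC: "finite (set_pmf Cb)" unfolding Cb_def using finr by (intro finite_set_Pi_pmf) auto
  have fstr: "map_pmf fst r = map_pmf C \<Omega>" by (simp add: r_def map_fst_pair_pmf)
  have pexp_fst: "pexp r (\<lambda>w. h (fst w)) = pexp (map_pmf C \<Omega>) h" for h
    using pexp_map[OF finr, of fst h] by (simp add: fstr)
  define test where "test v t \<longleftrightarrow> pCB (v,t) > G2 * pC v * pB t" for v t
  \<comment> \<open>Any index of the announced bin that passes the density test may be returned.
    Only the word is compared afterwards, so two indices carrying the same word cause no
    error.\<close>
  define dec where "dec c j t = fst (c (SOME m. m < K \<and> snd (c m) = j \<and> test (fst (c m)) t))"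
    for c :: "nat \<Rightarrow> 'v \<times> nat" and j t
  define fail where "fail c m s t \<longleftrightarrow> dec c (snd (c m)) t \<noteq> fst (c m) \<or> Bad s t (fst (c m))" for c m s t
  \<comment> \<open>The conditional law of source and side information given the word.\<close>
  define \<kappa> where "\<kappa> s t v = pABC (s,t,v) / pC v" for s t v
  \<comment> \<open>The conditional probability of failure, given the source value \<open>s\<close>,
    if index \<open>m\<close> is used.\<close>
  define l where "l c s m = (\<Sum>t\<in>?SB. pAB (s,t) / pA s * of_bool (fail c m s t))" for c s m
  define Q where "Q c s = (\<Sum>m<K. pAC (s, fst (c m)) / pC (fst (c m))) / real K" for c :: "nat \<Rightarrow> 'v \<times> nat" and s
  \<comment> \<open>A minimizer replaces random selection of the index: it is at least as good as
    any mixture of indices, in particular the one weighted by the likelihoods, and it makes the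
    encoder deterministic.\<close>
  define best where "best c s = arg_min_on (l c s) {..<K}" for c s
  have best: "best c s < K" "m < K \<Longrightarrow> l c s (best c s) \<le> l c s m" for c s m
    using arg_min_if_finite(1)[of "{..<K}" "l c s"] arg_min_least[of "{..<K}" m "l c s"] K
    by (auto simp: best_def)
  have nn: "pA s \<ge> 0" "pB t \<ge> 0" "pC v \<ge> 0" "pAB (s,t) \<ge> 0" "pABC (s,t,v) \<ge> 0" "\<kappa> s t v \<ge> 0"
    "pAC (s,v) \<ge> 0" for s t v
    by (simp_all add: pA_def pB_def pC_def pAB_def pABC_def \<kappa>_def pAC_def)
  have pA_pos: "pA s > 0" if "s \<in> ?SA" for s
    using that pmf_map_pos unfolding pA_def by fastforce
  have pB_pos: "pB s > 0" if "s \<in> ?SB" for s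
    using that pmf_map_pos unfolding pB_def by fastforce
  have pC_pos: "pC s > 0" if "s \<in> ?SC" for s
    using that pmf_map_pos unfolding pC_def by fastforce
  have pAB_sum: "(\<Sum>t\<in>?SB. pAB (s,t)) = pA s" for s
  proof -
    have "(\<Sum>t\<in>?SB. pAB (s,t)) = (\<Sum>t\<in>?SB. pmf (map_pmf (B \<bowtie> A) \<Omega>) (t,s))"
      unfolding pAB_def pmf_map by (intro sum.cong refl arg_cong[of _ _ "measure_pmf.prob \<Omega>"]) auto
    then show ?thesis unfolding pA_def by (simp add: sum_pmf_marginal[OF fin])
  qed
  have l01: "l c s m \<ge> 0" "s \<in> ?SA \<Longrightarrow> l c s m \<le> 1" for c s m
  proof -
    show "l c s m \<ge> 0" unfolding l_def using nn by (intro sum_nonneg) auto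
    assume s: "s \<in> ?SA"
    have "l c s m \<le> (\<Sum>t\<in>?SB. pAB (s,t) / pA s)"
      unfolding l_def using nn by (intro sum_mono mult_right_le_one_le) auto
    also have "\<dots> = 1" using pA_pos[OF s] by (simp add: sum_divide_distrib[symmetric] pAB_sum)
    finally show "l c s m \<le> 1" .
  qed
  \<comment> \<open>Drawing the word first and then \<open>(s,t)\<close> from
    \<open>\<kappa>\<close> reproduces the law of \<open>(A,B,C)\<close>, so averages over a random
    codeword are ideal averages.\<close>
  have avg: "pexp (map_pmf C \<Omega>) (\<lambda>v. \<Sum>s\<in>?SA. \<Sum>t\<in>?SB. \<kappa> s t v * F s t v) = pexp \<Omega> (\<lambda>\<omega>. F (A \<omega>) (B \<omega>) (C \<omega>))"
    for F
  proof -
    have "pexp (map_pmf C \<Omega>) (\<lambda>v. \<Sum>s\<in>?SA. \<Sum>t\<in>?SB. \<kappa> s t v * F s t v)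
        = (\<Sum>v\<in>?SC. \<Sum>s\<in>?SA. \<Sum>t\<in>?SB. pC v * (\<kappa> s t v * F s t v))"
      by (simp add: pexp_def pC_def sum_distrib_left)
    also have "\<dots> = (\<Sum>v\<in>?SC. \<Sum>s\<in>?SA. \<Sum>t\<in>?SB. pABC (s,t,v) * F s t v)"
      using pC_pos by (intro sum.cong refl) (auto simp: \<kappa>_def less_imp_neq[symmetric])
    also have "\<dots> = (\<Sum>s\<in>?SA. \<Sum>t\<in>?SB. \<Sum>v\<in>?SC. pABC (s,t,v) * F s t v)"
      by (subst sum.swap) (intro sum.cong refl sum.swap)
    also have "\<dots> = pexp \<Omega> (\<lambda>\<omega>. F (A \<omega>) (B \<omega>) (C \<omega>))"
      unfolding pABC_def by (rule pexp_joint3[OF fin, symmetric])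
    finally show ?thesis .
  qed
  \<comment> \<open>Change of measure: wherever the test passes, \<open>pC v\<close> is below
    \<open>pCB (v,t) / (G2 * pB t)\<close>, and these bounds sum to \<open>1 / G2\<close>.\<close>
  have pass: "pexp (map_pmf C \<Omega>) (\<lambda>v. of_bool (test v t)) \<le> 1 / G2" if t: "t \<in> ?SB" for t
  proof -
    have "pexp (map_pmf C \<Omega>) (\<lambda>v. of_bool (test v t)) = (\<Sum>v\<in>?SC. pC v * of_bool (test v t))"
      by (simp add: pexp_def pC_def)
    also have "\<dots> \<le> (\<Sum>v\<in>?SC. pCB (v,t) / (G2 * pB t))"
    proof (intro sum_mono)
      fix v
      show "pC v * of_bool (test v t) \<le> pCB (v,t) / (G2 * pB t)"
        using pB_pos[OF t] G2 by (auto simp: test_def pos_le_divide_eq pCB_def mult_ac)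
    qed
    also have "\<dots> = 1 / G2"
      using pB_pos[OF t] sum_pmf_marginal[OF fin, of C B t]
      by (simp add: sum_divide_distrib[symmetric] pCB_def pB_def)
    finally show ?thesis .
  qed
  \<comment> \<open>The competing word is independent of the true one: it shares the bin with
    probability \<open>1 / N\<close> and passes the test with probability at most
    \<open>1 / G2\<close>.\<close>
  have collide: "pexp Cb (\<lambda>c. \<Sum>s\<in>?SA. \<Sum>t\<in>?SB. \<kappa> s t (fst (c m)) *
       of_bool (snd (c m') = snd (c m) \<and> test (fst (c m')) t)) \<le> 1 / (real N * G2)"
    if m: "m < K" "m' < K" "m \<noteq> m'" for m m'
  proof -
    have inner: "pexp r (\<lambda>w'. of_bool (snd w' = b \<and> test (fst w') t)) \<le> 1 / (real N * G2)"
      if "b < N" "t \<in> ?SB" for b t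
    proof -
      have "pexp r (\<lambda>w'. of_bool (snd w' = b \<and> test (fst w') t))
         = pexp (map_pmf C \<Omega>) (\<lambda>v. of_bool (test v t) * pexp (pmf_of_set {..<N}) (\<lambda>b'. of_bool (b' = b)))"
        unfolding r_def using fin Nne
        by (subst pexp_pair) (auto simp: pexp_cmult[symmetric] of_bool_conj mult.commute)
      also have "pexp (pmf_of_set {..<N}) (\<lambda>b'. of_bool (b' = b)) = 1 / real N"
        using that Nne by (simp add: pexp_of_bool_eq)
      also have "pexp (map_pmf C \<Omega>) (\<lambda>v. of_bool (test v t) * (1 / real N))
          = pexp (map_pmf C \<Omega>) (\<lambda>v. of_bool (test v t)) * (1 / real N)"
        by (rule pexp_multc)
      also have "\<dots> \<le> 1 / G2 * (1 / real N)"
        using pass[OF that(2)] by (intro mult_right_mono) auto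
      finally show ?thesis by (simp add: mult.commute)
    qed
    have "pexp Cb (\<lambda>c. \<Sum>s\<in>?SA. \<Sum>t\<in>?SB. \<kappa> s t (fst (c m)) *
         of_bool (snd (c m') = snd (c m) \<and> test (fst (c m')) t))
       = pexp r (\<lambda>w. pexp r (\<lambda>w'. \<Sum>s\<in>?SA. \<Sum>t\<in>?SB. \<kappa> s t (fst w) *
         of_bool (snd w' = snd w \<and> test (fst w') t)))"
      unfolding Cb_def using m finr by (intro pexp_Pi_two_components) auto
    also have "\<dots> = pexp r (\<lambda>w. \<Sum>s\<in>?SA. \<Sum>t\<in>?SB. \<kappa> s t (fst w) *
         pexp r (\<lambda>w'. of_bool (snd w' = snd w \<and> test (fst w') t)))"
      by (simp only: pexp_sum pexp_cmult)
    also have "\<dots> \<le> pexp r (\<lambda>w. \<Sum>s\<in>?SA. \<Sum>t\<in>?SB. \<kappa> s t (fst w) * (1 / (real N * G2)))"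
      using nn by (intro pexp_mono sum_mono mult_left_mono inner) (auto simp: setr)
    also have "\<dots> = pexp \<Omega> (\<lambda>\<omega>. 1 / (real N * G2))"
      using avg[of "\<lambda>_ _ _. 1 / (real N * G2)"]
        pexp_fst[of "\<lambda>v. \<Sum>s\<in>?SA. \<Sum>t\<in>?SB. \<kappa> s t v * (1 / (real N * G2))"] by simp
    also have "\<dots> = 1 / (real N * G2)" by (simp add: pexp_const[OF fin])
    finally show ?thesis .
  qed
  \<comment> \<open>A failure has three causes: the triple is bad, the true word fails the test, or
    another index of the same bin passes it.\<close>
  have fail_le: "of_bool (fail c m s t) \<le> of_bool (Bad s t (fst (c m))) + of_bool (\<not> test (fst (c m)) t)
       + (\<Sum>m'\<in>{..<K} - {m}. of_bool (snd (c m') = snd (c m) \<and> test (fst (c m')) t) :: real)"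
    if m: "m < K" for c m s t
  proof (cases "fail c m s t \<and> \<not> Bad s t (fst (c m)) \<and> test (fst (c m)) t")
    case True
    define m' where "m' = (SOME m'. m' < K \<and> snd (c m') = snd (c m) \<and> test (fst (c m')) t)"
    have m': "m' < K \<and> snd (c m') = snd (c m) \<and> test (fst (c m')) t"
      unfolding m'_def by (rule someI[of _ m]) (use True m in auto)
    have "fst (c m') \<noteq> fst (c m)" using True by (auto simp: fail_def dec_def m'_def)
    then have mem: "m' \<in> {..<K} - {m}" using m' by auto
    have "1 \<le> (\<Sum>m'\<in>{..<K} - {m}. of_bool (snd (c m') = snd (c m) \<and> test (fst (c m')) t) :: real)"
      using member_le_sum[OF mem, of "\<lambda>m'. of_bool (snd (c m') = snd (c m) \<and> test (fst (c m')) t) :: real"] m'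
      by simp
    then show ?thesis using True by simp
  next
    case False
    have "(\<Sum>m'\<in>{..<K} - {m}. of_bool (snd (c m') = snd (c m) \<and> test (fst (c m')) t) :: real) \<ge> 0"
      by (intro sum_nonneg) auto
    with False show ?thesis by auto
  qed
  have single: "pexp Cb (\<lambda>c. \<Sum>s\<in>?SA. \<Sum>t\<in>?SB. \<kappa> s t (fst (c m)) * F s t (fst (c m)))
      = pexp \<Omega> (\<lambda>\<omega>. F (A \<omega>) (B \<omega>) (C \<omega>))" if "m < K" for m F
  proof -
    have "pexp Cb (\<lambda>c. \<Sum>s\<in>?SA. \<Sum>t\<in>?SB. \<kappa> s t (fst (c m)) * F s t (fst (c m)))
       = pexp r (\<lambda>w. \<Sum>s\<in>?SA. \<Sum>t\<in>?SB. \<kappa> s t (fst w) * F s t (fst w))"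
      unfolding Cb_def using that finr
      by (intro pexp_Pi_component[where h = "\<lambda>w. \<Sum>s\<in>?SA. \<Sum>t\<in>?SB. \<kappa> s t (fst w) * F s t (fst w)"]) auto
    then show ?thesis
      using pexp_fst[of "\<lambda>v. \<Sum>s\<in>?SA. \<Sum>t\<in>?SB. \<kappa> s t v * F s t v"] avg[of F] by simp
  qed
  have per_m: "pexp Cb (\<lambda>c. \<Sum>s\<in>?SA. \<Sum>t\<in>?SB. \<kappa> s t (fst (c m)) * of_bool (fail c m s t))
      \<le> ?bad + ?low + real K / (real N * G2)" if m: "m < K" for m
  proof -
    have "pexp Cb (\<lambda>c. \<Sum>s\<in>?SA. \<Sum>t\<in>?SB. \<kappa> s t (fst (c m)) * of_bool (fail c m s t))
      \<le> pexp Cb (\<lambda>c. \<Sum>s\<in>?SA. \<Sum>t\<in>?SB. \<kappa> s t (fst (c m)) * (of_bool (Bad s t (fst (c m)))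
          + of_bool (\<not> test (fst (c m)) t)
          + (\<Sum>m'\<in>{..<K} - {m}. of_bool (snd (c m') = snd (c m) \<and> test (fst (c m')) t))))"
      using nn by (intro pexp_mono sum_mono mult_left_mono fail_le m) auto
    also have "\<dots> = pexp Cb (\<lambda>c. (\<Sum>s\<in>?SA. \<Sum>t\<in>?SB. \<kappa> s t (fst (c m)) * of_bool (Bad s t (fst (c m))))
         + (\<Sum>s\<in>?SA. \<Sum>t\<in>?SB. \<kappa> s t (fst (c m)) * of_bool (\<not> test (fst (c m)) t))
         + (\<Sum>m'\<in>{..<K} - {m}. \<Sum>s\<in>?SA. \<Sum>t\<in>?SB. \<kappa> s t (fst (c m)) *
               of_bool (snd (c m') = snd (c m) \<and> test (fst (c m')) t)))"
    proof (intro pexp_cong)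
      fix c
      let ?g = "\<lambda>s t m'. \<kappa> s t (fst (c m)) * of_bool (snd (c m') = snd (c m) \<and> test (fst (c m')) t) :: real"
      have "(\<Sum>s\<in>?SA. \<Sum>t\<in>?SB. \<Sum>m'\<in>{..<K} - {m}. ?g s t m') = (\<Sum>s\<in>?SA. \<Sum>m'\<in>{..<K} - {m}. \<Sum>t\<in>?SB. ?g s t m')"
        by (intro sum.cong refl sum.swap)
      also have "\<dots> = (\<Sum>m'\<in>{..<K} - {m}. \<Sum>s\<in>?SA. \<Sum>t\<in>?SB. ?g s t m')" by (rule sum.swap)
      finally show "(\<Sum>s\<in>?SA. \<Sum>t\<in>?SB. \<kappa> s t (fst (c m)) * (of_bool (Bad s t (fst (c m)))
          + of_bool (\<not> test (fst (c m)) t)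
          + (\<Sum>m'\<in>{..<K} - {m}. of_bool (snd (c m') = snd (c m) \<and> test (fst (c m')) t))))
        = (\<Sum>s\<in>?SA. \<Sum>t\<in>?SB. \<kappa> s t (fst (c m)) * of_bool (Bad s t (fst (c m))))
         + (\<Sum>s\<in>?SA. \<Sum>t\<in>?SB. \<kappa> s t (fst (c m)) * of_bool (\<not> test (fst (c m)) t))
         + (\<Sum>m'\<in>{..<K} - {m}. \<Sum>s\<in>?SA. \<Sum>t\<in>?SB. ?g s t m')"
        by (simp only: distrib_left sum_distrib_left sum.distrib)
    qed
    also have "\<dots> = ?bad + ?low + (\<Sum>m'\<in>{..<K} - {m}. pexp Cb (\<lambda>c. \<Sum>s\<in>?SA. \<Sum>t\<in>?SB. \<kappa> s t (fst (c m)) *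
               of_bool (snd (c m') = snd (c m) \<and> test (fst (c m')) t)))"
      using single[OF m, of "\<lambda>s t v. of_bool (Bad s t v)"] single[OF m, of "\<lambda>s t v. of_bool (\<not> test v t)"]
      by (simp add: pexp_add pexp_sum[of _ _ "{..<K} - {m}"] prob_eq_pexp[OF fin] test_def not_less)
    also have "\<dots> \<le> ?bad + ?low + (\<Sum>m'\<in>{..<K} - {m}. 1 / (real N * G2))"
      using m by (intro add_left_mono sum_mono collide) auto
    also have "\<dots> \<le> ?bad + ?low + real K / (real N * G2)"
      using m N G2 by (auto simp: divide_right_mono)
    finally show ?thesis .
  qed
  define loss where "loss c = (\<Sum>s\<in>?SA. max 0 (pA s - Q c s))
      + (\<Sum>m<K. \<Sum>s\<in>?SA. \<Sum>t\<in>?SB. \<kappa> s t (fst (c m)) * of_bool (fail c m s t)) / real K" for c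
  have "pexp Cb loss \<le> (?cov + sqrt (G1 / real K)) + (?bad + ?low + real K / (real N * G2))"
  proof -
    have "pexp Cb (\<lambda>c. \<Sum>s\<in>?SA. max 0 (pA s - Q c s)) \<le> ?cov + sqrt (G1 / real K)"
      using soft_covering[OF fin finr K G1 fstr, of undefined A]
      by (simp add: Cb_def Q_def pA_def pC_def pAC_def)
    moreover have "(\<Sum>m<K. pexp Cb (\<lambda>c. \<Sum>s\<in>?SA. \<Sum>t\<in>?SB. \<kappa> s t (fst (c m)) * of_bool (fail c m s t)))
        \<le> (\<Sum>m<K. ?bad + ?low + real K / (real N * G2))"
      by (intro sum_mono per_m) auto
    then have "(\<Sum>m<K. pexp Cb (\<lambda>c. \<Sum>s\<in>?SA. \<Sum>t\<in>?SB. \<kappa> s t (fst (c m)) * of_bool (fail c m s t))) / real K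
        \<le> ?bad + ?low + real K / (real N * G2)"
      using K by (simp add: pos_divide_le_eq mult.commute)
    moreover have "pexp Cb loss = pexp Cb (\<lambda>c. \<Sum>s\<in>?SA. max 0 (pA s - Q c s))
      + (\<Sum>m<K. pexp Cb (\<lambda>c. \<Sum>s\<in>?SA. \<Sum>t\<in>?SB. \<kappa> s t (fst (c m)) * of_bool (fail c m s t))) / real K"
      unfolding loss_def by (simp only: pexp_add divide_inverse pexp_multc pexp_sum[of _ _ "{..<K}"])
    ultimately show ?thesis by linarith
  qed
  moreover obtain c where c: "c \<in> set_pmf Cb" "loss c \<le> pexp Cb loss"
    using pexp_attained[OF finC] .
  ultimately have loss_c: "loss c \<le> (?cov + sqrt (G1 / real K)) + (?bad + ?low + real K / (real N * G2))"
    by linarith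
  \<comment> \<open>The rate constraint on \<open>bin\<close> holds because the chosen codebook lies
    in the support of the random one.\<close>
  have lab: "snd (c m) < N" if "m < K" for m
  proof -
    have "c \<in> PiE_dflt {..<K} undefined (set_pmf \<circ> (\<lambda>_. r))"
      using c(1) set_Pi_pmf_subset'[of "{..<K}" undefined "\<lambda>_. r"] by (auto simp: Cb_def)
    then show ?thesis using that by (auto simp: PiE_dflt_def setr mem_Times_iff)
  qed
  define enc where "enc s = fst (c (best c s))" for s
  define bin where "bin s = snd (c (best c s))" for s
  have "measure_pmf.prob \<Omega> {\<omega>. dec c (bin (A \<omega>)) (B \<omega>) \<noteq> enc (A \<omega>) \<or> Bad (A \<omega>) (B \<omega>) (enc (A \<omega>))}
     = pexp \<Omega> (\<lambda>\<omega>. of_bool (fail c (best c (A \<omega>)) (A \<omega>) (B \<omega>)))"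
    by (simp add: prob_eq_pexp[OF fin] fail_def enc_def bin_def)
  also have "\<dots> = (\<Sum>s\<in>?SA. pA s * l c s (best c s))"
  proof -
    have "pexp \<Omega> (\<lambda>\<omega>. of_bool (fail c (best c (A \<omega>)) (A \<omega>) (B \<omega>)))
       = (\<Sum>s\<in>?SA. \<Sum>t\<in>?SB. pAB (s,t) * of_bool (fail c (best c s) s t))"
      unfolding pAB_def by (rule pexp_joint[OF fin, of "\<lambda>s t. of_bool (fail c (best c s) s t)"])
    also have "\<dots> = (\<Sum>s\<in>?SA. pA s * l c s (best c s))"
      unfolding l_def sum_distrib_left using pA_pos by (intro sum.cong refl) (auto simp: less_imp_neq[symmetric])
    finally show ?thesis .
  qed
  also have "\<dots> \<le> (\<Sum>s\<in>?SA. max 0 (pA s - Q c s)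
      + (\<Sum>m<K. \<Sum>t\<in>?SB. \<kappa> s t (fst (c m)) * of_bool (fail c m s t)) / real K)"
  proof (intro sum_mono)
    fix s assume s: "s \<in> ?SA"
    \<comment> \<open>The Markov condition enters here: the law of the source given the word,
      followed by that of the side information given the source, is the joint law given the
      word.\<close>
    have k: "pAC (s, v) / pC v * (pAB (s,t) / pA s) = \<kappa> s t v" for t v
    proof -
      have "pABC (s,t,v) = pAB (s,t) * pAC (s,v) / pA s"
        using markov[of s t v] pA_pos[OF s] by (simp add: eq_divide_eq)
      then show ?thesis by (simp add: \<kappa>_def mult_ac)
    qed
    \<comment> \<open>The mass of \<open>s\<close> exceeding \<open>Q c s\<close> is charged with
      failure probability 1; on the covered mass the best index is compared with each index
      \<open>m\<close> at its own weight.\<close>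
    have "pA s * l c s (best c s) = (pA s - Q c s) * l c s (best c s) + Q c s * l c s (best c s)"
      by (simp add: left_diff_distrib)
    also have "(pA s - Q c s) * l c s (best c s) \<le> max 0 (pA s - Q c s) * l c s (best c s)"
      using l01(1) by (intro mult_right_mono) auto
    also have "\<dots> \<le> max 0 (pA s - Q c s) * 1"
      using l01(2)[OF s] by (intro mult_left_mono) auto
    also have "Q c s * l c s (best c s)
       = (\<Sum>m<K. pAC (s, fst (c m)) / pC (fst (c m)) * l c s (best c s)) / real K"
      by (simp add: Q_def sum_distrib_right)
    also have "\<dots> \<le> (\<Sum>m<K. pAC (s, fst (c m)) / pC (fst (c m)) * l c s m) / real K"
      using nn by (intro divide_right_mono sum_mono mult_left_mono best(2)) auto
    also have "\<dots> = (\<Sum>m<K. \<Sum>t\<in>?SB. \<kappa> s t (fst (c m)) * of_bool (fail c m s t)) / real K"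
      by (simp add: l_def sum_distrib_left k[symmetric] mult.assoc)
    finally show "pA s * l c s (best c s) \<le> max 0 (pA s - Q c s)
      + (\<Sum>m<K. \<Sum>t\<in>?SB. \<kappa> s t (fst (c m)) * of_bool (fail c m s t)) / real K" by simp
  qed
  also have "\<dots> = loss c"
    unfolding loss_def by (subst sum.swap[of _ ?SA]) (simp add: sum.distrib sum_divide_distrib)
  finally have "measure_pmf.prob \<Omega> {\<omega>. dec c (bin (A \<omega>)) (B \<omega>) \<noteq> enc (A \<omega>) \<or> Bad (A \<omega>) (B \<omega>) (enc (A \<omega>))}
     \<le> ?bad + ?cov + sqrt (G1 / real K) + ?low + real K / (real N * G2)"
    using loss_c by linarith
  moreover have "\<forall>s. bin s < N" using lab best(1) by (auto simp: bin_def)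
  ultimately show ?thesis by blast
qed

section \<open>Achievability\<close>

lemma prob_mono_support:
  assumes "\<And>\<omega>. \<omega> \<in> set_pmf M \<Longrightarrow> P \<omega> \<Longrightarrow> Q \<omega>"
  shows "measure_pmf.prob M {\<omega>. P \<omega>} \<le> measure_pmf.prob M {\<omega>. Q \<omega>}"
  using assms by (intro measure_pmf.finite_measure_mono_AE) (auto simp: AE_measure_pmf_iff)

section \<open>Product laws of tuples of words, and information densities\<close>

lemma pmf_iid_pmf_map_pair:
  assumes "length as = n" "length bs = n"
  shows "pmf (map_pmf (map A \<bowtie> map B) (iid_pmf n q)) (as, bs)
       = (\<Prod>i<n. pmf (map_pmf (A \<bowtie> B) q) (as ! i, bs ! i))"
proof -
  let ?u = "\<lambda>z. (map fst z, map snd z)"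
  have inj: "inj ?u" by (rule injI) (metis zip_map_fst_snd prod.inject)
  have "map_pmf (map A \<bowtie> map B) (iid_pmf n q)
      = map_pmf ?u (map_pmf (map (A \<bowtie> B)) (iid_pmf n q))"
    by (simp add: map_pmf_comp o_def)
  also have "\<dots> = map_pmf ?u (iid_pmf n (map_pmf (A \<bowtie> B) q))"
    by (simp add: map_iid_pmf)
  finally have "pmf (map_pmf (map A \<bowtie> map B) (iid_pmf n q)) (?u (zip as bs))
      = pmf (iid_pmf n (map_pmf (A \<bowtie> B) q)) (zip as bs)"
    using pmf_map_inj'[OF inj] by simp
  then show ?thesis using assms by (simp add: pmf_iid_pmf)
qed

lemma pmf_iid_pmf_map:
  assumes "length as = n"
  shows "pmf (map_pmf (map A) (iid_pmf n q)) as = (\<Prod>i<n. pmf (map_pmf A q) (as ! i))"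
  using assms by (simp add: map_iid_pmf pmf_iid_pmf)

lemma pmf_iid_pmf_map_triple:
  assumes "length as = n" "length bs = n" "length cs = n"
  shows "pmf (map_pmf (map A \<bowtie> map B \<bowtie> map C) (iid_pmf n q)) (as, bs, cs)
       = (\<Prod>i<n. pmf (map_pmf (A \<bowtie> B \<bowtie> C) q) (as ! i, bs ! i, cs ! i))"
proof -
  let ?u = "\<lambda>(as, z). (as, map fst z, map snd z)"
  have inj: "inj ?u"
  proof (rule injI)
    fix a b assume "?u a = ?u b"
    then show "a = b" by (cases a; cases b) (auto intro: pair_list_eqI)
  qed
  have "pmf (map_pmf (map A \<bowtie> map B \<bowtie> map C) (iid_pmf n q)) (?u (as, zip bs cs))
      = pmf (map_pmf ?u (map_pmf (\<lambda>l. (map A l, map (B \<bowtie> C) l)) (iid_pmf n q))) (?u (as, zip bs cs))"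
    by (simp add: map_pmf_comp o_def)
  also have "\<dots> = pmf (map_pmf (\<lambda>l. (map A l, map (B \<bowtie> C) l)) (iid_pmf n q)) (as, zip bs cs)"
    by (rule pmf_map_inj'[OF inj])
  finally show ?thesis using assms by (simp add: pmf_iid_pmf_map_pair)
qed

text \<open>For words of length \<open>n\<close> the identity holds letter by letter; for any other
  lengths both sides vanish.\<close>

lemma iid_markov:
  assumes markov: "\<And>s t v. pmf (map_pmf (A \<bowtie> B \<bowtie> C) q) (s,t,v) * pmf (map_pmf A q) s
     = pmf (map_pmf (A \<bowtie> B) q) (s,t) * pmf (map_pmf (A \<bowtie> C) q) (s,v)"
  shows "pmf (map_pmf (map A \<bowtie> map B \<bowtie> map C) (iid_pmf n q)) (ss,ts,vs)
       * pmf (map_pmf (map A) (iid_pmf n q)) ss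
     = pmf (map_pmf (map A \<bowtie> map B) (iid_pmf n q)) (ss,ts)
       * pmf (map_pmf (map A \<bowtie> map C) (iid_pmf n q)) (ss,vs)"
proof (cases "length ss = n \<and> length ts = n \<and> length vs = n")
  case True
  then show ?thesis
    by (simp add: pmf_iid_pmf_map pmf_iid_pmf_map_pair pmf_iid_pmf_map_triple
        prod.distrib[symmetric] markov)
next
  case False
  then have "(ss,ts,vs) \<notin> (map A \<bowtie> map B \<bowtie> map C) ` set_pmf (iid_pmf n q)"
    and "(ss,ts) \<notin> (map A \<bowtie> map B) ` set_pmf (iid_pmf n q)
       \<or> (ss,vs) \<notin> (map A \<bowtie> map C) ` set_pmf (iid_pmf n q)"
    by (auto simp: set_iid_pmf)
  then show ?thesis by (auto simp: pmf_map_outside)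
qed

lemma log_prod_lessThan:
  fixes n :: nat and h :: "nat \<Rightarrow> real"
  shows "(\<And>i. i < n \<Longrightarrow> h i > 0) \<Longrightarrow> log 2 (\<Prod>i<n. h i) = (\<Sum>i<n. log 2 (h i))"
  by (induction n) (auto simp: log_mult prod_pos less_imp_neq[symmetric])

text \<open>The pointwise mutual information. Its mean is I(A;B), and it is additive over the
  letters of a memoryless source, so the weak law locates the density ratios of the one-shot
  bound.\<close>

definition info_density :: "'o pmf \<Rightarrow> ('o \<Rightarrow> 'a) \<Rightarrow> ('o \<Rightarrow> 'b) \<Rightarrow> 'o \<Rightarrow> real" where
  "info_density q A B \<omega> = log 2 (pmf (map_pmf (A \<bowtie> B) q) (A \<omega>, B \<omega>))
     - log 2 (pmf (map_pmf A q) (A \<omega>)) - log 2 (pmf (map_pmf B q) (B \<omega>))"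

lemma pexp_info_density:
  assumes "finite (set_pmf q)"
  shows "pexp q (info_density q A B) = rv_entropy q A + rv_entropy q B - rv_entropy q (A \<bowtie> B)"
  unfolding info_density_def[abs_def] by (simp add: rv_entropy_eq_pexp[OF assms] pexp_diff pexp_minus)

lemma info_density_iid:
  assumes l: "l \<in> set_pmf (iid_pmf n q)"
  shows "log 2 (pmf (map_pmf (map A \<bowtie> map B) (iid_pmf n q)) (map A l, map B l))
     = (\<Sum>x\<leftarrow>l. info_density q A B x) + log 2 (pmf (map_pmf (map A) (iid_pmf n q)) (map A l))
       + log 2 (pmf (map_pmf (map B) (iid_pmf n q)) (map B l))"
proof -
  have len: "length l = n" and mem: "\<And>i. i < n \<Longrightarrow> l ! i \<in> set_pmf q"
    using l by (auto simp: set_iid_pmf)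
  have pos1: "pmf (map_pmf A q) (A (l ! i)) > 0" "pmf (map_pmf B q) (B (l ! i)) > 0"
    "pmf (map_pmf (A \<bowtie> B) q) (A (l ! i), B (l ! i)) > 0" if "i < n" for i
    using pmf_map_pos[OF mem[OF that]] by blast+
  show ?thesis
    using len pos1
    by (simp add: pmf_iid_pmf_map pmf_iid_pmf_map_pair log_prod_lessThan info_density_def
        sum_list_sum_nth atLeast0LessThan sum_subtractf)
qed

lemma zero_less_pmf_iid_map:
  assumes l: "l \<in> set_pmf (iid_pmf n q)"
  shows "pmf (map_pmf (map A) (iid_pmf n q)) (map A l) > 0"
    and "pmf (map_pmf (map A \<bowtie> map B) (iid_pmf n q)) (map A l, map B l) > 0"
  using pmf_map_pos[OF l, of "map A"] pmf_map_pos[OF l, of "map A \<bowtie> map B"] by auto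

section \<open>Rates, message counts and the asymptotic coding theorems\<close>

lemma powr_neg_eventually_le:
  fixes \<delta> e :: real
  assumes "\<delta> > 0" "e > 0"
  shows "\<exists>N. \<forall>n\<ge>N. 2 powr (- (real n * \<delta>)) \<le> e"
proof -
  have "2 powr (- \<delta>) < 1" using assms by (simp add: powr_less_one)
  then obtain N where N: "(2 powr (- \<delta>)) ^ N < e"
    using real_arch_pow_inv[OF assms(2)] by blast
  have "2 powr (- (real n * \<delta>)) \<le> e" if "n \<ge> N" for n
  proof -
    have "2 powr (- (real n * \<delta>)) = (2 powr (- \<delta>)) ^ n"
      by (simp add: powr_realpow[symmetric] powr_powr mult.commute)
    also have "\<dots> \<le> (2 powr (- \<delta>)) ^ N"
      using that \<open>2 powr (- \<delta>) < 1\<close> by (intro power_decreasing) auto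
    finally show ?thesis using N by simp
  qed
  then show ?thesis by blast
qed

lemma num_msgs_ge_half:
  assumes "R \<ge> 0"
  shows "real (num_msgs n R) \<ge> 2 powr (real n * R) / 2" "num_msgs n R > 0"
proof -
  have ge: "2 powr (real n * R) \<ge> 1" using assms by (simp add: ge_one_powr_ge_zero)
  then have fl: "\<lfloor>2 powr (real n * R)\<rfloor> \<ge> 1" by simp
  then show "num_msgs n R > 0" by (simp add: num_msgs_def)
  have "real (num_msgs n R) = of_int \<lfloor>2 powr (real n * R)\<rfloor>"
    using ge by (simp add: num_msgs_def)
  also have "\<dots> \<ge> 2 powr (real n * R) / 2"
  proof -
    have "real_of_int \<lfloor>2 powr (real n * R)\<rfloor> \<ge> 1" using fl by linarith
    then show ?thesis using real_of_int_floor_add_one_gt[of "2 powr (real n * R)"] by linarith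
  qed
  finally show "real (num_msgs n R) \<ge> 2 powr (real n * R) / 2" .
qed

text \<open>In the rate condition H(C) has cancelled: the threshold is I(A;C) - I(C;B), the cost of
  covering minus the gain of binning. The threshold for \<open>n\<close> is chosen before
  \<open>Bad\<close>, so that \<open>Bad\<close> may depend on \<open>n\<close> and on another code
  of that length.\<close>

lemma wyner_ziv_coding:
  fixes A :: "'o \<Rightarrow> 's" and B :: "'o \<Rightarrow> 't" and C :: "'o \<Rightarrow> 'v"
  assumes fin: "finite (set_pmf q)"
    and markov: "\<And>s t v. pmf (map_pmf (A \<bowtie> B \<bowtie> C) q) (s,t,v) * pmf (map_pmf A q) s
     = pmf (map_pmf (A \<bowtie> B) q) (s,t) * pmf (map_pmf (A \<bowtie> C) q) (s,v)"
    and R0: "R \<ge> 0"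
    and R: "R > rv_entropy q A - rv_entropy q (A \<bowtie> C) - rv_entropy q B + rv_entropy q (C \<bowtie> B)"
    and eps: "\<epsilon> > 0"
  shows "\<exists>N. \<forall>n\<ge>N. \<forall>Bad. \<exists>enc bin dec. (\<forall>s. bin s < num_msgs n R) \<and>
     measure_pmf.prob (iid_pmf n q) {l. dec (bin (map A l)) (map B l) \<noteq> enc (map A l)
         \<or> Bad (map A l) (map B l) (enc (map A l))}
     \<le> measure_pmf.prob (iid_pmf n q) {l. Bad (map A l) (map B l) (map C l)} + \<epsilon>"
proof -
  define I1 where "I1 = rv_entropy q A + rv_entropy q C - rv_entropy q (A \<bowtie> C)"
  define I2 where "I2 = rv_entropy q C + rv_entropy q B - rv_entropy q (C \<bowtie> B)"
  \<comment> \<open>Five portions of slack: two make the codebook rate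
    \<open>I1 + 2 * \<delta>\<close>, one lowers the test threshold to \<open>I2 - \<delta>\<close>,
    and two remain for the collision bound.\<close>
  define \<delta> where "\<delta> = (R - I1 + I2) / 5"
  have \<delta>: "\<delta> > 0" using R by (simp add: \<delta>_def I1_def I2_def)
  have I1: "I1 \<ge> 0" using rv_entropy_subadditive[OF fin, of A C] by (simp add: I1_def)
  have Rd: "R = I1 - I2 + 5 * \<delta>" by (simp add: \<delta>_def field_simps)
  have mean: "pexp q (info_density q A C) = I1" "pexp q (info_density q C B) = I2"
    by (simp_all add: pexp_info_density[OF fin] I1_def I2_def)
  obtain N1 where N1: "\<forall>n\<ge>N1. measure_pmf.prob (iid_pmf n q)
      {l. \<bar>(\<Sum>x\<leftarrow>l. info_density q A C x) - real n * I1\<bar> \<ge> real n * \<delta>} \<le> \<epsilon> / 4"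
    using iid_pmf_weak_law[OF fin \<delta>, of "\<epsilon> / 4" "info_density q A C"] eps mean by auto
  obtain N2 where N2: "\<forall>n\<ge>N2. measure_pmf.prob (iid_pmf n q)
      {l. \<bar>(\<Sum>x\<leftarrow>l. info_density q C B x) - real n * I2\<bar> \<ge> real n * \<delta>} \<le> \<epsilon> / 4"
    using iid_pmf_weak_law[OF fin \<delta>, of "\<epsilon> / 4" "info_density q C B"] eps mean by auto
  obtain N3 where N3: "\<forall>n\<ge>N3. 2 powr (- (real n * \<delta>)) \<le> (\<epsilon> / 4)\<^sup>2"
    using powr_neg_eventually_le[OF \<delta>, of "(\<epsilon> / 4)\<^sup>2"] eps by auto
  \<comment> \<open>Rounding \<open>K\<close> up and the number of messages down costs at most a
    factor of 4, hence \<open>\<epsilon> / 16\<close> in place of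
    \<open>\<epsilon> / 4\<close>.\<close>
  obtain N4 where N4: "\<forall>n\<ge>N4. 2 powr (- (real n * \<delta>)) \<le> \<epsilon> / 16"
    using powr_neg_eventually_le[OF \<delta>, of "\<epsilon> / 16"] eps by auto
  have "\<exists>enc bin dec. (\<forall>s. bin s < num_msgs n R) \<and>
     measure_pmf.prob (iid_pmf n q) {l. dec (bin (map A l)) (map B l) \<noteq> enc (map A l)
         \<or> Bad (map A l) (map B l) (enc (map A l))}
     \<le> measure_pmf.prob (iid_pmf n q) {l. Bad (map A l) (map B l) (map C l)} + \<epsilon>"
    if n: "n \<ge> N1" "n \<ge> N2" "n \<ge> N3" "n \<ge> N4" for n Bad
  proof -
    let ?O = "iid_pmf n q"
    let ?pA = "\<lambda>l. pmf (map_pmf (map A) ?O) (map A l)" and ?pB = "\<lambda>l. pmf (map_pmf (map B) ?O) (map B l)"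
      and ?pC = "\<lambda>l. pmf (map_pmf (map C) ?O) (map C l)"
      and ?pAC = "\<lambda>l. pmf (map_pmf (map A \<bowtie> map C) ?O) (map A l, map C l)"
      and ?pCB = "\<lambda>l. pmf (map_pmf (map C \<bowtie> map B) ?O) (map C l, map B l)"
    define G1 where "G1 = 2 powr (real n * (I1 + \<delta>))"
    define G2 where "G2 = 2 powr (real n * (I2 - \<delta>))"
    \<comment> \<open>The codebook rate exceeds the exponent of \<open>G1\<close> by
      \<open>\<delta>\<close>, so that \<open>G1 / real K\<close> decays.\<close>
    define y where "y = 2 powr (real n * (I1 + 2 * \<delta>))"
    define K where "K = nat \<lceil>y\<rceil>"
    define N where "N = num_msgs n R"
    have y1: "y \<ge> 1" unfolding y_def using I1 \<delta> by (intro ge_one_powr_ge_zero) auto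
    have K: "real K \<ge> y" "real K \<le> 2 * y" "K > 0"
      using y1 unfolding K_def by linarith+
    note N = num_msgs_ge_half[OF R0, of n, folded N_def]
    have G: "G1 > 0" "G2 > 0" by (simp_all add: G1_def G2_def)
    have cov: "measure_pmf.prob ?O {l. ?pAC l
        > G1 * ?pA l * ?pC l} \<le> \<epsilon> / 4"
    proof (rule order_trans[OF prob_mono_support N1[rule_format, OF n(1)]])
      fix l assume l: "l \<in> set_pmf ?O"
        and gt: "?pAC l
        > G1 * ?pA l * ?pC l"
      note pos = zero_less_pmf_iid_map[OF l]
      have "log 2 (G1 * ?pA l * ?pC l)
          < log 2 (?pAC l)"
        using gt pos(1)[of A] pos(1)[of C] G pos(2)[of A C] by simp
      moreover have "log 2 (G1 * ?pA l * ?pC l)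
         = real n * (I1 + \<delta>) + log 2 (?pA l) + log 2 (?pC l)"
        using pos(1)[of A] pos(1)[of C] G by (simp add: log_mult G1_def)
      ultimately have "real n * (I1 + \<delta>) < (\<Sum>x\<leftarrow>l. info_density q A C x)"
        unfolding info_density_iid[OF l] by linarith
      then show "\<bar>(\<Sum>x\<leftarrow>l. info_density q A C x) - real n * I1\<bar> \<ge> real n * \<delta>"
        by (simp add: algebra_simps)
    qed
    have low: "measure_pmf.prob ?O {l. ?pCB l
        \<le> G2 * ?pC l * ?pB l} \<le> \<epsilon> / 4"
    proof (rule order_trans[OF prob_mono_support N2[rule_format, OF n(2)]])
      fix l assume l: "l \<in> set_pmf ?O"
        and le: "?pCB l
        \<le> G2 * ?pC l * ?pB l"
      note pos = zero_less_pmf_iid_map[OF l]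
      have "log 2 (?pCB l)
        \<le> log 2 (G2 * ?pC l * ?pB l)"
        using le pos(1)[of B] pos(1)[of C] G pos(2)[of C B] by simp
      moreover have "log 2 (G2 * ?pC l * ?pB l)
         = real n * (I2 - \<delta>) + log 2 (?pC l) + log 2 (?pB l)"
        using pos(1)[of B] pos(1)[of C] G by (simp add: log_mult G2_def)
      ultimately have "(\<Sum>x\<leftarrow>l. info_density q C B x) \<le> real n * (I2 - \<delta>)"
        unfolding info_density_iid[OF l] by linarith
      then show "\<bar>(\<Sum>x\<leftarrow>l. info_density q C B x) - real n * I2\<bar> \<ge> real n * \<delta>"
        by (simp add: algebra_simps)
    qed
    have "G1 / real K \<le> G1 / y" using K y1 G by (intro divide_left_mono) auto
    also have "\<dots> = 2 powr (- (real n * \<delta>))"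
      unfolding G1_def y_def powr_diff[symmetric] by (simp add: algebra_simps)
    also have "\<dots> \<le> (\<epsilon> / 4)\<^sup>2" using N3 n by blast
    finally have sq: "sqrt (G1 / real K) \<le> \<epsilon> / 4"
      using eps by (intro real_le_lsqrt) auto
    have "real K / (real N * G2) \<le> (2 * y) / ((2 powr (real n * R) / 2) * G2)"
      using K N G y1 by (intro frac_le mult_mono) auto
    also have "\<dots> = 4 * (y / (2 powr (real n * R) * G2))" by simp
    also have "y / (2 powr (real n * R) * G2) = 2 powr (- (real n * \<delta>) - real n * \<delta>)"
      unfolding G2_def y_def Rd powr_add[symmetric] powr_diff[symmetric] by (simp add: algebra_simps)
    also have "\<dots> \<le> 2 powr (- (real n * \<delta>))" using \<delta> by simp
    also have "\<dots> \<le> \<epsilon> / 16" using N4 n by blast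
    finally have coll: "real K / (real N * G2) \<le> \<epsilon> / 4" by simp
    have "\<exists>enc bin dec. (\<forall>s. bin s < N) \<and> measure_pmf.prob ?O {l. dec (bin (map A l)) (map B l) \<noteq> enc (map A l)
         \<or> Bad (map A l) (map B l) (enc (map A l))}
       \<le> measure_pmf.prob ?O {l. Bad (map A l) (map B l) (map C l)}
         + measure_pmf.prob ?O {l. ?pAC l
             > G1 * ?pA l * ?pC l} + sqrt (G1 / real K)
         + measure_pmf.prob ?O {l. ?pCB l
             \<le> G2 * ?pC l * ?pB l}
         + real K / (real N * G2)"
      by (rule one_shot_covering_binning[OF finite_set_iid_pmf[OF fin] K(3) N(2) G iid_markov[OF markov]])
    then obtain enc bin dec where "\<forall>s. bin s < N" and
      "measure_pmf.prob ?O {l. dec (bin (map A l)) (map B l) \<noteq> enc (map A l)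
         \<or> Bad (map A l) (map B l) (enc (map A l))}
       \<le> measure_pmf.prob ?O {l. Bad (map A l) (map B l) (map C l)}
         + measure_pmf.prob ?O {l. ?pAC l
             > G1 * ?pA l * ?pC l} + sqrt (G1 / real K)
         + measure_pmf.prob ?O {l. ?pCB l
             \<le> G2 * ?pC l * ?pB l}
         + real K / (real N * G2)"
      by blast
    then show ?thesis
      using cov low sq coll unfolding N_def
      by (intro exI[of _ enc] exI[of _ bin] exI[of _ dec] conjI) (assumption | linarith)+
  qed
  then show ?thesis by (intro exI[of _ "Max {N1,N2,N3,N4}"]) auto
qed

text \<open>The words of probability at least 2^(-nR) number at most 2^(nR), and each gets its own
  message. By the weak law the remaining words have small total probability.\<close>

lemma lossless_coding:
  fixes p :: "'a pmf"
  assumes fin: "finite (set_pmf p)" and R: "R > entropy_pmf p" and eps: "\<epsilon> > 0"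
  shows "\<exists>N. \<forall>n\<ge>N. \<exists>enc dec. (\<forall>xs. enc xs < num_msgs n R) \<and>
     measure_pmf.prob (iid_pmf n p) {xs. dec (enc xs) \<noteq> xs} \<le> \<epsilon>"
proof -
  define h where "h x = - log 2 (pmf p x)" for x
  have mean: "pexp p h = entropy_pmf p" by (simp add: entropy_pmf_eq_pexp h_def[abs_def])
  have "pmf p x * log 2 (pmf p x) \<le> 0" for x
    using pmf_le_1[of p x] by (cases "pmf p x = 0") (auto intro!: mult_nonneg_nonpos simp: log_le_zero_cancel_iff pmf_nonneg less_le)
  then have "entropy_pmf p \<ge> 0" by (simp add: entropy_pmf_def sum_nonpos)
  then have R0: "R \<ge> 0" using R by simp
  obtain N where N: "\<forall>n\<ge>N. measure_pmf.prob (iid_pmf n p)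
      {xs. \<bar>(\<Sum>x\<leftarrow>xs. h x) - real n * entropy_pmf p\<bar> \<ge> real n * (R - entropy_pmf p)} \<le> \<epsilon>"
    using iid_pmf_weak_law[OF fin, of "R - entropy_pmf p" \<epsilon> h] R eps mean by auto
  have "\<exists>enc dec. (\<forall>xs. enc xs < num_msgs n R) \<and>
     measure_pmf.prob (iid_pmf n p) {xs. dec (enc xs) \<noteq> xs} \<le> \<epsilon>" if n: "n \<ge> N" for n
  proof -
    define T where "T = {xs \<in> set_pmf (iid_pmf n p). pmf (iid_pmf n p) xs \<ge> 2 powr (- (real n * R))}"
    have finT: "finite T" using finite_set_iid_pmf[OF fin] by (auto simp: T_def)
    have "real (card T) * 2 powr (- (real n * R)) \<le> (\<Sum>xs\<in>T. pmf (iid_pmf n p) xs)"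
      by (intro sum_bounded_below[of T, simplified]) (auto simp: T_def)
    also have "\<dots> \<le> 1"
      using finT by (simp add: measure_measure_pmf_finite[symmetric])
    finally have "real (card T) \<le> 2 powr (real n * R)"
      by (simp add: powr_minus field_simps)
    then have card: "card T \<le> num_msgs n R" by (simp add: num_msgs_def le_nat_floor)
    obtain g where g: "bij_betw g T {0..<card T}" using ex_bij_betw_finite_nat[OF finT] by blast
    define enc where "enc xs = (if xs \<in> T then g xs else 0)" for xs
    have "enc xs < num_msgs n R" for xs
      using bij_betwE[OF g] card num_msgs_ge_half(2)[OF R0, of n] by (fastforce simp: enc_def)
    moreover have "measure_pmf.prob (iid_pmf n p) {xs. inv_into T g (enc xs) \<noteq> xs} \<le> \<epsilon>"
    proof (rule order_trans[OF prob_mono_support N[rule_format, OF n]])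
      fix xs assume xs: "xs \<in> set_pmf (iid_pmf n p)" and "inv_into T g (enc xs) \<noteq> xs"
      then have "xs \<notin> T" using g by (auto simp: enc_def bij_betw_def inv_into_f_f)
      then have "pmf (iid_pmf n p) xs < 2 powr (- (real n * R))" using xs by (auto simp: T_def)
      then have "log 2 (pmf (iid_pmf n p) xs) < - (real n * R)"
        using xs by (simp add: log_less_iff pmf_positive)
      moreover have "log 2 (pmf (iid_pmf n p) xs) = - (\<Sum>x\<leftarrow>xs. h x)"
        using xs by (simp add: set_iid_pmf pmf_iid_pmf, subst log_prod_lessThan)
           (auto simp: h_def sum_list_sum_nth atLeast0LessThan sum_negf subset_iff pmf_positive)
      ultimately show "\<bar>(\<Sum>x\<leftarrow>xs. h x) - real n * entropy_pmf p\<bar> \<ge> real n * (R - entropy_pmf p)"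
        by (simp add: right_diff_distrib)
    qed
    ultimately show ?thesis by blast
  qed
  then show ?thesis by blast
qed


lemma zip_map_same: "zip (map A l) (map B l) = map (\<lambda>x. (A x, B x)) l"
  by (induction l) auto

text \<open>The independent sets enter only through their consequence that \<open>f\<close> is a
  function \<open>g\<close> of \<open>(x,u,w)\<close> on the support. Strict rate inequalities are
  enough, because the rate region is a closure.\<close>

lemma achievable_of_auxiliary:
  fixes p :: "('x \<times> 'y) pmf" and q :: "('x \<times> 'y \<times> 'u \<times> 'w) pmf"
  assumes fin: "finite (set_pmf q)"
    and marg: "map_pmf (\<lambda>(x,y,u,w). (x,y)) q = p"
    and m1: "markov_chain_pmf (map_pmf (\<lambda>(x,y,u,w). (u,x,y)) q)"
    and m2: "markov_chain_pmf (map_pmf (\<lambda>(x,y,u,w). (x,(u,y),w)) q)"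
    and g: "\<And>x y u w. (x,y,u,w) \<in> set_pmf q \<Longrightarrow> f x y = g x u w"
    and RX: "RX > entropy_pmf (map_pmf fst p)"
    and R0: "R0 > cond_mi_pmf (map_pmf (\<lambda>(x,y,u,w). (x,u,y)) q)"
    and RY: "RY > cond_mi_pmf (map_pmf (\<lambda>(x,y,u,w). (y,w,(x,u))) q)"
  shows "achievable p f (R0, RX, RY)"
proof -
  define X where "X = (\<lambda>(x::'x,y::'y,u::'u,w::'w). x)"
  define Y where "Y = (\<lambda>(x::'x,y::'y,u::'u,w::'w). y)"
  define U where "U = (\<lambda>(x::'x,y::'y,u::'u,w::'w). u)"
  define W where "W = (\<lambda>(x::'x,y::'y,u::'u,w::'w). w)"
  note XYUW = X_def Y_def U_def W_def
  let ?H = "rv_entropy q"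
  have lam: "(\<lambda>(x,y,u,w). (x,y)) = (X \<bowtie> Y)" "(\<lambda>(x,y,u,w). (u,x,y)) = (U \<bowtie> X \<bowtie> Y)"
    "(\<lambda>(x,y,u,w). (x,(u,y),w)) = (X \<bowtie> (U \<bowtie> Y) \<bowtie> W)"
    "(\<lambda>(x,y,u,w). (x,u,y)) = (X \<bowtie> U \<bowtie> Y)"
    "(\<lambda>(x,y,u,w). (y,w,(x,u))) = (Y \<bowtie> W \<bowtie> (X \<bowtie> U))"
    by (auto simp: XYUW)
  have nn0: "R0 \<ge> 0" using R0 cond_mi_pmf_nonneg[of "map_pmf (\<lambda>(x,y,u,w). (x,u,y)) q"] fin by simp
  have nnY: "RY \<ge> 0" using RY cond_mi_pmf_nonneg[of "map_pmf (\<lambda>(x,y,u,w). (y,w,(x,u))) q"] fin by simp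
  \<comment> \<open>The chain U - X - Y turns I(X;U|Y) into I(X;U) - I(U;Y).\<close>
  have R0': "R0 > ?H X - ?H (X \<bowtie> U) - ?H Y + ?H (U \<bowtie> Y)"
  proof -
    have "?H (U \<bowtie> X \<bowtie> Y) + ?H X = ?H (U \<bowtie> X) + ?H (X \<bowtie> Y)"
      using rv_entropy_markov[OF fin m1[unfolded lam]] .
    moreover have "?H (U \<bowtie> X \<bowtie> Y) = ?H (X \<bowtie> U \<bowtie> Y)"
      by (rule rv_entropy_cong[OF fin]) auto
    moreover have "?H (U \<bowtie> X) = ?H (X \<bowtie> U)"
      by (rule rv_entropy_cong[OF fin]) auto
    ultimately show ?thesis using R0[unfolded lam cond_mi_pmf_map] by linarith
  qed
  have RY': "RY > ?H (U \<bowtie> Y) - ?H ((U \<bowtie> Y) \<bowtie> W) - ?H (X \<bowtie> U)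
      + ?H (W \<bowtie> (X \<bowtie> U))"
  proof -
    have "?H (X \<bowtie> (U \<bowtie> Y) \<bowtie> W) + ?H (U \<bowtie> Y)
        = ?H (X \<bowtie> (U \<bowtie> Y)) + ?H ((U \<bowtie> Y) \<bowtie> W)"
      using rv_entropy_markov[OF fin m2[unfolded lam]] .
    moreover have "?H (X \<bowtie> (U \<bowtie> Y) \<bowtie> W) = ?H (Y \<bowtie> W \<bowtie> (X \<bowtie> U))"
      by (rule rv_entropy_cong[OF fin]) auto
    moreover have "?H (X \<bowtie> (U \<bowtie> Y)) = ?H (Y \<bowtie> (X \<bowtie> U))"
      by (rule rv_entropy_cong[OF fin]) auto
    ultimately show ?thesis using RY[unfolded lam cond_mi_pmf_map] by linarith
  qed
  have mk1: "pmf (map_pmf (X \<bowtie> Y \<bowtie> U) q) (s,t,v) * pmf (map_pmf X q) s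
     = pmf (map_pmf (X \<bowtie> Y) q) (s,t) * pmf (map_pmf (X \<bowtie> U) q) (s,v)" for s t v
  proof -
    have "pmf (map_pmf (U \<bowtie> X \<bowtie> Y) q) (v,s,t) * pmf (map_pmf X q) s
     = pmf (map_pmf (U \<bowtie> X) q) (v,s) * pmf (map_pmf (X \<bowtie> Y) q) (s,t)"
      using m1[unfolded lam markov_chain_pmf_def] by (simp add: map_pmf_comp)
    moreover have "pmf (map_pmf (U \<bowtie> X \<bowtie> Y) q) (v,s,t) = pmf (map_pmf (X \<bowtie> Y \<bowtie> U) q) (s,t,v)"
      unfolding pmf_map by (intro arg_cong[of _ _ "measure_pmf.prob q"]) auto
    moreover have "pmf (map_pmf (U \<bowtie> X) q) (v,s) = pmf (map_pmf (X \<bowtie> U) q) (s,v)"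
      unfolding pmf_map by (intro arg_cong[of _ _ "measure_pmf.prob q"]) auto
    ultimately show ?thesis by (simp add: mult.commute)
  qed
  \<comment> \<open>Source \<open>(U,Y)\<close> and side information \<open>(X,U)\<close> of the
    second code share the component \<open>U\<close>. If the two copies disagree, both sides vanish;
    otherwise this is the chain X - (U,Y) - W.\<close>
  have mk2: "pmf (map_pmf ((U \<bowtie> Y) \<bowtie> (X \<bowtie> U) \<bowtie> W) q) (s,t,v) * pmf (map_pmf (U \<bowtie> Y) q) s
     = pmf (map_pmf ((U \<bowtie> Y) \<bowtie> (X \<bowtie> U)) q) (s,t) * pmf (map_pmf ((U \<bowtie> Y) \<bowtie> W) q) (s,v)"
    for s t v
  proof (cases "fst s = snd t")
    case True
    obtain u y x where st: "s = (u,y)" "t = (x,u)" using True by (cases s; cases t) auto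
    have "pmf (map_pmf (X \<bowtie> (U \<bowtie> Y) \<bowtie> W) q) (x,(u,y),v) * pmf (map_pmf (U \<bowtie> Y) q) (u,y)
     = pmf (map_pmf (X \<bowtie> (U \<bowtie> Y)) q) (x,(u,y)) * pmf (map_pmf ((U \<bowtie> Y) \<bowtie> W) q) ((u,y),v)"
      using m2[unfolded lam markov_chain_pmf_def] by (simp add: map_pmf_comp)
    moreover have "pmf (map_pmf (X \<bowtie> (U \<bowtie> Y) \<bowtie> W) q) (x,(u,y),v)
        = pmf (map_pmf ((U \<bowtie> Y) \<bowtie> (X \<bowtie> U) \<bowtie> W) q) ((u,y),(x,u),v)"
      unfolding pmf_map by (intro arg_cong[of _ _ "measure_pmf.prob q"]) auto
    moreover have "pmf (map_pmf (X \<bowtie> (U \<bowtie> Y)) q) (x,(u,y))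
        = pmf (map_pmf ((U \<bowtie> Y) \<bowtie> (X \<bowtie> U)) q) ((u,y),(x,u))"
      unfolding pmf_map by (intro arg_cong[of _ _ "measure_pmf.prob q"]) auto
    ultimately show ?thesis by (simp add: st)
  next
    case False
    then have "(s,t,v) \<notin> ((U \<bowtie> Y) \<bowtie> (X \<bowtie> U) \<bowtie> W) ` set_pmf q"
      "(s,t) \<notin> ((U \<bowtie> Y) \<bowtie> (X \<bowtie> U)) ` set_pmf q" by auto
    then show ?thesis by (simp add: pmf_map_outside)
  qed
  have pX: "map_pmf fst p = map_pmf X q"
    unfolding marg[symmetric] by (simp add: map_pmf_comp X_def case_prod_unfold)
  have "\<exists>N. \<forall>n\<ge>N. \<exists>\<phi>0 \<phi>X \<phi>Y \<psi>. is_code n R0 RX RY \<phi>0 \<phi>X \<phi>Y \<and> code_error p f n \<phi>0 \<phi>X \<phi>Y \<psi> \<le> \<epsilon>"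
    if eps: "\<epsilon> > 0" for \<epsilon> :: real
  proof -
    \<comment> \<open>The budget: one third for a failure of the second code under the ideal law,
      one for the excess of the first code, one for losing X^n.\<close>
    have eps3: "\<epsilon> / 3 > 0" using eps by simp
    obtain N1 where N1: "\<And>n Bad. n \<ge> N1 \<Longrightarrow> \<exists>enc bin dec. (\<forall>s. bin s < num_msgs n R0) \<and>
       measure_pmf.prob (iid_pmf n q) {l. dec (bin (map X l)) (map Y l) \<noteq> enc (map X l)
         \<or> Bad (map X l) (map Y l) (enc (map X l))}
       \<le> measure_pmf.prob (iid_pmf n q) {l. Bad (map X l) (map Y l) (map U l)} + \<epsilon> / 3"
      using wyner_ziv_coding[OF fin mk1 nn0 R0' eps3] by blast
    obtain N2 where N2: "\<And>n Bad. n \<ge> N2 \<Longrightarrow> \<exists>enc bin dec. (\<forall>s. bin s < num_msgs n RY) \<and>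
       measure_pmf.prob (iid_pmf n q) {l. dec (bin (map (U \<bowtie> Y) l)) (map (X \<bowtie> U) l)
           \<noteq> enc (map (U \<bowtie> Y) l)
         \<or> Bad (map (U \<bowtie> Y) l) (map (X \<bowtie> U) l) (enc (map (U \<bowtie> Y) l))}
       \<le> measure_pmf.prob (iid_pmf n q) {l. Bad (map (U \<bowtie> Y) l) (map (X \<bowtie> U) l) (map W l)} + \<epsilon> / 3"
      using wyner_ziv_coding[OF fin mk2 nnY RY' eps3] by blast
    obtain N3 where N3: "\<And>n. n \<ge> N3 \<Longrightarrow> \<exists>enc dec. (\<forall>xs. enc xs < num_msgs n RX) \<and>
       measure_pmf.prob (iid_pmf n (map_pmf fst p)) {xs. dec (enc xs) \<noteq> xs} \<le> \<epsilon> / 3"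
      using lossless_coding[OF _ RX eps3] fin by (auto simp: pX)
    have "\<exists>\<phi>0 \<phi>X \<phi>Y \<psi>. is_code n R0 RX RY \<phi>0 \<phi>X \<phi>Y \<and> code_error p f n \<phi>0 \<phi>X \<phi>Y \<psi> \<le> \<epsilon>"
      if n: "n \<ge> N1" "n \<ge> N2" "n \<ge> N3" for n
    proof -
      let ?L = "iid_pmf n q"
      define Bad2 where "Bad2 ss ts vs \<longleftrightarrow> (\<exists>i<n. f (fst (ts ! i)) (snd (ss ! i)) \<noteq> g (fst (ts ! i)) (snd (ts ! i)) (vs ! i))"
        for ss :: "('u \<times> 'y) list" and ts :: "('x \<times> 'u) list" and vs :: "'w list"
      have Bad2_0: "measure_pmf.prob ?L {l. Bad2 (map (U \<bowtie> Y) l) (map (X \<bowtie> U) l) (map W l)} = 0"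
      proof -
        have "\<not> Bad2 (map (U \<bowtie> Y) l) (map (X \<bowtie> U) l) (map W l)" if l: "l \<in> set_pmf ?L" for l
        proof -
          have "f (X (l ! i)) (Y (l ! i)) = g (X (l ! i)) (U (l ! i)) (W (l ! i))" if "i < n" for i
          proof -
            obtain x y u w where li: "l ! i = (x,y,u,w)" by (cases "l ! i") auto
            have "l ! i \<in> set_pmf q" using l that by (auto simp: set_iid_pmf)
            then show ?thesis using g[of x y u w] by (simp add: li XYUW)
          qed
          then show ?thesis using l by (auto simp: Bad2_def set_iid_pmf)
        qed
        then show ?thesis by (subst measure_pmf_zero_iff) auto
      qed
      obtain enc2 bin2 dec2 where c2: "\<And>s. bin2 s < num_msgs n RY"
        "measure_pmf.prob ?L {l. dec2 (bin2 (map (U \<bowtie> Y) l)) (map (X \<bowtie> U) l)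
           \<noteq> enc2 (map (U \<bowtie> Y) l)
         \<or> Bad2 (map (U \<bowtie> Y) l) (map (X \<bowtie> U) l) (enc2 (map (U \<bowtie> Y) l))} \<le> \<epsilon> / 3"
        using N2[OF n(2), of Bad2] Bad2_0 by auto
      \<comment> \<open>All failures of the second code, as an event in the words of the first. The
        length condition excludes codewords that \<open>zip\<close> would truncate.\<close>
      define Bad1 where "Bad1 xs ys us \<longleftrightarrow> length us \<noteq> n \<or>
          dec2 (bin2 (zip us ys)) (zip xs us) \<noteq> enc2 (zip us ys) \<or> Bad2 (zip us ys) (zip xs us) (enc2 (zip us ys))"
        for xs ys us
      have Bad1: "measure_pmf.prob ?L {l. Bad1 (map X l) (map Y l) (map U l)} \<le> \<epsilon> / 3"
        by (rule order_trans[OF prob_mono_support c2(2)]) (auto simp: Bad1_def zip_map_same set_iid_pmf)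
      obtain enc1 bin1 dec1 where c1: "\<And>s. bin1 s < num_msgs n R0"
        "measure_pmf.prob ?L {l. dec1 (bin1 (map X l)) (map Y l) \<noteq> enc1 (map X l)
         \<or> Bad1 (map X l) (map Y l) (enc1 (map X l))}
         \<le> measure_pmf.prob ?L {l. Bad1 (map X l) (map Y l) (map U l)} + \<epsilon> / 3"
        using N1[OF n(1), of Bad1] by blast
      obtain encX decX where cX: "\<And>xs. encX xs < num_msgs n RX"
        "measure_pmf.prob (iid_pmf n (map_pmf fst p)) {xs. decX (encX xs) \<noteq> xs} \<le> \<epsilon> / 3"
        using N3[OF n(3)] by blast
      have cX': "measure_pmf.prob ?L {l. decX (encX (map X l)) \<noteq> map X l} \<le> \<epsilon> / 3"
        using cX(2) unfolding pX map_iid_pmf[symmetric] by (simp add: vimage_def)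
      \<comment> \<open>The \<open>Y\<close>-encoder first recovers \<open>u\<close> from the bin
        label and its own word, then applies the second code to \<open>(u, Y)\<close>.\<close>
      define \<phi>Y where "\<phi>Y ys m = bin2 (zip (dec1 m ys) ys)" for ys m
      \<comment> \<open>The decoder obtains \<open>u\<close> by rerunning the first encoder on the
        recovered source word.\<close>
      define \<psi> where "\<psi> mx my = (let xs = decX mx; us = enc1 xs; ws = dec2 my (zip xs us)
         in map (\<lambda>i. g (xs ! i) (us ! i) (ws ! i)) [0..<n])" for mx my
      have "is_code n R0 RX RY bin1 encX \<phi>Y"
        using c1(1) c2(1) cX(1) by (simp add: is_code_def \<phi>Y_def)
      moreover have "code_error p f n bin1 encX \<phi>Y \<psi> \<le> \<epsilon>"
      proof -
        have "code_error p f n bin1 encX \<phi>Y \<psi> = measure_pmf.prob ?L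
           {l. \<psi> (encX (map X l)) (\<phi>Y (map Y l) (bin1 (map X l))) \<noteq> map (\<lambda>\<omega>. f (X \<omega>) (Y \<omega>)) l}"
          unfolding code_error_def marg[symmetric] map_iid_pmf[symmetric]
          by (simp add: vimage_def o_def XYUW case_prod_unfold)
        also have "\<dots> \<le> measure_pmf.prob ?L {l. decX (encX (map X l)) \<noteq> map X l \<or>
            (dec1 (bin1 (map X l)) (map Y l) \<noteq> enc1 (map X l) \<or> Bad1 (map X l) (map Y l) (enc1 (map X l)))}"
        proof (rule prob_mono_support, rule ccontr)
          fix l assume l: "l \<in> set_pmf ?L"
            and err: "\<psi> (encX (map X l)) (\<phi>Y (map Y l) (bin1 (map X l))) \<noteq> map (\<lambda>\<omega>. f (X \<omega>) (Y \<omega>)) l"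
            and ok: "\<not> (decX (encX (map X l)) \<noteq> map X l \<or>
            (dec1 (bin1 (map X l)) (map Y l) \<noteq> enc1 (map X l) \<or> Bad1 (map X l) (map Y l) (enc1 (map X l))))"
          define us where "us = enc1 (map X l)"
          have len: "length l = n" using l by (simp add: set_iid_pmf)
          have us: "length us = n" "dec2 (bin2 (zip us (map Y l))) (zip (map X l) us) = enc2 (zip us (map Y l))"
             "\<not> Bad2 (zip us (map Y l)) (zip (map X l) us) (enc2 (zip us (map Y l)))"
            using ok by (auto simp: Bad1_def us_def)
          have "\<psi> (encX (map X l)) (\<phi>Y (map Y l) (bin1 (map X l)))
             = map (\<lambda>i. g (X (l ! i)) (us ! i) (enc2 (zip us (map Y l)) ! i)) [0..<n]"
            using ok us len by (auto simp: \<psi>_def \<phi>Y_def Let_def us_def[symmetric])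
          also have "\<dots> = map (\<lambda>\<omega>. f (X \<omega>) (Y \<omega>)) l"
            using us(1,3) len by (intro nth_equalityI) (auto simp: Bad2_def)
          finally show False using err by simp
        qed
        also have "\<dots> \<le> measure_pmf.prob ?L {l. decX (encX (map X l)) \<noteq> map X l} +
            measure_pmf.prob ?L {l. dec1 (bin1 (map X l)) (map Y l) \<noteq> enc1 (map X l)
              \<or> Bad1 (map X l) (map Y l) (enc1 (map X l))}"
          unfolding Collect_disj_eq by (intro measure_subadditive) auto
        also have "\<dots> \<le> \<epsilon>" using cX' c1(2) Bad1 by linarith
        finally show ?thesis .
      qed
      ultimately show ?thesis by blast
    qed
    then show ?thesis by (intro exI[of _ "Max {N1,N2,N3}"]) auto
  qed
  then show ?thesis by (simp add: achievable_def)
qed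

section \<open>Converse\<close>

text \<open>The factors may be unnormalized: each marginal is one factor, or its sum, times the
  other, so the two cross products agree.\<close>

lemma markov_chain_pmfI:
  fixes M :: "('a \<times> 'b \<times> 'c) pmf"
  assumes fin: "finite (set_pmf M)" and fac: "\<And>a b c. pmf M (a,b,c) = \<alpha> a b * \<beta> b c"
  shows "markov_chain_pmf M"
proof -
  let ?A = "(\<lambda>(a,b,c). a) ` set_pmf M" and ?C = "(\<lambda>(a,b,c). c) ` set_pmf M"
  have ab: "pmf (map_pmf (\<lambda>(a,b,c). (a,b)) M) (a,b) = \<alpha> a b * (\<Sum>c\<in>?C. \<beta> b c)" for a b
  proof -
    have "pmf (map_pmf (\<lambda>\<omega>. ((\<lambda>(a,b,c). c) \<omega>, (\<lambda>(a,b,c). (a,b)) \<omega>)) M) (c, (a,b)) = pmf M (a,b,c)" for c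
      using pmf_map_inj'[of "\<lambda>\<omega>. ((\<lambda>(a,b,c). c) \<omega>, (\<lambda>(a,b,c). (a,b)) \<omega>)" M "(a,b,c)"]
      by (simp add: inj_def)
    then show ?thesis
      using sum_pmf_marginal[OF fin, of "\<lambda>(a,b,c). c" "\<lambda>(a,b,c). (a,b)" "(a,b)"]
      by (simp add: fac sum_distrib_left)
  qed
  have bc: "pmf (map_pmf (\<lambda>(a,b,c). (b,c)) M) (b,c) = (\<Sum>a\<in>?A. \<alpha> a b) * \<beta> b c" for b c
  proof -
    have "pmf (map_pmf (\<lambda>\<omega>. ((\<lambda>(a,b,c). a) \<omega>, (\<lambda>(a,b,c). (b,c)) \<omega>)) M) (a, (b,c)) = pmf M (a,b,c)" for a
      using pmf_map_inj'[of "\<lambda>\<omega>. ((\<lambda>(a,b,c). a) \<omega>, (\<lambda>(a,b,c). (b,c)) \<omega>)" M "(a,b,c)"]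
      by (simp add: inj_def)
    then show ?thesis
      using sum_pmf_marginal[OF fin, of "\<lambda>(a,b,c). a" "\<lambda>(a,b,c). (b,c)" "(b,c)"]
      by (simp add: fac sum_distrib_right)
  qed
  have b: "pmf (map_pmf (\<lambda>(a,b,c). b) M) b = (\<Sum>a\<in>?A. \<alpha> a b) * (\<Sum>c\<in>?C. \<beta> b c)" for b
  proof -
    have "pmf (map_pmf (\<lambda>(a,b,c). b) M) b
       = (\<Sum>a\<in>?A. pmf (map_pmf (\<lambda>\<omega>. ((\<lambda>(a,b,c). a) \<omega>, (\<lambda>(a,b,c). b) \<omega>)) M) (a, b))"
      by (rule sum_pmf_marginal[OF fin, symmetric])
    also have "\<dots> = (\<Sum>a\<in>?A. pmf (map_pmf (\<lambda>(a,b,c). (a,b)) M) (a,b))"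
      by (intro sum.cong refl arg_cong[of _ _ "\<lambda>M. pmf M _"] map_pmf_cong) auto
    finally show ?thesis by (simp add: ab sum_distrib_right)
  qed
  show ?thesis unfolding markov_chain_pmf_def ab bc b fac by (simp add: mult_ac)
qed

lemma pmf_marginal_factor:
  assumes fin: "finite (set_pmf M)"
    and "\<And>d. pmf (map_pmf (D \<bowtie> Z) M) (d, z) = k * h d"
  shows "pmf (map_pmf Z M) z = k * (\<Sum>d\<in>D ` set_pmf M. h d)"
  unfolding sum_pmf_marginal[OF fin, of D Z z, symmetric] by (simp add: assms(2) sum_distrib_left)

text \<open>For every value of \<open>Z\<close>, freeze \<open>D\<close> at its best value.\<close>

lemma estimator_without_irrelevant:
  fixes Y :: "'o \<Rightarrow> 'y" and Z :: "'o \<Rightarrow> 'z" and D :: "'o \<Rightarrow> 'd"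
  assumes fin: "finite (set_pmf M)"
    and markov: "markov_chain_pmf (map_pmf (Y \<bowtie> Z \<bowtie> D) M)"
  shows "\<exists>g. measure_pmf.prob M {\<omega>. e (Y \<omega>) (Z \<omega>) \<noteq> g (Z \<omega>)}
           \<le> measure_pmf.prob M {\<omega>. e (Y \<omega>) (Z \<omega>) \<noteq> h (Z \<omega>) (D \<omega>)}"
proof -
  let ?Y = "Y ` set_pmf M" and ?Z = "Z ` set_pmf M" and ?D = "D ` set_pmf M"
  let ?yzd = "Y \<bowtie> Z \<bowtie> D" and ?yz = "Y \<bowtie> Z" and ?zd = "Z \<bowtie> D"
  let ?P = "pmf (map_pmf ?yzd M)" and ?PYZ = "pmf (map_pmf ?yz M)"
    and ?PZD = "pmf (map_pmf ?zd M)" and ?PZ = "pmf (map_pmf Z M)"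
  have fin': "finite ?Y" "finite ?Z" "finite ?D" "?D \<noteq> {}" using fin set_pmf_not_empty by auto
  have eq: "?P (y,z,d) * ?PZ z = ?PYZ (y,z) * ?PZD (z,d)" for y z d
    using markov by (simp add: markov_chain_pmf_def map_pmf_comp)
  have Zpos: "?PZ z > 0" if "z \<in> ?Z" for z using that pmf_map_pos by fastforce
  define L where "L z d = (\<Sum>y\<in>?Y. ?PYZ (y,z) * of_bool (e y z \<noteq> h z d))" for z d
  define best where "best z = arg_min_on (L z) ?D" for z
  have best: "L z (best z) \<le> L z d" if "d \<in> ?D" for z d
    using arg_min_least[OF fin'(3,4) that, of "L z"] by (simp add: best_def)
  have ZD: "(\<Sum>d\<in>?D. ?PZD (z,d)) = ?PZ z" for z
  proof -
    have "(\<Sum>d\<in>?D. ?PZD (z,d)) = (\<Sum>d\<in>?D. pmf (map_pmf (D \<bowtie> Z) M) (d,z))"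
      unfolding pmf_map by (intro sum.cong refl arg_cong[of _ _ "measure_pmf.prob M"]) auto
    then show ?thesis by (simp add: sum_pmf_marginal[OF fin])
  qed
  have YZ: "pexp M (\<lambda>\<omega>. F (Y \<omega>) (Z \<omega>)) = (\<Sum>z\<in>?Z. \<Sum>y\<in>?Y. ?PYZ (y,z) * F y z)" for F
    by (simp only: pexp_joint[OF fin] sum.swap[of _ ?Y])
  have YZD: "pexp M (\<lambda>\<omega>. F (Y \<omega>) (Z \<omega>) (D \<omega>)) = (\<Sum>z\<in>?Z. \<Sum>d\<in>?D. \<Sum>y\<in>?Y. ?P (y,z,d) * F y z d)" for F
    by (simp only: pexp_joint3[OF fin] sum.swap[of _ ?Y])
  have "measure_pmf.prob M {\<omega>. e (Y \<omega>) (Z \<omega>) \<noteq> h (Z \<omega>) (best (Z \<omega>))} = (\<Sum>z\<in>?Z. L z (best z))"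
    unfolding prob_eq_pexp[OF fin] using YZ[of "\<lambda>y z. of_bool (e y z \<noteq> h z (best z))"] by (simp add: L_def)
  also have "\<dots> = (\<Sum>z\<in>?Z. \<Sum>d\<in>?D. ?PZD (z,d) / ?PZ z * L z (best z))"
    using Zpos by (intro sum.cong refl)
      (auto simp: sum_distrib_right[symmetric] sum_divide_distrib[symmetric] ZD less_imp_neq[symmetric])
  also have "\<dots> \<le> (\<Sum>z\<in>?Z. \<Sum>d\<in>?D. ?PZD (z,d) / ?PZ z * L z d)"
    by (intro sum_mono mult_left_mono best) auto
  also have "\<dots> = (\<Sum>z\<in>?Z. \<Sum>d\<in>?D. \<Sum>y\<in>?Y. ?P (y,z,d) * of_bool (e y z \<noteq> h z d))"
  proof (intro sum.cong refl)
    fix z d assume z: "z \<in> ?Z"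
    have "?PZD (z,d) / ?PZ z * ?PYZ (y,z) = ?P (y,z,d)" for y
      using eq[of y z d] Zpos[OF z] by (simp add: field_simps)
    then show "?PZD (z,d) / ?PZ z * L z d = (\<Sum>y\<in>?Y. ?P (y,z,d) * of_bool (e y z \<noteq> h z d))"
      unfolding L_def sum_distrib_left mult.assoc[symmetric] by simp
  qed
  also have "\<dots> = measure_pmf.prob M {\<omega>. e (Y \<omega>) (Z \<omega>) \<noteq> h (Z \<omega>) (D \<omega>)}"
    unfolding prob_eq_pexp[OF fin] using YZD[of "\<lambda>y z d. of_bool (e y z \<noteq> h z d)"] by simp
  finally show ?thesis by (rule exI[of _ "\<lambda>z. h z (best z)"])
qed

section \<open>Time sharing and single-letterization\<close>

lemma map_nth_iid_pmf:
  assumes "i < n"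
  shows "map_pmf (\<lambda>l. l ! i) (iid_pmf n p) = p"
proof -
  have n: "n = i + Suc (n - Suc i)" using assms by simp
  have "map_pmf (\<lambda>l. l ! i) (iid_pmf n p)
      = map_pmf (\<lambda>(as, x, bs). x) (pair_pmf (iid_pmf i p) (pair_pmf p (iid_pmf (n - Suc i) p)))"
    by (subst n, subst iid_pmf_split, unfold map_pmf_comp, rule map_pmf_cong)
       (auto simp: set_iid_pmf nth_append)
  also have "\<dots> = map_pmf fst (map_pmf snd (pair_pmf (iid_pmf i p) (pair_pmf p (iid_pmf (n - Suc i) p))))"
    by (simp add: map_pmf_comp case_prod_unfold)
  also have "\<dots> = p" by (simp add: map_snd_pair_pmf map_fst_pair_pmf)
  finally show ?thesis .
qed

lemma pexp_uniform:
  assumes "n > 0"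
  shows "pexp (pmf_of_set {..<n}) h = (\<Sum>i<n. h i) / real n"
  using assms by (auto simp: pexp_def lessThan_empty_iff sum_divide_distrib)

lemma pmf_time_sharing:
  assumes fin: "finite (set_pmf L)" and "i < n"
  shows "pmf (map_pmf (\<lambda>(i,l). (i, Z i l)) (pair_pmf (pmf_of_set {..<n}) L)) (i, z)
       = pmf (map_pmf (Z i) L) z / real n"
proof -
  let ?U = "pmf_of_set {..<n}"
  have ne: "{..<n} \<noteq> {}" using \<open>i < n\<close> by auto
  have finU: "finite (set_pmf ?U)" using ne by simp
  have finM: "finite (set_pmf (pair_pmf ?U L))" using fin ne by simp
  have "pmf (map_pmf (\<lambda>(i,l). (i, Z i l)) (pair_pmf ?U L)) (i, z)
     = pexp ?U (\<lambda>j. pexp L (\<lambda>l. of_bool (j = i \<and> Z j l = z)))"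
    using pexp_of_bool_eq[of "map_pmf (\<lambda>(i,l). (i, Z i l)) (pair_pmf ?U L)" "(i,z)"] finM finU fin
    by (simp add: pexp_map pexp_pair)
  also have "\<dots> = pexp ?U (\<lambda>j. pexp L (\<lambda>l. of_bool (j = i) * of_bool (Z i l = z)))"
    by (intro pexp_cong) auto
  also have "\<dots> = pexp ?U (\<lambda>j. of_bool (j = i)) * pexp L (\<lambda>l. of_bool (Z i l = z))"
    by (simp only: pexp_cmult pexp_multc)
  also have "\<dots> = (1 / real n) * pmf (map_pmf (Z i) L) z"
  proof -
    have "pexp L (\<lambda>l. of_bool (Z i l = z)) = pmf (map_pmf (Z i) L) z"
      using pexp_of_bool_eq[of "map_pmf (Z i) L" z] fin by (simp add: pexp_map)
    moreover have "pexp ?U (\<lambda>j. of_bool (j = i)) = 1 / real n"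
      using \<open>i < n\<close> ne finU by (simp add: pexp_of_bool_eq)
    ultimately show ?thesis by simp
  qed
  finally show ?thesis by simp
qed

text \<open>A variable that contains the time index has the average entropy plus
  \<open>log 2 (real n)\<close>; this surplus cancels in differences of entropies.\<close>

lemma rv_entropy_time_sharing:
  assumes fin: "finite (set_pmf L)" and n: "n > 0"
  shows "rv_entropy (pair_pmf (pmf_of_set {..<n}) L) (\<lambda>(i,l). (i, Z i l))
       = log 2 (real n) + (\<Sum>i<n. rv_entropy L (Z i)) / real n"
proof -
  let ?U = "pmf_of_set {..<n}"
  have ne: "{..<n} \<noteq> {}" using n by auto
  have finU: "finite (set_pmf ?U)" using ne by simp
  have finM: "finite (set_pmf (pair_pmf ?U L))" using fin ne by simp
  note law = pmf_time_sharing[OF fin]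
  have "rv_entropy (pair_pmf ?U L) (\<lambda>(i,l). (i, Z i l))
     = pexp ?U (\<lambda>i. pexp L (\<lambda>l. - log 2 (pmf (map_pmf (\<lambda>(i,l). (i, Z i l)) (pair_pmf ?U L)) (i, Z i l))))"
    using finM finU fin by (simp add: rv_entropy_eq_pexp pexp_pair)
  also have "\<dots> = pexp ?U (\<lambda>i. pexp L (\<lambda>l. log 2 (real n) + - log 2 (pmf (map_pmf (Z i) L) (Z i l))))"
  proof (intro pexp_cong)
    fix i l assume "i \<in> set_pmf ?U" "l \<in> set_pmf L"
    then show "- log 2 (pmf (map_pmf (\<lambda>(i,l). (i, Z i l)) (pair_pmf ?U L)) (i, Z i l))
        = log 2 (real n) + - log 2 (pmf (map_pmf (Z i) L) (Z i l))"
      using ne n pmf_map_pos[of l L "Z i"] by (simp add: law log_divide)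
  qed
  also have "\<dots> = pexp ?U (\<lambda>i. log 2 (real n) + rv_entropy L (Z i))"
    unfolding pexp_add pexp_const[OF fin] rv_entropy_eq_pexp[OF fin] ..
  also have "\<dots> = log 2 (real n) + (\<Sum>i<n. rv_entropy L (Z i)) / real n"
    using finU n by (simp add: pexp_add pexp_const pexp_uniform)
  finally show ?thesis .
qed


lemma pexp_iid_at:
  assumes fin: "finite (set_pmf p)" and "i < n"
  shows "pexp (iid_pmf n p) h
    = pexp (iid_pmf i p) (\<lambda>as. pexp p (\<lambda>z. pexp (iid_pmf (n - Suc i) p) (\<lambda>bs. h (as @ z # bs))))"
proof -
  have n: "n = i + Suc (n - Suc i)" using assms by simp
  have "pexp (iid_pmf (i + Suc (n - Suc i)) p) h
    = pexp (iid_pmf i p) (\<lambda>as. pexp p (\<lambda>z. pexp (iid_pmf (n - Suc i) p) (\<lambda>bs. h (as @ z # bs))))"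
    unfolding iid_pmf_split using fin finite_set_iid_pmf[OF fin] by (simp add: pexp_map pexp_pair)
  then show ?thesis using n by simp
qed

lemma log_num_msgs_le: "num_msgs n R > 0 \<Longrightarrow> log 2 (real (num_msgs n R)) \<le> real n * R"
proof -
  assume pos: "num_msgs n R > 0"
  have "real (num_msgs n R) \<le> 2 powr (real n * R)" by (simp add: num_msgs_def)
  then show ?thesis using pos by (simp add: log_le_iff)
qed

text \<open>These equivalences allow \<open>rv_entropy_cong\<close> to identify tuples of prefixes,
  letters and suffixes that carry the same information.\<close>

lemma list_eq_iff_split_at:
  "i < length ys \<Longrightarrow> i < length zs \<Longrightarrow>
    ys = zs \<longleftrightarrow> take i ys = take i zs \<and> ys ! i = zs ! i \<and> drop (Suc i) ys = drop (Suc i) zs"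
  by (metis id_take_nth_drop)

lemma take_Suc_eq_iff:
  "i < length ys \<Longrightarrow> i < length zs \<Longrightarrow>
    take (Suc i) ys = take (Suc i) zs \<longleftrightarrow> take i ys = take i zs \<and> ys ! i = zs ! i"
  by (simp add: take_Suc_conv_app_nth)

lemma drop_eq_iff_Suc:
  "i < length ys \<Longrightarrow> i < length zs \<Longrightarrow>
    drop i ys = drop i zs \<longleftrightarrow> ys ! i = zs ! i \<and> drop (Suc i) ys = drop (Suc i) zs"
  by (simp add: Cons_nth_drop_Suc[symmetric])

lemma list_pair_eq_iff: "l = l' \<longleftrightarrow> map fst l = map fst l' \<and> map snd l = map snd l'"
  by (metis zip_map_fst_snd)

text \<open>
  The auxiliary variables are \<open>U = (i, \<phi>0(X\<^sup>n), X\<^sub>1 \<dots> X\<^sub>i\<^sub>-\<^sub>1, Y\<^sub>i\<^sub>+\<^sub>1 \<dots> Y\<^sub>n)\<close>, with a uniform time index \<open>i\<close>,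
  and \<open>W = \<phi>Y(Y\<^sup>n, \<phi>0(X\<^sup>n))\<close>. The decoder also uses \<open>X\<^sub>i\<^sub>+\<^sub>1 \<dots> X\<^sub>n\<close>, which is irrelevant given \<open>(X\<^sub>i, U, W)\<close>.
\<close>

lemma single_letter_converse:
  fixes p :: "('x \<times> 'y) pmf" and f :: "'x \<Rightarrow> 'y \<Rightarrow> 'f"
  assumes fin: "finite (set_pmf p)" and n: "n > 0"
    and code: "is_code n R0 RX RY \<phi>0 \<phi>X \<phi>Y" and err: "code_error p f n \<phi>0 \<phi>X \<phi>Y \<psi> \<le> \<epsilon>"
  shows "\<exists>q :: ('x \<times> 'y \<times> (nat \<times> nat \<times> 'x list \<times> 'y list) \<times> nat) pmf.
    finite (set_pmf q) \<and> map_pmf (\<lambda>(x,y,u,w). (x,y)) q = p \<and>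
    markov_chain_pmf (map_pmf (\<lambda>(x,y,u,w). (u,x,y)) q) \<and>
    markov_chain_pmf (map_pmf (\<lambda>(x,y,u,w). (x,(u,y),w)) q) \<and>
    cond_mi_pmf (map_pmf (\<lambda>(x,y,u,w). (x,u,y)) q) \<le> R0 \<and>
    cond_mi_pmf (map_pmf (\<lambda>(x,y,u,w). (y,w,(x,u))) q) \<le> RY \<and>
    (\<exists>g. measure_pmf.prob q {(x,y,u,w). f x y \<noteq> g x u w} \<le> \<epsilon>)"
proof -
  define L where "L = iid_pmf n p"
  define \<Omega> where "\<Omega> = pair_pmf (pmf_of_set {..<n}) L"
  have ne: "{..<n} \<noteq> {}" using n by auto
  have finL: "finite (set_pmf L)" unfolding L_def by (rule finite_set_iid_pmf[OF fin])
  have fin\<Omega>: "finite (set_pmf \<Omega>)" unfolding \<Omega>_def using finL ne by simp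
  have set\<Omega>: "\<omega> \<in> set_pmf \<Omega> \<longleftrightarrow> fst \<omega> < n \<and> snd \<omega> \<in> set_pmf L" for \<omega>
    unfolding \<Omega>_def using ne by (cases \<omega>) auto
  have len: "length l = n" if "l \<in> set_pmf L" for l using that by (simp add: L_def set_iid_pmf)
  define M0 where "M0 l = \<phi>0 (map fst l)" for l :: "('x \<times> 'y) list"
  define MY where "MY l = \<phi>Y (map snd l) (M0 l)" for l :: "('x \<times> 'y) list"
  define xi where "xi i l = fst (l ! i)" for i and l :: "('x \<times> 'y) list"
  define yi where "yi i l = snd (l ! i)" for i and l :: "('x \<times> 'y) list"
  define ui where "ui i l = (i, M0 l, take i (map fst l), drop (Suc i) (map snd l))" for i and l :: "('x \<times> 'y) list"
  define X where "X = (\<lambda>(i,l). xi i l)"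
  define Y where "Y = (\<lambda>(i,l). yi i l)"
  define U where "U = (\<lambda>(i,l). ui i l)"
  define W where "W = (\<lambda>(i::nat,l). MY l)"
  define D where "D = (\<lambda>(i,l::('x \<times> 'y) list). drop (Suc i) (map fst l))"
  note XY = X_def Y_def U_def W_def D_def
  define q where "q = map_pmf (X \<bowtie> Y \<bowtie> U \<bowtie> W) \<Omega>"
  have finq: "finite (set_pmf q)" using fin\<Omega> by (simp add: q_def)

  have nth_\<Omega>: "map_pmf (\<lambda>(i,l). l ! i) \<Omega> = p"
  proof -
    have "map_pmf (\<lambda>(i,l). l ! i) \<Omega> = bind_pmf (pmf_of_set {..<n}) (\<lambda>i. map_pmf (\<lambda>l. l ! i) L)"
      by (simp add: \<Omega>_def pair_pmf_def map_bind_pmf map_pmf_def bind_assoc_pmf bind_return_pmf)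
    also have "\<dots> = bind_pmf (pmf_of_set {..<n}) (\<lambda>i. p)"
      using ne by (intro bind_pmf_cong refl) (auto simp: L_def map_nth_iid_pmf)
    finally show ?thesis by simp
  qed
  have marg: "map_pmf (X \<bowtie> Y) \<Omega> = p"
    using nth_\<Omega> by (simp add: XY xi_def yi_def case_prod_unfold)

  \<comment> \<open>Past, present and future of position \<open>i\<close> are independent; all three
    Markov chains below come from this.\<close>
  have law_i: "pexp L (\<lambda>l. of_bool (l ! i = (x,y) \<and> EA (take i l) \<and> EB (drop (Suc i) l)))
      = pmf p (x,y) * (pexp (iid_pmf i p) (\<lambda>as. of_bool (EA as)) * pexp (iid_pmf (n - Suc i) p) (\<lambda>bs. of_bool (EB bs)))"
    if i: "i < n" for i x y EA EB
  proof -
    have "pexp L (\<lambda>l. of_bool (l ! i = (x,y) \<and> EA (take i l) \<and> EB (drop (Suc i) l)))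
       = pexp (iid_pmf i p) (\<lambda>as. pexp p (\<lambda>z. pexp (iid_pmf (n - Suc i) p)
           (\<lambda>bs. of_bool (EA as) * (of_bool (z = (x,y)) * of_bool (EB bs)))))"
      unfolding L_def pexp_iid_at[OF fin i]
      by (intro pexp_cong) (auto simp: set_iid_pmf nth_append)
    also have "\<dots> = pexp (iid_pmf i p) (\<lambda>as. of_bool (EA as)) * (pmf p (x,y) * pexp (iid_pmf (n - Suc i) p) (\<lambda>bs. of_bool (EB bs)))"
      by (simp only: pexp_cmult pexp_multc pexp_of_bool_eq[OF fin])
    finally show ?thesis by simp
  qed
  have law_Z: "pmf (map_pmf (\<lambda>(i,l). (i, Z i l)) \<Omega>) (i, z) = pexp L (\<lambda>l. of_bool (Z i l = z)) / real n"
    if "i < n" for Z :: "nat \<Rightarrow> ('x \<times> 'y) list \<Rightarrow> 'z" and i z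
    unfolding \<Omega>_def pmf_time_sharing[OF finL that]
    using pexp_of_bool_eq[of "map_pmf (Z i) L" z] finL by (simp add: pexp_map)
  have map_take_drop: "xi i l = map fst l ! i" "yi i l = map snd l ! i"
     "map fst l = take i (map fst l) @ xi i l # drop (Suc i) (map fst l)"
     "map snd l = take i (map snd l) @ yi i l # drop (Suc i) (map snd l)"
    if "l \<in> set_pmf L" "i < n" for i l
    using that len[OF that(1)] id_take_nth_drop[of i "map fst l"] id_take_nth_drop[of i "map snd l"]
    by (auto simp: xi_def yi_def)

  \<comment> \<open>Once \<open>U\<close> is fixed, the joint event splits. The future together with
    the condition on \<open>\<phi>0\<close> depends on \<open>x\<close> and \<open>d\<close> but not
    on \<open>y\<close>, giving \<open>aa\<close>; the past together with the condition on
    \<open>\<phi>Y\<close> depends on \<open>y\<close> and \<open>w\<close> but not on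
    \<open>x\<close>, giving \<open>bb\<close>. Summing out \<open>d\<close> and \<open>w\<close>
    yields \<open>a'\<close>.\<close>
  define aa where "aa u x d = (case u of (i,m,xa,yb) \<Rightarrow> (if i < n then
      pexp (iid_pmf (n - Suc i) p) (\<lambda>bs. of_bool (map fst bs = d \<and> map snd bs = yb \<and> \<phi>0 (xa @ x # d) = m)) / real n else 0))"
    for u :: "nat \<times> nat \<times> 'x list \<times> 'y list" and x d
  define bb where "bb u y w = (case u of (i,m,xa,yb) \<Rightarrow>
      pexp (iid_pmf i p) (\<lambda>as. of_bool (map fst as = xa \<and> \<phi>Y (map snd as @ y # yb) m = w)))"
    for u :: "nat \<times> nat \<times> 'x list \<times> 'y list" and y w
  define a' where "a' u x = (case u of (i,m,xa,yb) \<Rightarrow> (if i < n then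
      pexp (iid_pmf i p) (\<lambda>as. of_bool (map fst as = xa)) *
      pexp (iid_pmf (n - Suc i) p) (\<lambda>bs. of_bool (map snd bs = yb \<and> \<phi>0 (xa @ x # map fst bs) = m)) / real n else 0))"
    for u :: "nat \<times> nat \<times> 'x list \<times> 'y list" and x
  have law5: "pmf (map_pmf (D \<bowtie> X \<bowtie> Y \<bowtie> U \<bowtie> W) \<Omega>) (d,x,y,u,w)
      = pmf p (x,y) * aa u x d * bb u y w" for d x y u w
  proof -
    obtain i m xa yb where u: "u = (i,m,xa,yb)" by (cases u) auto
    show ?thesis
    proof (cases "i < n")
      case False
      then have "(d,x,y,u,w) \<notin> (D \<bowtie> X \<bowtie> Y \<bowtie> U \<bowtie> W) ` set_pmf \<Omega>"
        by (auto simp: u set\<Omega> U_def ui_def)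
      then show ?thesis using False by (simp add: pmf_map_outside aa_def u)
    next
      case i: True
      define Z where "Z i l = (drop (Suc i) (map fst l), xi i l, yi i l, ui i l, MY l)" for i l
      have "pmf (map_pmf (D \<bowtie> X \<bowtie> Y \<bowtie> U \<bowtie> W) \<Omega>) (d,x,y,u,w)
         = pmf (map_pmf (\<lambda>(i,l). (i, Z i l)) \<Omega>) (i, (d,x,y,u,w))"
        unfolding pmf_map by (rule arg_cong[of _ _ "measure_pmf.prob \<Omega>"]) (auto simp: u XY Z_def ui_def)
      also have "\<dots> = pexp L (\<lambda>l. of_bool (Z i l = (d,x,y,u,w))) / real n" by (rule law_Z[OF i])
      also have "pexp L (\<lambda>l. of_bool (Z i l = (d,x,y,u,w)))
         = pexp L (\<lambda>l. of_bool (l ! i = (x,y) \<and>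
             (map fst (take i l) = xa \<and> \<phi>Y (map snd (take i l) @ y # yb) m = w) \<and>
             (map fst (drop (Suc i) l) = d \<and> map snd (drop (Suc i) l) = yb \<and> \<phi>0 (xa @ x # d) = m)))"
      proof (intro pexp_cong arg_cong[of _ _ of_bool])
        fix l assume l: "l \<in> set_pmf L"
        note md = map_take_drop[OF l i]
        have "Z i l = (d,x,y,u,w) \<longleftrightarrow> xi i l = x \<and> yi i l = y \<and> take i (map fst l) = xa
            \<and> drop (Suc i) (map fst l) = d \<and> drop (Suc i) (map snd l) = yb \<and> M0 l = m \<and> MY l = w"
          by (auto simp: Z_def ui_def u)
        also have "\<dots> \<longleftrightarrow> xi i l = x \<and> yi i l = y \<and> take i (map fst l) = xa
            \<and> drop (Suc i) (map fst l) = d \<and> drop (Suc i) (map snd l) = yb \<and> \<phi>0 (xa @ x # d) = m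
            \<and> \<phi>Y (take i (map snd l) @ y # yb) m = w"
          unfolding M0_def MY_def by (metis md(3,4))
        finally show "Z i l = (d,x,y,u,w) \<longleftrightarrow> l ! i = (x,y) \<and>
             (map fst (take i l) = xa \<and> \<phi>Y (map snd (take i l) @ y # yb) m = w) \<and>
             (map fst (drop (Suc i) l) = d \<and> map snd (drop (Suc i) l) = yb \<and> \<phi>0 (xa @ x # d) = m)"
          by (auto simp: xi_def yi_def take_map drop_map prod_eq_iff)
      qed
      also have "\<dots> = pmf p (x,y) * (pexp (iid_pmf i p) (\<lambda>as. of_bool (map fst as = xa \<and> \<phi>Y (map snd as @ y # yb) m = w))
          * pexp (iid_pmf (n - Suc i) p) (\<lambda>bs. of_bool (map fst bs = d \<and> map snd bs = yb \<and> \<phi>0 (xa @ x # d) = m)))"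
        by (rule law_i[OF i])
      finally show ?thesis using i by (simp add: aa_def bb_def u)
    qed
  qed
  have law3: "pmf (map_pmf (U \<bowtie> X \<bowtie> Y) \<Omega>) (u,x,y) = a' u x * pmf p (x,y)" for x y u
  proof -
    obtain i m xa yb where u: "u = (i,m,xa,yb)" by (cases u) auto
    show ?thesis
    proof (cases "i < n")
      case False
      then have "(u,x,y) \<notin> (U \<bowtie> X \<bowtie> Y) ` set_pmf \<Omega>"
        by (auto simp: u set\<Omega> U_def ui_def)
      then show ?thesis using False by (simp add: pmf_map_outside a'_def u)
    next
      case i: True
      define Z where "Z i l = (ui i l, xi i l, yi i l)" for i l
      have "pmf (map_pmf (U \<bowtie> X \<bowtie> Y) \<Omega>) (u,x,y)
         = pmf (map_pmf (\<lambda>(i,l). (i, Z i l)) \<Omega>) (i, (u,x,y))"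
        unfolding pmf_map by (rule arg_cong[of _ _ "measure_pmf.prob \<Omega>"]) (auto simp: u XY Z_def ui_def)
      also have "\<dots> = pexp L (\<lambda>l. of_bool (Z i l = (u,x,y))) / real n" by (rule law_Z[OF i])
      also have "pexp L (\<lambda>l. of_bool (Z i l = (u,x,y)))
         = pexp L (\<lambda>l. of_bool (l ! i = (x,y) \<and> map fst (take i l) = xa \<and>
             (map snd (drop (Suc i) l) = yb \<and> \<phi>0 (xa @ x # map fst (drop (Suc i) l)) = m)))"
      proof (intro pexp_cong arg_cong[of _ _ of_bool])
        fix l assume l: "l \<in> set_pmf L"
        note md = map_take_drop[OF l i]
        have "Z i l = (u,x,y) \<longleftrightarrow> xi i l = x \<and> yi i l = y \<and> take i (map fst l) = xa
            \<and> drop (Suc i) (map snd l) = yb \<and> M0 l = m"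
          by (auto simp: Z_def ui_def u)
        also have "\<dots> \<longleftrightarrow> xi i l = x \<and> yi i l = y \<and> take i (map fst l) = xa
            \<and> drop (Suc i) (map snd l) = yb \<and> \<phi>0 (xa @ x # drop (Suc i) (map fst l)) = m"
          unfolding M0_def by (metis md(3))
        finally show "Z i l = (u,x,y) \<longleftrightarrow> l ! i = (x,y) \<and> map fst (take i l) = xa \<and>
             (map snd (drop (Suc i) l) = yb \<and> \<phi>0 (xa @ x # map fst (drop (Suc i) l)) = m)"
          by (auto simp: xi_def yi_def take_map drop_map prod_eq_iff)
      qed
      also have "\<dots> = pmf p (x,y) * (pexp (iid_pmf i p) (\<lambda>as. of_bool (map fst as = xa))
          * pexp (iid_pmf (n - Suc i) p) (\<lambda>bs. of_bool (map snd bs = yb \<and> \<phi>0 (xa @ x # map fst bs) = m)))"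
        by (rule law_i[OF i])
      finally show ?thesis using i by (simp add: a'_def u)
    qed
  qed
  have markov1: "markov_chain_pmf (map_pmf (U \<bowtie> X \<bowtie> Y) \<Omega>)"
    using fin\<Omega> law3 by (intro markov_chain_pmfI[where \<alpha>=a' and \<beta>="\<lambda>x y. pmf p (x,y)"]) auto
  have markov2: "markov_chain_pmf (map_pmf (X \<bowtie> (U \<bowtie> Y) \<bowtie> W) \<Omega>)"
  proof (rule markov_chain_pmfI[where \<alpha>="\<lambda>x (u,y). pmf p (x,y) * (\<Sum>d\<in>D ` set_pmf \<Omega>. aa u x d)"
        and \<beta>="\<lambda>(u,y) w. bb u y w"])
    fix x and b :: "(nat \<times> nat \<times> 'x list \<times> 'y list) \<times> 'y" and w
    obtain u y where b: "b = (u,y)" by (cases b)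
    have "pmf (map_pmf (\<lambda>\<omega>. (D \<omega>, (X \<omega>, (U \<omega>, Y \<omega>), W \<omega>))) \<Omega>) (d, (x,(u,y),w))
       = (pmf p (x,y) * bb u y w) * aa u x d" for d
    proof -
      have "pmf (map_pmf (\<lambda>\<omega>. (D \<omega>, (X \<omega>, (U \<omega>, Y \<omega>), W \<omega>))) \<Omega>) (d, (x,(u,y),w))
        = pmf (map_pmf (D \<bowtie> X \<bowtie> Y \<bowtie> U \<bowtie> W) \<Omega>) (d,x,y,u,w)"
        unfolding pmf_map by (rule arg_cong[of _ _ "measure_pmf.prob \<Omega>"]) auto
      then show ?thesis by (simp add: law5)
    qed
    from pmf_marginal_factor[OF fin\<Omega> this]
    show "pmf (map_pmf (X \<bowtie> (U \<bowtie> Y) \<bowtie> W) \<Omega>) (x, b, w)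
       = (case b of (u,y) \<Rightarrow> pmf p (x,y) * (\<Sum>d\<in>D ` set_pmf \<Omega>. aa u x d)) * (case b of (u,y) \<Rightarrow> \<lambda>w. bb u y w) w"
      by (simp add: b)
  qed (use fin\<Omega> in auto)
  \<comment> \<open>This chain makes the suffix \<open>D\<close> irrelevant for guessing
    \<open>f\<close> from \<open>(X,U,W)\<close>.\<close>
  have markov3: "markov_chain_pmf (map_pmf (Y \<bowtie> (X \<bowtie> U \<bowtie> W) \<bowtie> D) \<Omega>)"
  proof (rule markov_chain_pmfI[where \<alpha>="\<lambda>y (x,u,w). pmf p (x,y) * bb u y w" and \<beta>="\<lambda>(x,u,w) d. aa u x d"])
    fix y d and b :: "'x \<times> (nat \<times> nat \<times> 'x list \<times> 'y list) \<times> nat"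
    obtain x u w where b: "b = (x,u,w)" by (cases b)
    have "pmf (map_pmf (Y \<bowtie> (X \<bowtie> U \<bowtie> W) \<bowtie> D) \<Omega>) (y, (x,u,w), d)
        = pmf (map_pmf (D \<bowtie> X \<bowtie> Y \<bowtie> U \<bowtie> W) \<Omega>) (d,x,y,u,w)"
      unfolding pmf_map by (rule arg_cong[of _ _ "measure_pmf.prob \<Omega>"]) auto
    then show "pmf (map_pmf (Y \<bowtie> (X \<bowtie> U \<bowtie> W) \<bowtie> D) \<Omega>) (y, b, d)
       = (case b of (x,u,w) \<Rightarrow> pmf p (x,y) * bb u y w) * (case b of (x,u,w) \<Rightarrow> \<lambda>d. aa u x d) d"
      by (simp add: b law5)
  qed (use fin\<Omega> in auto)

  \<comment> \<open>The prefix stored in \<open>U\<close>, the current letter and \<open>D\<close>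
    restore the whole source word; the guess is the letter of the decoder output at the time index
    in \<open>U\<close>.\<close>
  define est where "est z d = \<psi> (\<phi>X (fst (snd (snd (fst (snd z)))) @ fst z # d)) (snd (snd z)) ! fst (fst (snd z))"
    for z :: "'x \<times> (nat \<times> nat \<times> 'x list \<times> 'y list) \<times> nat" and d
  obtain g where g: "measure_pmf.prob \<Omega> {\<omega>. f (X \<omega>) (Y \<omega>) \<noteq> g (X \<omega>, U \<omega>, W \<omega>)}
     \<le> measure_pmf.prob \<Omega> {\<omega>. f (X \<omega>) (Y \<omega>) \<noteq> est (X \<omega>, U \<omega>, W \<omega>) (D \<omega>)}"
    using estimator_without_irrelevant[OF fin\<Omega> markov3, of "\<lambda>y z. f (fst z) y" est] by auto
  have "measure_pmf.prob \<Omega> {\<omega>. f (X \<omega>) (Y \<omega>) \<noteq> est (X \<omega>, U \<omega>, W \<omega>) (D \<omega>)}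
     = pexp (pmf_of_set {..<n}) (\<lambda>i. pexp L (\<lambda>l. of_bool (f (xi i l) (yi i l) \<noteq>
         \<psi> (\<phi>X (take i (map fst l) @ xi i l # drop (Suc i) (map fst l))) (MY l) ! i)))"
    unfolding prob_eq_pexp[OF fin\<Omega>] unfolding \<Omega>_def using finL ne
    by (simp add: pexp_pair XY ui_def est_def)
  also have "\<dots> \<le> \<epsilon>"
  proof (rule pexp_le_const)
    fix i assume "i \<in> set_pmf (pmf_of_set {..<n})"
    then have i: "i < n" using ne by simp
    have "pexp L (\<lambda>l. of_bool (f (xi i l) (yi i l) \<noteq>
         \<psi> (\<phi>X (take i (map fst l) @ xi i l # drop (Suc i) (map fst l))) (MY l) ! i))
       \<le> pexp L (\<lambda>l. of_bool (\<psi> (\<phi>X (map fst l)) (\<phi>Y (map snd l) (\<phi>0 (map fst l))) \<noteq> map (\<lambda>(x,y). f x y) l))"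
    proof (rule pexp_mono)
      fix l assume l: "l \<in> set_pmf L"
      have "f (xi i l) (yi i l) = map (\<lambda>(x,y). f x y) l ! i"
        using i len[OF l] by (simp add: xi_def yi_def case_prod_unfold)
      then show "of_bool (f (xi i l) (yi i l) \<noteq>
         \<psi> (\<phi>X (take i (map fst l) @ xi i l # drop (Suc i) (map fst l))) (MY l) ! i)
        \<le> (of_bool (\<psi> (\<phi>X (map fst l)) (\<phi>Y (map snd l) (\<phi>0 (map fst l))) \<noteq> map (\<lambda>(x,y). f x y) l) :: real)"
        unfolding map_take_drop(3)[OF l i, symmetric] MY_def M0_def by auto
    qed
    also have "\<dots> = code_error p f n \<phi>0 \<phi>X \<phi>Y \<psi>"
      unfolding code_error_def L_def by (rule prob_eq_pexp[OF finite_set_iid_pmf[OF fin], symmetric])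
    also have "\<dots> \<le> \<epsilon>" by (rule err)
    finally show "pexp L (\<lambda>l. of_bool (f (xi i l) (yi i l) \<noteq>
         \<psi> (\<phi>X (take i (map fst l) @ xi i l # drop (Suc i) (map fst l))) (MY l) ! i)) \<le> \<epsilon>" .
  qed (use ne in simp)
  finally have err_g: "measure_pmf.prob \<Omega> {\<omega>. f (X \<omega>) (Y \<omega>) \<noteq> g (X \<omega>, U \<omega>, W \<omega>)} \<le> \<epsilon>"
    using g by linarith

  let ?HL = "rv_entropy L" and ?H = "rv_entropy \<Omega>"
  define hXY where "hXY = entropy_pmf p"
  define hX where "hX = entropy_pmf (map_pmf fst p)"
  define hY where "hY = entropy_pmf (map_pmf snd p)"
  have HXY: "?H (X \<bowtie> Y) = hXY" by (simp add: rv_entropy_def marg hXY_def)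
  have "map_pmf Y \<Omega> = map_pmf snd p" unfolding marg[symmetric] by (simp add: map_pmf_comp)
  then have HY: "?H Y = hY" by (simp add: rv_entropy_def hY_def)
  have HLn: "?HL (\<lambda>l. l) = real n * hXY"
    by (simp add: rv_entropy_def L_def hXY_def entropy_iid_pmf[OF fin])
  have HLX: "?HL (map fst) = real n * hX" "?HL (map snd) = real n * hY"
    using fin by (simp_all add: rv_entropy_def L_def hX_def hY_def map_iid_pmf entropy_iid_pmf)
  have HLxi: "?HL (xi i) = hX" "?HL (yi i \<bowtie> xi i) = hXY" if i: "i < n" for i
  proof -
    have "map_pmf (xi i) L = map_pmf fst (map_pmf (\<lambda>l. l ! i) L)"
      by (simp add: map_pmf_comp xi_def[abs_def])
    then show "?HL (xi i) = hX" using i by (simp add: rv_entropy_def hX_def L_def map_nth_iid_pmf)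
    have "?HL (yi i \<bowtie> xi i) = ?HL (\<lambda>l. l ! i)"
      by (rule rv_entropy_cong[OF finL]) (auto simp: xi_def yi_def prod_eq_iff)
    then show "?HL (yi i \<bowtie> xi i) = hXY"
      using i by (simp add: rv_entropy_def hXY_def L_def map_nth_iid_pmf)
  qed
  \<comment> \<open>Any variable that determines \<open>U\<close> determines the time index.\<close>
  have ts: "?H V = log 2 (real n) + (\<Sum>i<n. ?HL (\<lambda>l. V (i, l))) / real n"
    if "\<And>\<omega> \<omega>'. V \<omega> = V \<omega>' \<Longrightarrow> U \<omega> = U \<omega>'" for V :: "nat \<times> ('x \<times> 'y) list \<Rightarrow> 'v"
  proof -
    have "?H V = ?H (\<lambda>(i,l). (i, V (i, l)))"
      by (rule rv_entropy_cong[OF fin\<Omega>]) (use that in \<open>fastforce simp: U_def ui_def\<close>)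
    then show ?thesis unfolding \<Omega>_def using rv_entropy_time_sharing[OF finL n] by simp
  qed

  have card_n0: "num_msgs n R0 > 0" "num_msgs n RY > 0"
    and M0_lt: "M0 l < num_msgs n R0" and MY_lt: "MY l < num_msgs n RY" if "l \<in> set_pmf L" for l
  proof -
    show "M0 l < num_msgs n R0" using code len[OF that] by (simp add: M0_def is_code_def)
    moreover from this show "MY l < num_msgs n RY" using code len[OF that] by (simp add: MY_def is_code_def)
    ultimately show "num_msgs n R0 > 0" "num_msgs n RY > 0" by linarith+
  qed
  obtain l0 where "l0 \<in> set_pmf L" using set_pmf_not_empty by fast
  note pos = card_n0[OF this]
  have HM0: "?HL M0 \<le> real n * R0"
  proof -
    have "?HL M0 \<le> log 2 (real (card {..<num_msgs n R0}))"
      unfolding rv_entropy_def by (rule entropy_pmf_le_log_card) (use M0_lt in auto)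
    then show ?thesis using log_num_msgs_le[OF pos(1)] by simp
  qed
  have HMY: "?HL MY \<le> real n * RY"
  proof -
    have "?HL MY \<le> log 2 (real (card {..<num_msgs n RY}))"
      unfolding rv_entropy_def by (rule entropy_pmf_le_log_card) (use MY_lt in auto)
    then show ?thesis using log_num_msgs_le[OF pos(2)] by simp
  qed

  have rate0: "cond_mi_pmf (map_pmf (X \<bowtie> U \<bowtie> Y) \<Omega>) \<le> R0"
  proof -
    \<comment> \<open>The increments of \<open>h\<close> are H(X_i | M0, X_1..X_(i-1), Y^n), and
      forgetting the earlier \<open>Y\<close> letters only increases them to H(X_i | U_i, Y_i). The
      sum telescopes from H(M0, Y^n), at most nR0 + nH(Y), to at least nH(X,Y).\<close>
    define h where "h i = ?HL (\<lambda>l. (M0 l, take i (map fst l), map snd l))" for i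
    have step: "h (Suc i) - h i \<le> ?HL (xi i \<bowtie> ui i \<bowtie> yi i) - ?HL (ui i \<bowtie> yi i)" if i: "i < n" for i
    proof -
      have "?HL (\<lambda>l. (xi i l, take i (map snd l), ui i l, yi i l)) = h (Suc i)"
        unfolding h_def
      proof (rule rv_entropy_cong[OF finL])
        fix l l' assume l: "l \<in> set_pmf L" "l' \<in> set_pmf L"
        show "(xi i l, take i (map snd l), ui i l, yi i l) = (xi i l', take i (map snd l'), ui i l', yi i l')
          \<longleftrightarrow> (M0 l, take (Suc i) (map fst l), map snd l) = (M0 l', take (Suc i) (map fst l'), map snd l')"
          using i len[OF l(1)] len[OF l(2)] take_Suc_eq_iff[of i "map fst l" "map fst l'"]
            list_eq_iff_split_at[of i "map snd l" "map snd l'"]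
          by (auto simp: ui_def xi_def yi_def simp del: map_eq_conv)
      qed
      moreover have "?HL (\<lambda>l. (take i (map snd l), ui i l, yi i l)) = h i"
        unfolding h_def
      proof (rule rv_entropy_cong[OF finL])
        fix l l' assume l: "l \<in> set_pmf L" "l' \<in> set_pmf L"
        show "(take i (map snd l), ui i l, yi i l) = (take i (map snd l'), ui i l', yi i l')
          \<longleftrightarrow> (M0 l, take i (map fst l), map snd l) = (M0 l', take i (map fst l'), map snd l')"
          using i len[OF l(1)] len[OF l(2)] list_eq_iff_split_at[of i "map snd l" "map snd l'"]
          by (auto simp: ui_def xi_def yi_def simp del: map_eq_conv)
      qed
      ultimately show ?thesis
        using rv_entropy_submodular[OF finL, of "xi i" "\<lambda>l. take i (map snd l)" "ui i \<bowtie> yi i"] by simp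
    qed
    have "real n * hXY - (real n * R0 + real n * hY) \<le> h n - h 0"
    proof -
      have "?HL (\<lambda>l. l) \<le> h n" unfolding h_def
        by (rule rv_entropy_mono[OF finL]) (auto simp: len list_pair_eq_iff simp del: map_eq_conv)
      moreover have "h 0 \<le> ?HL (M0 \<bowtie> map snd)" unfolding h_def
        by (rule rv_entropy_mono[OF finL]) auto
      moreover have "\<dots> \<le> ?HL M0 + ?HL (map snd)" by (rule rv_entropy_subadditive[OF finL])
      ultimately show ?thesis using HLn HLX HM0 by linarith
    qed
    also have "\<dots> = (\<Sum>i<n. h (Suc i) - h i)" by (simp add: sum_lessThan_telescope)
    also have "\<dots> \<le> (\<Sum>i<n. ?HL (xi i \<bowtie> ui i \<bowtie> yi i) - ?HL (ui i \<bowtie> yi i))"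
      using step by (intro sum_mono) auto
    finally have main: "real n * (hXY - hY - R0)
       \<le> (\<Sum>i<n. ?HL (xi i \<bowtie> ui i \<bowtie> yi i)) - (\<Sum>i<n. ?HL (ui i \<bowtie> yi i))"
      by (simp add: sum_subtractf algebra_simps)
    have e: "?H (U \<bowtie> Y) = log 2 (real n) + (\<Sum>i<n. ?HL (ui i \<bowtie> yi i)) / real n"
      "?H (X \<bowtie> U \<bowtie> Y) = log 2 (real n) + (\<Sum>i<n. ?HL (xi i \<bowtie> ui i \<bowtie> yi i)) / real n"
      using ts[of "U \<bowtie> Y"] ts[of "X \<bowtie> U \<bowtie> Y"] by (simp_all add: X_def Y_def U_def)
    have "hXY - hY - R0 \<le> ((\<Sum>i<n. ?HL (xi i \<bowtie> ui i \<bowtie> yi i)) - (\<Sum>i<n. ?HL (ui i \<bowtie> yi i))) / real n"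
      using main n by (simp add: pos_le_divide_eq mult.commute)
    then show ?thesis unfolding cond_mi_pmf_map e HXY HY by (simp add: diff_divide_distrib)
  qed
  have rateY: "cond_mi_pmf (map_pmf (Y \<bowtie> W \<bowtie> (X \<bowtie> U)) \<Omega>) \<le> RY"
  proof -
    \<comment> \<open>The decrements of \<open>k\<close> are H(Y_i | MY, X^n, Y_(i+1)..Y_n);
      \<open>M0\<close> is implicit, being a function of X^n. The sum telescopes from at least
      nH(X,Y) down to at most nRY + nH(X).\<close>
    define k where "k i = ?HL (\<lambda>l. (MY l, map fst l, drop i (map snd l)))" for i
    \<comment> \<open>I(Y_i; MY | X_i, U_i). Its positive part H(Y_i | X_i, U_i) is at most H(Y|X),
      and the subtracted H(Y_i | MY, X_i, U_i) is at least the decrement of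
      \<open>k\<close>.\<close>
    define J where "J i = ?HL (yi i \<bowtie> xi i \<bowtie> ui i) + ?HL (MY \<bowtie> xi i \<bowtie> ui i)
       - ?HL (yi i \<bowtie> MY \<bowtie> xi i \<bowtie> ui i) - ?HL (xi i \<bowtie> ui i)" for i
    have step: "J i \<le> hXY - hX - (k i - k (Suc i))" if i: "i < n" for i
    proof -
      have "?HL (yi i \<bowtie> ui i \<bowtie> xi i) + ?HL (xi i) \<le> ?HL (yi i \<bowtie> xi i) + ?HL (ui i \<bowtie> xi i)"
        by (rule rv_entropy_submodular[OF finL])
      moreover have "?HL (yi i \<bowtie> ui i \<bowtie> xi i) = ?HL (yi i \<bowtie> xi i \<bowtie> ui i)"
        by (rule rv_entropy_cong[OF finL]) auto
      moreover have "?HL (ui i \<bowtie> xi i) = ?HL (xi i \<bowtie> ui i)"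
        by (rule rv_entropy_cong[OF finL]) auto
      moreover have "?HL (yi i \<bowtie> map fst \<bowtie> MY \<bowtie> xi i \<bowtie> ui i) + ?HL (MY \<bowtie> xi i \<bowtie> ui i)
         \<le> ?HL (yi i \<bowtie> MY \<bowtie> xi i \<bowtie> ui i) + ?HL (map fst \<bowtie> MY \<bowtie> xi i \<bowtie> ui i)"
        by (rule rv_entropy_submodular[OF finL])
      moreover have "?HL (yi i \<bowtie> map fst \<bowtie> MY \<bowtie> xi i \<bowtie> ui i) = k i"
        unfolding k_def
      proof (rule rv_entropy_cong[OF finL])
        fix l l' assume l: "l \<in> set_pmf L" "l' \<in> set_pmf L"
        have "map fst l = map fst l' \<Longrightarrow> xi i l = xi i l'"
          by (metis map_take_drop(1)[OF l(1) i] map_take_drop(1)[OF l(2) i])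
        then show "(yi i l, map fst l, MY l, xi i l, ui i l) = (yi i l', map fst l', MY l', xi i l', ui i l')
          \<longleftrightarrow> (MY l, map fst l, drop i (map snd l)) = (MY l', map fst l', drop i (map snd l'))"
          using i len[OF l(1)] len[OF l(2)] drop_eq_iff_Suc[of i "map snd l" "map snd l'"]
          by (auto simp: ui_def yi_def M0_def simp del: map_eq_conv)
      qed
      moreover have "?HL (map fst \<bowtie> MY \<bowtie> xi i \<bowtie> ui i) = k (Suc i)"
        unfolding k_def
      proof (rule rv_entropy_cong[OF finL])
        fix l l' assume l: "l \<in> set_pmf L" "l' \<in> set_pmf L"
        show "(map fst l, MY l, xi i l, ui i l) = (map fst l', MY l', xi i l', ui i l')
          \<longleftrightarrow> (MY l, map fst l, drop (Suc i) (map snd l)) = (MY l', map fst l', drop (Suc i) (map snd l'))"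
          using map_take_drop(1)[OF l(1) i] map_take_drop(1)[OF l(2) i]
          by (auto simp: ui_def M0_def simp del: map_eq_conv)
      qed
      ultimately show ?thesis using HLxi[OF i] unfolding J_def by linarith
    qed
    have "(\<Sum>i<n. J i) \<le> (\<Sum>i<n. hXY - hX - (k i - k (Suc i)))"
      using step by (intro sum_mono) auto
    also have "\<dots> = real n * (hXY - hX) - (k 0 - k n)"
      using sum_lessThan_telescope[of k n] by (simp add: sum_subtractf sum.distrib algebra_simps)
    also have "\<dots> \<le> real n * RY"
    proof -
      have "?HL (\<lambda>l. l) \<le> k 0" unfolding k_def
        by (rule rv_entropy_mono[OF finL]) (auto simp: list_pair_eq_iff simp del: map_eq_conv)
      moreover have "k n \<le> ?HL (MY \<bowtie> map fst)" unfolding k_def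
        by (rule rv_entropy_mono[OF finL]) (auto simp: len simp del: map_eq_conv)
      moreover have "\<dots> \<le> ?HL MY + ?HL (map fst)" by (rule rv_entropy_subadditive[OF finL])
      ultimately show ?thesis using HLn HLX HMY by (simp add: right_diff_distrib)
    qed
    finally have main: "(\<Sum>i<n. J i) / real n \<le> RY" using n by (simp add: pos_divide_le_eq mult.commute)
    have e: "?H (Y \<bowtie> X \<bowtie> U) = log 2 (real n) + (\<Sum>i<n. ?HL (yi i \<bowtie> xi i \<bowtie> ui i)) / real n"
      "?H (W \<bowtie> X \<bowtie> U) = log 2 (real n) + (\<Sum>i<n. ?HL (MY \<bowtie> xi i \<bowtie> ui i)) / real n"
      "?H (Y \<bowtie> W \<bowtie> X \<bowtie> U) = log 2 (real n) + (\<Sum>i<n. ?HL (yi i \<bowtie> MY \<bowtie> xi i \<bowtie> ui i)) / real n"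
      "?H (X \<bowtie> U) = log 2 (real n) + (\<Sum>i<n. ?HL (xi i \<bowtie> ui i)) / real n"
      using ts[of "Y \<bowtie> X \<bowtie> U"] ts[of "W \<bowtie> X \<bowtie> U"] ts[of "Y \<bowtie> W \<bowtie> X \<bowtie> U"] ts[of "X \<bowtie> U"]
      by (simp_all add: X_def Y_def U_def W_def)
    show ?thesis
      unfolding cond_mi_pmf_map e using main
      by (simp add: J_def sum.distrib sum_subtractf add_divide_distrib diff_divide_distrib)
  qed
  show ?thesis
  proof (intro exI[of _ q] conjI)
    show "map_pmf (\<lambda>(x,y,u,w). (x,y)) q = p" using marg by (simp add: q_def map_pmf_comp)
    show "\<exists>g. measure_pmf.prob q {(x,y,u,w). f x y \<noteq> g x u w} \<le> \<epsilon>"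
      using err_g by (intro exI[of _ "\<lambda>x u w. g (x,u,w)"]) (simp add: q_def vimage_def)
  qed (use finq markov1 markov2 rate0 rateY in \<open>simp_all add: q_def map_pmf_comp\<close>)
qed

section \<open>Bounding the auxiliary alphabets\<close>

text \<open>Gaussian elimination, by induction on the equations: an unknown with nonzero coefficient
  in equation \<open>k\<close> is solved for and removed from the others.\<close>

lemma homogeneous_system_nontrivial:
  fixes v :: "'i \<Rightarrow> 'k \<Rightarrow> real"
  assumes "finite K" "finite S" "card K < card S"
  shows "\<exists>\<mu>. (\<exists>i\<in>S. \<mu> i \<noteq> 0) \<and> (\<forall>k\<in>K. (\<Sum>i\<in>S. \<mu> i * v i k) = 0)"
  using assms
proof (induction K arbitrary: S v rule: finite_induct)
  case empty
  then have "S \<noteq> {}" by auto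
  then show ?case by (intro exI[of _ "\<lambda>_. 1"]) auto
next
  case (insert k K)
  show ?case
  proof (cases "\<forall>i\<in>S. v i k = 0")
    case True
    obtain \<mu> where "\<exists>i\<in>S. \<mu> i \<noteq> 0" "\<forall>k\<in>K. (\<Sum>i\<in>S. \<mu> i * v i k) = 0"
      using insert.IH[of S v] insert.prems insert.hyps by auto
    then show ?thesis using True by (intro exI[of _ \<mu>]) auto
  next
    case False
    then obtain j where j: "j \<in> S" "v j k \<noteq> 0" by blast
    define v' where "v' i k' = v i k' - v j k' * v i k / v j k" for i k'
    obtain \<mu> where mu: "\<exists>i\<in>S - {j}. \<mu> i \<noteq> 0" "\<forall>k'\<in>K. (\<Sum>i\<in>S - {j}. \<mu> i * v' i k') = 0"
    proof -
      have "Suc (card K) < card S" "card (S - {j}) = card S - 1"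
        using insert.prems insert.hyps j by simp_all
      then have "card K < card (S - {j})" by linarith
      then show ?thesis using insert.IH[of "S - {j}" v'] insert.prems that by blast
    qed
    define t where "t = (\<Sum>i\<in>S - {j}. \<mu> i * v i k) / v j k"
    define \<nu> where "\<nu> = \<mu>(j := - t)"
    have sum_eq: "(\<Sum>i\<in>S. \<nu> i * v i k') = - t * v j k' + (\<Sum>i\<in>S - {j}. \<mu> i * v i k')" for k'
      using j insert.prems by (subst sum.remove[of S j]) (auto simp: \<nu>_def intro!: sum.cong)
    have "(\<Sum>i\<in>S. \<nu> i * v i k) = 0" unfolding sum_eq using j by (simp add: t_def)
    moreover have "(\<Sum>i\<in>S. \<nu> i * v i k') = 0" if "k' \<in> K" for k'
    proof -
      have "0 = (\<Sum>i\<in>S - {j}. \<mu> i * v i k' - (\<mu> i * v i k) * (v j k' / v j k))"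
        using mu(2) that by (simp add: v'_def right_diff_distrib mult_ac)
      also have "\<dots> = (\<Sum>i\<in>S - {j}. \<mu> i * v i k') - t * v j k'"
        unfolding sum_subtractf sum_distrib_right[symmetric] t_def by simp
      finally show ?thesis unfolding sum_eq by simp
    qed
    moreover have "\<exists>i\<in>S. \<nu> i \<noteq> 0" using mu(1) by (auto simp: \<nu>_def)
    ultimately show ?thesis by (intro exI[of _ \<nu>]) auto
  qed
qed

text \<open>
  A basic optimal solution of a linear program: positivity of the combination \<open>\<tau>\<close> of the
  constraints makes every direction in the kernel have a negative entry, so one can move
  along a cost-decreasing direction until a weight vanishes.
\<close>

lemma sparse_weights:
  fixes v :: "'i \<Rightarrow> 'k \<Rightarrow> real" and c \<rho> :: "'i \<Rightarrow> real"
  assumes fin: "finite I" "finite K" and pos: "\<And>i. i \<in> I \<Longrightarrow> (\<Sum>k\<in>K. \<tau> k * v i k) > 0"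
    and nn: "\<And>i. i \<in> I \<Longrightarrow> \<rho> i \<ge> 0"
  shows "\<exists>\<rho>'. (\<forall>i\<in>I. \<rho>' i \<ge> 0) \<and> card {i\<in>I. \<rho>' i \<noteq> 0} \<le> card K \<and>
     (\<forall>k\<in>K. (\<Sum>i\<in>I. \<rho>' i * v i k) = (\<Sum>i\<in>I. \<rho> i * v i k)) \<and>
     (\<Sum>i\<in>I. \<rho>' i * c i) \<le> (\<Sum>i\<in>I. \<rho> i * c i)"
  using nn
proof (induction "card {i\<in>I. \<rho> i \<noteq> 0}" arbitrary: \<rho> rule: less_induct)
  case less
  let ?S = "{i\<in>I. \<rho> i \<noteq> 0}"
  show ?case
  proof (cases "card ?S \<le> card K")
    case True
    then show ?thesis using less.prems by (intro exI[of _ \<rho>]) auto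
  next
    case False
    have finS: "finite ?S" using fin by auto
    obtain \<mu>0 where mu0: "\<exists>i\<in>?S. \<mu>0 i \<noteq> 0" "\<forall>k\<in>K. (\<Sum>i\<in>?S. \<mu>0 i * v i k) = 0"
      using homogeneous_system_nontrivial[OF fin(2) finS, of v] False by auto
    \<comment> \<open>The kernel direction is oriented so that following it does not raise the
      cost.\<close>
    define sg :: real where "sg = (if (\<Sum>i\<in>?S. \<mu>0 i * c i) \<le> 0 then 1 else -1)"
    define \<mu> where "\<mu> i = (if i \<in> ?S then sg * \<mu>0 i else 0)" for i
    have sumS: "(\<Sum>i\<in>I. \<mu> i * h i) = sg * (\<Sum>i\<in>?S. \<mu>0 i * h i)" for h :: "'i \<Rightarrow> real"
    proof -
      have "(\<Sum>i\<in>I. \<mu> i * h i) = (\<Sum>i\<in>?S. \<mu> i * h i)"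
        using fin by (intro sum.mono_neutral_right) (auto simp: \<mu>_def)
      also have "\<dots> = (\<Sum>i\<in>?S. sg * (\<mu>0 i * h i))" by (intro sum.cong) (auto simp: \<mu>_def)
      finally show ?thesis by (simp add: sum_distrib_left)
    qed
    have ker: "(\<Sum>i\<in>I. \<mu> i * v i k) = 0" if "k \<in> K" for k using mu0(2) that by (simp add: sumS)
    have cost: "(\<Sum>i\<in>I. \<mu> i * c i) \<le> 0" unfolding sumS by (auto simp: sg_def)
    have "\<exists>i\<in>?S. \<mu> i < 0"
    proof (rule ccontr)
      assume "\<not> ?thesis"
      then have ge: "\<mu> i \<ge> 0" for i by (cases "i \<in> ?S") (auto simp: \<mu>_def not_less)
      obtain j where j: "j \<in> ?S" "\<mu> j \<noteq> 0" using mu0(1) by (auto simp: \<mu>_def sg_def)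
      have "0 < \<mu> j * (\<Sum>k\<in>K. \<tau> k * v j k)" using j ge[of j] pos[of j] by auto
      also have "\<dots> \<le> (\<Sum>i\<in>I. \<mu> i * (\<Sum>k\<in>K. \<tau> k * v i k))"
        using j fin by (intro member_le_sum mult_nonneg_nonneg ge less_imp_le[OF pos]) auto
      also have "\<dots> = (\<Sum>k\<in>K. \<tau> k * (\<Sum>i\<in>I. \<mu> i * v i k))"
        unfolding sum_distrib_left by (subst sum.swap) (simp add: mult_ac)
      also have "\<dots> = 0" by (simp add: ker)
      finally show False by simp
    qed
    define N where "N = {i\<in>?S. \<mu> i < 0}"
    \<comment> \<open>The ratio test of the simplex method: the smallest ratio is the step at which
      the first weight reaches zero while all others stay nonnegative.\<close>
    define r where "r i = \<rho> i / (- \<mu> i)" for i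
    have N: "finite N" "N \<noteq> {}" using fin(1) \<open>\<exists>i\<in>?S. \<mu> i < 0\<close> by (auto simp: N_def)
    define j where "j = arg_min_on r N"
    have j: "j \<in> N" "\<And>i. i \<in> N \<Longrightarrow> r j \<le> r i"
      using arg_min_if_finite(1)[OF N] arg_min_least[OF N] by (auto simp: j_def)
    define t where "t = r j"
    have jS: "j \<in> I" "\<rho> j \<noteq> 0" "\<mu> j < 0" using j by (auto simp: N_def)
    have t: "t \<ge> 0" using less.prems[of j] jS by (auto simp: t_def r_def intro!: divide_nonneg_neg)
    define \<rho>1 where "\<rho>1 i = \<rho> i + t * \<mu> i" for i
    have nn1: "\<rho>1 i \<ge> 0" if "i \<in> I" for i
    proof (cases "i \<in> N")
      case True
      then have "\<mu> i < 0" by (simp add: N_def)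
      have "t \<le> \<rho> i / (- \<mu> i)" using j(2)[OF True] by (simp add: t_def r_def)
      moreover have "- \<mu> i > 0" using \<open>\<mu> i < 0\<close> by simp
      ultimately have "t * (- \<mu> i) \<le> \<rho> i" by (simp only: pos_le_divide_eq)
      then show ?thesis by (simp add: \<rho>1_def)
    next
      case False
      then have "\<mu> i \<ge> 0" using that by (cases "i \<in> ?S") (auto simp: N_def \<mu>_def)
      then show ?thesis using less.prems[OF that] t by (simp add: \<rho>1_def)
    qed
    have "\<rho>1 j = 0" using jS by (simp add: \<rho>1_def t_def r_def)
    then have "{i\<in>I. \<rho>1 i \<noteq> 0} \<subset> ?S" using jS by (auto simp: \<rho>1_def \<mu>_def)
    then have "card {i\<in>I. \<rho>1 i \<noteq> 0} < card ?S" by (rule psubset_card_mono[OF finS])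
    from less.hyps[OF this nn1] obtain \<rho>' where \<rho>': "\<forall>i\<in>I. \<rho>' i \<ge> 0" "card {i\<in>I. \<rho>' i \<noteq> 0} \<le> card K"
      "\<forall>k\<in>K. (\<Sum>i\<in>I. \<rho>' i * v i k) = (\<Sum>i\<in>I. \<rho>1 i * v i k)"
      "(\<Sum>i\<in>I. \<rho>' i * c i) \<le> (\<Sum>i\<in>I. \<rho>1 i * c i)" by blast
    have lin: "(\<Sum>i\<in>I. \<rho>1 i * h i) = (\<Sum>i\<in>I. \<rho> i * h i) + t * (\<Sum>i\<in>I. \<mu> i * h i)" for h :: "'i \<Rightarrow> real"
      by (simp add: \<rho>1_def distrib_right sum.distrib sum_distrib_left mult.assoc)
    have "(\<Sum>i\<in>I. \<rho>1 i * c i) \<le> (\<Sum>i\<in>I. \<rho> i * c i)"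
      unfolding lin using t cost by (simp add: mult_nonneg_nonpos)
    moreover have "\<forall>k\<in>K. (\<Sum>i\<in>I. \<rho>1 i * v i k) = (\<Sum>i\<in>I. \<rho> i * v i k)"
      unfolding lin by (simp add: ker)
    ultimately show ?thesis using \<rho>' by (intro exI[of _ \<rho>']) auto
  qed
qed

section \<open>Reweighting a law along one of its variables\<close>

lemma reweight_pmf_exists:
  assumes fin: "finite (set_pmf M)" and nn: "\<And>\<omega>. \<omega> \<in> set_pmf M \<Longrightarrow> h \<omega> \<ge> 0" and one: "pexp M h = 1"
  shows "\<exists>M'. \<forall>\<omega>. pmf M' \<omega> = h \<omega> * pmf M \<omega>"
proof -
  have nn': "h \<omega> * pmf M \<omega> \<ge> 0" for \<omega>
    using nn by (cases "\<omega> \<in> set_pmf M") (auto simp: set_pmf_iff)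
  have "(\<integral>\<^sup>+\<omega>. ennreal (h \<omega> * pmf M \<omega>) \<partial>count_space UNIV) = (\<Sum>\<omega>\<in>set_pmf M. ennreal (h \<omega> * pmf M \<omega>))"
    using fin by (intro nn_integral_count_space') (auto simp: set_pmf_iff)
  also have "\<dots> = ennreal (\<Sum>\<omega>\<in>set_pmf M. h \<omega> * pmf M \<omega>)"
    using nn' by (intro sum_ennreal) auto
  also have "\<dots> = 1" using one by (simp add: pexp_def mult.commute)
  finally show ?thesis
    using nn' by (intro exI[of _ "embed_pmf (\<lambda>\<omega>. h \<omega> * pmf M \<omega>)"]) (simp add: pmf_embed_pmf)
qed

text \<open>The density depends on \<open>V\<close> alone, so the conditional law given each
  surviving value of \<open>V\<close> is kept.\<close>

definition reweights :: "('v \<Rightarrow> real) \<Rightarrow> ('o \<Rightarrow> 'v) \<Rightarrow> 'o pmf \<Rightarrow> 'o pmf \<Rightarrow> bool" where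
  "reweights \<rho> V M M' \<longleftrightarrow> (\<forall>\<omega>. pmf M' \<omega> = \<rho> (V \<omega>) * pmf M \<omega>)"

lemma reweights_set_pmf: "reweights \<rho> V M M' \<Longrightarrow> set_pmf M' \<subseteq> set_pmf M"
  by (auto simp: reweights_def set_pmf_iff)

lemma reweights_pexp:
  assumes fin: "finite (set_pmf M)" and rw: "reweights \<rho> V M M'"
  shows "pexp M' h = pexp M (\<lambda>\<omega>. \<rho> (V \<omega>) * h \<omega>)"
proof -
  have "pexp M' h = (\<Sum>\<omega>\<in>set_pmf M. pmf M' \<omega> * h \<omega>)"
    unfolding pexp_def using fin reweights_set_pmf[OF rw]
    by (intro sum.mono_neutral_left) (auto simp: set_pmf_iff)
  then show ?thesis using rw by (simp add: pexp_def reweights_def mult_ac)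
qed

lemma reweights_pmf_map:
  assumes fin: "finite (set_pmf M)" and rw: "reweights \<rho> V M M'" and det: "\<And>\<omega>. A \<omega> = a \<Longrightarrow> V \<omega> = v"
  shows "pmf (map_pmf A M') a = \<rho> v * pmf (map_pmf A M) a"
proof -
  have fin': "finite (set_pmf M')" using fin reweights_set_pmf[OF rw] finite_subset by blast
  have "pmf (map_pmf A M') a = pexp M' (\<lambda>\<omega>. of_bool (A \<omega> = a))"
    using pexp_of_bool_eq[of "map_pmf A M'" a] fin' by (simp add: pexp_map)
  also have "\<dots> = pexp M (\<lambda>\<omega>. \<rho> v * of_bool (A \<omega> = a))"
    unfolding reweights_pexp[OF fin rw] using det by (intro pexp_cong) auto
  also have "\<dots> = \<rho> v * pmf (map_pmf A M) a"
    using pexp_of_bool_eq[of "map_pmf A M" a] fin by (simp add: pexp_map pexp_cmult)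
  finally show ?thesis .
qed

text \<open>Both variables determine \<open>V\<close>, so the weight cancels in the quotient of
  their atoms. The difference is therefore the mean of a function fixed by \<open>M\<close>, hence
  linear in the weights, and can serve as a constraint of the linear program.\<close>

lemma reweights_entropy_diff:
  assumes fin: "finite (set_pmf M)" and rw: "reweights \<rho> V M M'"
    and A: "\<And>\<omega> \<omega>'. A \<omega> = A \<omega>' \<Longrightarrow> V \<omega> = V \<omega>'" and B: "\<And>\<omega> \<omega>'. B \<omega> = B \<omega>' \<Longrightarrow> V \<omega> = V \<omega>'"
  shows "rv_entropy M' B - rv_entropy M' A
     = pexp M' (\<lambda>\<omega>. log 2 (pmf (map_pmf A M) (A \<omega>)) - log 2 (pmf (map_pmf B M) (B \<omega>)))"
proof -
  have fin': "finite (set_pmf M')" using fin reweights_set_pmf[OF rw] finite_subset by blast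
  have "rv_entropy M' B - rv_entropy M' A
     = pexp M' (\<lambda>\<omega>. - log 2 (pmf (map_pmf B M') (B \<omega>)) - - log 2 (pmf (map_pmf A M') (A \<omega>)))"
    by (simp only: rv_entropy_eq_pexp[OF fin'] pexp_diff)
  also have "\<dots> = pexp M' (\<lambda>\<omega>. log 2 (pmf (map_pmf A M) (A \<omega>)) - log 2 (pmf (map_pmf B M) (B \<omega>)))"
  proof (intro pexp_cong)
    fix \<omega> assume \<omega>: "\<omega> \<in> set_pmf M'"
    have a: "pmf (map_pmf A M') (A \<omega>) = \<rho> (V \<omega>) * pmf (map_pmf A M) (A \<omega>)"
      by (rule reweights_pmf_map[OF fin rw]) (rule A)
    have b: "pmf (map_pmf B M') (B \<omega>) = \<rho> (V \<omega>) * pmf (map_pmf B M) (B \<omega>)"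
      by (rule reweights_pmf_map[OF fin rw]) (rule B)
    have "pmf (map_pmf A M') (A \<omega>) > 0" using \<omega> by (rule pmf_map_pos)
    moreover have "\<omega> \<in> set_pmf M" using \<omega> reweights_set_pmf[OF rw] by (rule subsetD[rotated])
    then have "pmf (map_pmf A M) (A \<omega>) > 0" "pmf (map_pmf B M) (B \<omega>) > 0"
      by (simp_all only: pmf_map_pos)
    ultimately have "\<rho> (V \<omega>) > 0" unfolding a by (simp add: zero_less_mult_iff)
    then show "- log 2 (pmf (map_pmf B M') (B \<omega>)) - - log 2 (pmf (map_pmf A M') (A \<omega>))
       = log 2 (pmf (map_pmf A M) (A \<omega>)) - log 2 (pmf (map_pmf B M) (B \<omega>))"
      unfolding a b using \<open>pmf (map_pmf A M) (A \<omega>) > 0\<close> \<open>pmf (map_pmf B M) (B \<omega>) > 0\<close>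
      by (simp add: log_mult)
  qed
  finally show ?thesis .
qed

text \<open>The linear program over weights on the values of \<open>V\<close>, started from the
  constant weight 1. The atoms of \<open>S\<close> contribute one constraint each, \<open>K\<close>
  the remaining ones, and \<open>C\<close> is the cost.\<close>

lemma sparse_reweighting:
  fixes M :: "'o pmf" and V :: "'o \<Rightarrow> 'v" and S :: "'o \<Rightarrow> 's" and F :: "'k \<Rightarrow> 'o \<Rightarrow> real"
  assumes fin: "finite (set_pmf M)" and K: "finite K"
  shows "\<exists>\<rho> M'. reweights \<rho> V M M' \<and> map_pmf S M' = map_pmf S M \<and>
     (\<forall>k\<in>K. pexp M' (F k) = pexp M (F k)) \<and> pexp M' C \<le> pexp M C \<and>
     card (V ` set_pmf M') \<le> card (S ` set_pmf M) + card K"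
proof -
  let ?I = "V ` set_pmf M" and ?K = "(S ` set_pmf M) <+> K"
  define G where "G k = (case k of Inl s \<Rightarrow> (\<lambda>\<omega>. of_bool (S \<omega> = s)) | Inr k \<Rightarrow> F k)" for k
  define part where "part h i = (\<Sum>\<omega>\<in>{\<omega>\<in>set_pmf M. V \<omega> = i}. pmf M \<omega> * h \<omega>)" for h i
  \<comment> \<open>Adding up the atom constraints of \<open>S\<close> gives the total mass of a
    fibre of \<open>V\<close>, which is positive as \<open>sparse_weights\<close> demands.\<close>
  define \<tau> :: "'s + 'k \<Rightarrow> real" where "\<tau> k = (case k of Inl s \<Rightarrow> 1 | Inr k \<Rightarrow> 0)" for k
  have finI: "finite ?I" and finK: "finite ?K" using fin K by auto
  have lin: "(\<Sum>i\<in>?I. r i * part h i) = pexp M (\<lambda>\<omega>. r (V \<omega>) * h \<omega>)" for r h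
  proof -
    have "pexp M (\<lambda>\<omega>. r (V \<omega>) * h \<omega>) = (\<Sum>i\<in>?I. \<Sum>\<omega>\<in>{\<omega>\<in>set_pmf M. V \<omega> = i}. pmf M \<omega> * (r (V \<omega>) * h \<omega>))"
      unfolding pexp_def by (rule sum.image_gen[OF fin])
    also have "\<dots> = (\<Sum>i\<in>?I. r i * part h i)"
      unfolding part_def sum_distrib_left by (intro sum.cong refl) (auto simp: mult_ac)
    finally show ?thesis by simp
  qed
  have S1: "(\<Sum>s\<in>S ` set_pmf M. of_bool (S \<omega> = s)) = (1::real)" if "\<omega> \<in> set_pmf M" for \<omega>
    using that fin by (subst sum.remove[of _ "S \<omega>"]) (auto intro!: sum.neutral)
  have pos: "(\<Sum>k\<in>?K. \<tau> k * part (G k) i) > 0" if "i \<in> ?I" for i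
  proof -
    have "(\<Sum>k\<in>?K. \<tau> k * part (G k) i) = (\<Sum>s\<in>S ` set_pmf M. part (\<lambda>\<omega>. of_bool (S \<omega> = s)) i)"
      using fin K by (simp add: sum.Plus \<tau>_def G_def)
    also have "\<dots> = (\<Sum>\<omega>\<in>{\<omega>\<in>set_pmf M. V \<omega> = i}. pmf M \<omega> * (\<Sum>s\<in>S ` set_pmf M. of_bool (S \<omega> = s)))"
      unfolding part_def sum_distrib_left by (rule sum.swap)
    also have "\<dots> = (\<Sum>\<omega>\<in>{\<omega>\<in>set_pmf M. V \<omega> = i}. pmf M \<omega>)"
      by (intro sum.cong refl) (auto simp: S1)
    also have "\<dots> > 0" using that fin by (intro sum_pos) (auto simp: pmf_positive)
    finally show ?thesis .
  qed
  obtain \<rho> where \<rho>: "\<forall>i\<in>?I. \<rho> i \<ge> 0" "card {i\<in>?I. \<rho> i \<noteq> 0} \<le> card ?K"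
     "\<forall>k\<in>?K. (\<Sum>i\<in>?I. \<rho> i * part (G k) i) = (\<Sum>i\<in>?I. 1 * part (G k) i)"
     "(\<Sum>i\<in>?I. \<rho> i * part C i) \<le> (\<Sum>i\<in>?I. 1 * part C i)"
    using sparse_weights[OF finI finK, of \<tau> "\<lambda>i k. part (G k) i" "\<lambda>_. 1" "part C"] pos by auto
  have keepG: "pexp M (\<lambda>\<omega>. \<rho> (V \<omega>) * G k \<omega>) = pexp M (G k)" if "k \<in> ?K" for k
    using \<rho>(3)[rule_format, OF that] lin[of \<rho> "G k"] lin[of "\<lambda>_. 1" "G k"] by simp
  \<comment> \<open>Normalization follows from the preserved atoms of \<open>S\<close>, which sum to
    1.\<close>
  have "pexp M (\<lambda>\<omega>. \<rho> (V \<omega>)) = pexp M (\<lambda>\<omega>. \<rho> (V \<omega>) * (\<Sum>s\<in>S ` set_pmf M. of_bool (S \<omega> = s)))"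
    by (intro pexp_cong) (simp add: S1)
  also have "\<dots> = (\<Sum>s\<in>S ` set_pmf M. pexp M (\<lambda>\<omega>. \<rho> (V \<omega>) * of_bool (S \<omega> = s)))"
    by (simp only: sum_distrib_left pexp_sum)
  also have "\<dots> = (\<Sum>s\<in>S ` set_pmf M. pexp M (\<lambda>\<omega>. of_bool (S \<omega> = s)))"
    using keepG[of "Inl _"] by (intro sum.cong refl) (auto simp: G_def)
  also have "\<dots> = pexp M (\<lambda>\<omega>. 1)"
    unfolding pexp_sum[symmetric] by (intro pexp_cong) (simp add: S1)
  finally have one: "pexp M (\<lambda>\<omega>. \<rho> (V \<omega>)) = 1" by (simp add: pexp_const[OF fin])
  obtain M' where "\<forall>\<omega>. pmf M' \<omega> = \<rho> (V \<omega>) * pmf M \<omega>"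
    using reweight_pmf_exists[OF fin _ one] \<rho>(1) by auto
  then have rw: "reweights \<rho> V M M'" by (simp add: reweights_def)
  have fin': "finite (set_pmf M')" using fin reweights_set_pmf[OF rw] finite_subset by blast
  have "pmf (map_pmf S M') s = pmf (map_pmf S M) s" for s
  proof (cases "s \<in> S ` set_pmf M")
    case True
    then have "pexp M' (\<lambda>\<omega>. of_bool (S \<omega> = s)) = pexp M (\<lambda>\<omega>. of_bool (S \<omega> = s))"
      using keepG[of "Inl s"] by (auto simp: reweights_pexp[OF fin rw] G_def)
    then show ?thesis
      using pexp_of_bool_eq[of "map_pmf S M'" s] pexp_of_bool_eq[of "map_pmf S M" s] fin fin'
      by (simp add: pexp_map)
  next
    case False
    then show ?thesis using reweights_set_pmf[OF rw] by (subst (1 2) pmf_map_outside) auto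
  qed
  then have "map_pmf S M' = map_pmf S M" by (rule pmf_eqI)
  moreover have "\<forall>k\<in>K. pexp M' (F k) = pexp M (F k)"
    using keepG[of "Inr _"] by (auto simp: reweights_pexp[OF fin rw] G_def)
  moreover have "pexp M' C \<le> pexp M C"
    using \<rho>(4) lin[of \<rho> C] lin[of "\<lambda>_. 1" C] by (simp add: reweights_pexp[OF fin rw])
  moreover have "card (V ` set_pmf M') \<le> card (S ` set_pmf M) + card K"
  proof -
    have "V ` set_pmf M' \<subseteq> {i\<in>?I. \<rho> i \<noteq> 0}"
      using rw by (auto simp: reweights_def set_pmf_iff)
    then have "card (V ` set_pmf M') \<le> card ?K"
      using \<rho>(2) card_mono[OF _ \<open>V ` set_pmf M' \<subseteq> _\<close>] finI by (simp add: order_trans)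
    then show ?thesis using fin K by (simp add: card_Plus)
  qed
  ultimately show ?thesis using rw by blast
qed

text \<open>Given \<open>S\<close>, the law of \<open>T\<close> does not depend on \<open>V\<close>.
  Changing the weights of \<open>V\<close> while keeping the law of \<open>S\<close> therefore keeps
  the law of \<open>(S,T)\<close>.\<close>

lemma reweights_markov_outer:
  assumes fin: "finite (set_pmf M)" and rw: "reweights \<rho> V M M'" and S: "map_pmf S M' = map_pmf S M"
    and mk: "markov_chain_pmf (map_pmf (V \<bowtie> S \<bowtie> T) M)"
  shows "map_pmf (S \<bowtie> T) M' = map_pmf (S \<bowtie> T) M"
    and "markov_chain_pmf (map_pmf (V \<bowtie> S \<bowtie> T) M')"
proof -
  have fin': "finite (set_pmf M')" using fin reweights_set_pmf[OF rw] finite_subset by blast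
  have eq: "pmf (map_pmf (V \<bowtie> S \<bowtie> T) M) (v,s,t) * pmf (map_pmf S M) s
    = pmf (map_pmf (V \<bowtie> S) M) (v,s) * pmf (map_pmf (S \<bowtie> T) M) (s,t)" for v s t
    using mk by (simp add: markov_chain_pmf_def map_pmf_comp)
  have r3: "pmf (map_pmf (V \<bowtie> S \<bowtie> T) M') (v,s,t) = \<rho> v * pmf (map_pmf (V \<bowtie> S \<bowtie> T) M) (v,s,t)"
    for v s t by (rule reweights_pmf_map[OF fin rw]) auto
  have r2: "pmf (map_pmf (V \<bowtie> S) M') (v,s) = \<rho> v * pmf (map_pmf (V \<bowtie> S) M) (v,s)"
    for v s by (rule reweights_pmf_map[OF fin rw]) auto
  have st: "pmf (map_pmf (S \<bowtie> T) M') (s,t) = pmf (map_pmf (S \<bowtie> T) M) (s,t)" for s t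
  proof (cases "s \<in> S ` set_pmf M'")
    case False
    then have "s \<notin> S ` set_pmf M" using S by (metis set_map_pmf)
    then show ?thesis using False by (subst (1 2) pmf_map_outside) auto
  next
    case True
    then have pos: "pmf (map_pmf S M) s > 0" using S pmf_map_pos[of _ M' S] by fastforce
    have "pmf (map_pmf (S \<bowtie> T) M') (s,t) * pmf (map_pmf S M) s
       = (\<Sum>v\<in>V ` set_pmf M'. pmf (map_pmf (V \<bowtie> S \<bowtie> T) M') (v,s,t) * pmf (map_pmf S M) s)"
      using sum_pmf_marginal[OF fin', of V "S \<bowtie> T" "(s,t)"] by (simp add: sum_distrib_right[symmetric])
    also have "\<dots> = (\<Sum>v\<in>V ` set_pmf M'. pmf (map_pmf (V \<bowtie> S) M') (v,s)) * pmf (map_pmf (S \<bowtie> T) M) (s,t)"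
      unfolding sum_distrib_right by (intro sum.cong refl) (simp add: r3 r2 mult.assoc eq)
    also have "\<dots> = pmf (map_pmf S M) s * pmf (map_pmf (S \<bowtie> T) M) (s,t)"
      by (simp add: sum_pmf_marginal[OF fin'] S)
    finally show ?thesis using pos by simp
  qed
  show "map_pmf (S \<bowtie> T) M' = map_pmf (S \<bowtie> T) M"
    by (rule pmf_eqI) (metis st surj_pair)
  show "markov_chain_pmf (map_pmf (V \<bowtie> S \<bowtie> T) M')"
    by (auto simp: markov_chain_pmf_def map_pmf_comp r3 r2 st S eq mult.assoc)
qed

text \<open>When the middle variable determines \<open>V\<close>, both sides of the Markov identity
  are scaled by the square of the same weight.\<close>

lemma reweights_markov_middle:
  assumes fin: "finite (set_pmf M)" and rw: "reweights \<rho> V M M'"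
    and det: "\<And>\<omega> \<omega>'. B \<omega> = B \<omega>' \<Longrightarrow> V \<omega> = V \<omega>'"
    and mk: "markov_chain_pmf (map_pmf (A \<bowtie> B \<bowtie> C) M)"
  shows "markov_chain_pmf (map_pmf (A \<bowtie> B \<bowtie> C) M')"
proof -
  have eq: "pmf (map_pmf (A \<bowtie> B \<bowtie> C) M) (a,b,c) * pmf (map_pmf B M) b
    = pmf (map_pmf (A \<bowtie> B) M) (a,b) * pmf (map_pmf (B \<bowtie> C) M) (b,c)" for a b c
    using mk by (simp add: markov_chain_pmf_def map_pmf_comp)
  have "pmf (map_pmf (A \<bowtie> B \<bowtie> C) M') (a,b,c) * pmf (map_pmf B M') b
    = pmf (map_pmf (A \<bowtie> B) M') (a,b) * pmf (map_pmf (B \<bowtie> C) M') (b,c)" for a b c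
  proof (cases "\<exists>\<omega>. B \<omega> = b")
    case True
    then obtain \<omega>0 where b: "b = B \<omega>0" by blast
    define v where "v = V \<omega>0"
    have d: "B \<omega> = b \<Longrightarrow> V \<omega> = v" for \<omega> using det[of \<omega> \<omega>0] unfolding b v_def .
    have "pmf (map_pmf (A \<bowtie> B \<bowtie> C) M') (a,b,c) = \<rho> v * pmf (map_pmf (A \<bowtie> B \<bowtie> C) M) (a,b,c)"
      "pmf (map_pmf B M') b = \<rho> v * pmf (map_pmf B M) b"
      "pmf (map_pmf (A \<bowtie> B) M') (a,b) = \<rho> v * pmf (map_pmf (A \<bowtie> B) M) (a,b)"
      "pmf (map_pmf (B \<bowtie> C) M') (b,c) = \<rho> v * pmf (map_pmf (B \<bowtie> C) M) (b,c)"
      by (rule reweights_pmf_map[OF fin rw]; use d in auto)+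
    then show ?thesis using eq[of a b c] by (simp add: mult_ac)
  next
    case False
    then show ?thesis by (subst (2 4) pmf_map_outside) auto
  qed
  then show ?thesis by (simp add: markov_chain_pmf_def map_pmf_comp)
qed

lemma markov_chain_pmf_swap:
  assumes "markov_chain_pmf (map_pmf (A \<bowtie> B \<bowtie> C) M)"
  shows "markov_chain_pmf (map_pmf (C \<bowtie> B \<bowtie> A) M)"
proof -
  have e1: "pmf (map_pmf (C \<bowtie> B \<bowtie> A) M) (c,b,a) = pmf (map_pmf (A \<bowtie> B \<bowtie> C) M) (a,b,c)" for a b c
    unfolding pmf_map by (rule arg_cong[of _ _ "measure_pmf.prob M"]) auto
  have e2: "pmf (map_pmf (C \<bowtie> B) M) (c,b) = pmf (map_pmf (B \<bowtie> C) M) (b,c)" for b c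
    unfolding pmf_map by (rule arg_cong[of _ _ "measure_pmf.prob M"]) auto
  have e3: "pmf (map_pmf (B \<bowtie> A) M) (b,a) = pmf (map_pmf (A \<bowtie> B) M) (a,b)" for b a
    unfolding pmf_map by (rule arg_cong[of _ _ "measure_pmf.prob M"]) auto
  show ?thesis
    using assms by (simp add: markov_chain_pmf_def map_pmf_comp e1 e2 e3 mult.commute)
qed


text \<open>The version of \<open>valid_aux\<close> for a fixed block length: arbitrary alphabets,
  and an estimator of error at most \<open>\<epsilon>\<close> where the limit will have independent
  sets.\<close>

definition auxiliary_rvs :: "'o pmf \<Rightarrow> ('o \<Rightarrow> 'x) \<Rightarrow> ('o \<Rightarrow> 'y) \<Rightarrow> ('o \<Rightarrow> 'u) \<Rightarrow> ('o \<Rightarrow> 'w)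
    \<Rightarrow> ('x \<times> 'y) pmf \<Rightarrow> ('x \<Rightarrow> 'y \<Rightarrow> 'f) \<Rightarrow> real \<Rightarrow> real \<Rightarrow> real \<Rightarrow> bool" where
  "auxiliary_rvs \<Omega> X Y U W p f R0 RY \<epsilon> \<longleftrightarrow>
     finite (set_pmf \<Omega>) \<and> map_pmf (X \<bowtie> Y) \<Omega> = p \<and>
     markov_chain_pmf (map_pmf (U \<bowtie> X \<bowtie> Y) \<Omega>) \<and>
     markov_chain_pmf (map_pmf (X \<bowtie> (U \<bowtie> Y) \<bowtie> W) \<Omega>) \<and>
     cond_mi_pmf (map_pmf (X \<bowtie> U \<bowtie> Y) \<Omega>) \<le> R0 \<and>
     cond_mi_pmf (map_pmf (Y \<bowtie> W \<bowtie> (X \<bowtie> U)) \<Omega>) \<le> RY \<and>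
     (\<exists>g. measure_pmf.prob \<Omega> {\<omega>. f (X \<omega>) (Y \<omega>) \<noteq> g (X \<omega>) (U \<omega>) (W \<omega>)} \<le> \<epsilon>)"

section \<open>Reduction of the alphabets of U and W\<close>

lemma reweights_refl: "reweights (\<lambda>_. 1) V M M"
  by (simp add: reweights_def)

text \<open>The values of \<open>U\<close> are reweighted with the law of \<open>X\<close> held
  fixed. The chain U - X - Y then preserves the source law, and the chain through
  \<open>(U,Y)\<close> survives because its middle variable contains \<open>U\<close>.\<close>

lemma auxiliary_rvs_reduce_U:
  fixes X :: "'o \<Rightarrow> 'x::finite"
  assumes aux: "auxiliary_rvs \<Omega> X Y U W p f R0 RY \<epsilon>"
  shows "\<exists>\<Omega>'. auxiliary_rvs \<Omega>' X Y U W p f R0 RY \<epsilon> \<and> card (U ` set_pmf \<Omega>') \<le> CARD('x) + 2"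
proof -
  let ?xuy = "X \<bowtie> U \<bowtie> Y" and ?uy = "U \<bowtie> Y" and ?xu = "X \<bowtie> U"
    and ?yxu = "Y \<bowtie> X \<bowtie> U" and ?wxu = "W \<bowtie> X \<bowtie> U"
    and ?ywxu = "Y \<bowtie> W \<bowtie> X \<bowtie> U"
  have fin: "finite (set_pmf \<Omega>)" and p: "map_pmf (X \<bowtie> Y) \<Omega> = p"
    and m1: "markov_chain_pmf (map_pmf (U \<bowtie> X \<bowtie> Y) \<Omega>)"
    and m2: "markov_chain_pmf (map_pmf (X \<bowtie> (U \<bowtie> Y) \<bowtie> W) \<Omega>)"
    and c1: "cond_mi_pmf (map_pmf ?xuy \<Omega>) \<le> R0" and c2: "cond_mi_pmf (map_pmf ?ywxu \<Omega>) \<le> RY"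
    using aux by (simp_all add: auxiliary_rvs_def)
  obtain g where g: "measure_pmf.prob \<Omega> {\<omega>. f (X \<omega>) (Y \<omega>) \<noteq> g (X \<omega>) (U \<omega>) (W \<omega>)} \<le> \<epsilon>"
    using aux by (auto simp: auxiliary_rvs_def)
  let ?l = "\<lambda>A \<omega>. log 2 (pmf (map_pmf A \<Omega>) (A \<omega>))"
  \<comment> \<open>The mean for \<open>True\<close> is H(U,Y) - H(X,U,Y), which fixes I(X;U|Y) as
    the source law is kept; the mean for \<open>False\<close> is I(Y;W|X,U).\<close>
  define F where "F k \<omega> = (if k then ?l ?xuy \<omega> - ?l ?uy \<omega>
      else (?l ?xu \<omega> - ?l ?yxu \<omega>) + (?l ?ywxu \<omega> - ?l ?wxu \<omega>))" for k \<omega>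
  obtain \<rho> \<Omega>' where rw: "reweights \<rho> U \<Omega> \<Omega>'" and S: "map_pmf X \<Omega>' = map_pmf X \<Omega>"
    and keep: "\<And>k. pexp \<Omega>' (F k) = pexp \<Omega> (F k)"
    and cost: "pexp \<Omega>' (\<lambda>\<omega>. of_bool (f (X \<omega>) (Y \<omega>) \<noteq> g (X \<omega>) (U \<omega>) (W \<omega>)))
       \<le> pexp \<Omega> (\<lambda>\<omega>. of_bool (f (X \<omega>) (Y \<omega>) \<noteq> g (X \<omega>) (U \<omega>) (W \<omega>)))"
    and card: "card (U ` set_pmf \<Omega>') \<le> card (X ` set_pmf \<Omega>) + card (UNIV :: bool set)"
    using sparse_reweighting[OF fin, of "UNIV :: bool set" U X F
        "\<lambda>\<omega>. of_bool (f (X \<omega>) (Y \<omega>) \<noteq> g (X \<omega>) (U \<omega>) (W \<omega>))"] by auto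
  have fin': "finite (set_pmf \<Omega>')" using fin reweights_set_pmf[OF rw] finite_subset by blast
  have p': "map_pmf (X \<bowtie> Y) \<Omega>' = map_pmf (X \<bowtie> Y) \<Omega>"
    by (rule reweights_markov_outer(1)[OF fin rw S m1])
  have Y': "map_pmf Y \<Omega>' = map_pmf Y \<Omega>" using arg_cong[OF p', of "map_pmf snd"] by (simp add: map_pmf_comp)
  have H1: "rv_entropy M ?uy - rv_entropy M ?xuy = pexp M (F True)" if "reweights r U \<Omega> M" for r M
    unfolding F_def using reweights_entropy_diff[OF fin that, of ?xuy ?uy] by simp
  have H2: "(rv_entropy M ?yxu - rv_entropy M ?xu) + (rv_entropy M ?wxu - rv_entropy M ?ywxu) = pexp M (F False)"
    if "reweights r U \<Omega> M" for r M
    unfolding F_def using reweights_entropy_diff[OF fin that, of ?xu ?yxu] reweights_entropy_diff[OF fin that, of ?ywxu ?wxu]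
    by (simp add: pexp_add)
  have "cond_mi_pmf (map_pmf ?xuy \<Omega>') = cond_mi_pmf (map_pmf ?xuy \<Omega>)"
    unfolding cond_mi_pmf_map using H1[OF rw] H1[OF reweights_refl] keep[of True] p' Y'
    by (simp add: rv_entropy_def)
  moreover have "cond_mi_pmf (map_pmf ?ywxu \<Omega>') = cond_mi_pmf (map_pmf ?ywxu \<Omega>)"
    unfolding cond_mi_pmf_map using H2[OF rw] H2[OF reweights_refl] keep[of False] by simp
  moreover have "markov_chain_pmf (map_pmf (U \<bowtie> X \<bowtie> Y) \<Omega>')"
    by (rule reweights_markov_outer(2)[OF fin rw S m1])
  moreover have "markov_chain_pmf (map_pmf (X \<bowtie> (U \<bowtie> Y) \<bowtie> W) \<Omega>')"
    by (rule reweights_markov_middle[OF fin rw _ m2]) auto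
  moreover have "measure_pmf.prob \<Omega>' {\<omega>. f (X \<omega>) (Y \<omega>) \<noteq> g (X \<omega>) (U \<omega>) (W \<omega>)} \<le> \<epsilon>"
    using cost g unfolding prob_eq_pexp[OF fin] prob_eq_pexp[OF fin'] by simp
  ultimately have "auxiliary_rvs \<Omega>' X Y U W p f R0 RY \<epsilon>"
    using fin' p p' c1 c2 by (auto simp: auxiliary_rvs_def)
  moreover have "card (X ` set_pmf \<Omega>) \<le> CARD('x)" by (intro card_mono) auto
  ultimately show ?thesis using card by (intro exI[of _ \<Omega>']) auto
qed

text \<open>Holding the law of \<open>(U,Y)\<close> fixed preserves that of \<open>(X,Y,U)\<close>
  by the chain W - (U,Y) - X. With it I(X;U|Y) is unchanged, and the only entropies that can move
  are those containing \<open>W\<close>, whose difference is one functional.\<close>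

lemma auxiliary_rvs_reduce_W:
  fixes Y :: "'o \<Rightarrow> 'y::finite"
  assumes aux: "auxiliary_rvs \<Omega> X Y U W p f R0 RY \<epsilon>"
  shows "\<exists>\<Omega>'. auxiliary_rvs \<Omega>' X Y U W p f R0 RY \<epsilon> \<and> U ` set_pmf \<Omega>' \<subseteq> U ` set_pmf \<Omega>
     \<and> card (W ` set_pmf \<Omega>') \<le> card (U ` set_pmf \<Omega>) * CARD('y) + 1"
proof -
  let ?xuy = "X \<bowtie> U \<bowtie> Y" and ?uy = "U \<bowtie> Y" and ?xu = "X \<bowtie> U"
    and ?yxu = "Y \<bowtie> X \<bowtie> U" and ?wxu = "W \<bowtie> X \<bowtie> U"
    and ?ywxu = "Y \<bowtie> W \<bowtie> X \<bowtie> U"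
  have fin: "finite (set_pmf \<Omega>)" and p: "map_pmf (X \<bowtie> Y) \<Omega> = p"
    and m1: "markov_chain_pmf (map_pmf (U \<bowtie> X \<bowtie> Y) \<Omega>)"
    and m2: "markov_chain_pmf (map_pmf (X \<bowtie> (U \<bowtie> Y) \<bowtie> W) \<Omega>)"
    and c1: "cond_mi_pmf (map_pmf ?xuy \<Omega>) \<le> R0" and c2: "cond_mi_pmf (map_pmf ?ywxu \<Omega>) \<le> RY"
    using aux by (simp_all add: auxiliary_rvs_def)
  obtain g where g: "measure_pmf.prob \<Omega> {\<omega>. f (X \<omega>) (Y \<omega>) \<noteq> g (X \<omega>) (U \<omega>) (W \<omega>)} \<le> \<epsilon>"
    using aux by (auto simp: auxiliary_rvs_def)
  let ?l = "\<lambda>A \<omega>. log 2 (pmf (map_pmf A \<Omega>) (A \<omega>))"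
  define F where "F \<omega> = ?l ?ywxu \<omega> - ?l ?wxu \<omega>" for \<omega>
  obtain \<rho> \<Omega>' where rw: "reweights \<rho> W \<Omega> \<Omega>'" and S: "map_pmf ?uy \<Omega>' = map_pmf ?uy \<Omega>"
    and keep: "pexp \<Omega>' F = pexp \<Omega> F"
    and cost: "pexp \<Omega>' (\<lambda>\<omega>. of_bool (f (X \<omega>) (Y \<omega>) \<noteq> g (X \<omega>) (U \<omega>) (W \<omega>)))
       \<le> pexp \<Omega> (\<lambda>\<omega>. of_bool (f (X \<omega>) (Y \<omega>) \<noteq> g (X \<omega>) (U \<omega>) (W \<omega>)))"
    and card: "card (W ` set_pmf \<Omega>') \<le> card (?uy ` set_pmf \<Omega>) + card (UNIV :: unit set)"
    using sparse_reweighting[OF fin, of "UNIV :: unit set" W ?uy "\<lambda>_. F"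
        "\<lambda>\<omega>. of_bool (f (X \<omega>) (Y \<omega>) \<noteq> g (X \<omega>) (U \<omega>) (W \<omega>))"] by auto
  have fin': "finite (set_pmf \<Omega>')" using fin reweights_set_pmf[OF rw] finite_subset by blast
  have m2': "markov_chain_pmf (map_pmf (W \<bowtie> (U \<bowtie> Y) \<bowtie> X) \<Omega>)"
    by (rule markov_chain_pmf_swap[OF m2])
  note outer = reweights_markov_outer[OF fin rw S m2']
  have same: "map_pmf (\<lambda>\<omega>. h (X \<omega>) (Y \<omega>) (U \<omega>)) \<Omega>' = map_pmf (\<lambda>\<omega>. h (X \<omega>) (Y \<omega>) (U \<omega>)) \<Omega>" for h :: "_ \<Rightarrow> _ \<Rightarrow> _ \<Rightarrow> 'h"
    using arg_cong[OF outer(1), of "map_pmf (\<lambda>((u,y),x). h x y u)"] by (simp add: map_pmf_comp)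
  have H: "rv_entropy M ?wxu - rv_entropy M ?ywxu = pexp M F" if "reweights r W \<Omega> M" for r M
    unfolding F_def using reweights_entropy_diff[OF fin that, of ?ywxu ?wxu] by simp
  have "map_pmf (X \<bowtie> Y) \<Omega>' = p" using same[of "\<lambda>x y u. (x,y)"] p by simp
  moreover have "map_pmf ?xuy \<Omega>' = map_pmf ?xuy \<Omega>" using same[of "\<lambda>x y u. (x,u,y)"] by simp
  moreover have "map_pmf (U \<bowtie> X \<bowtie> Y) \<Omega>' = map_pmf (U \<bowtie> X \<bowtie> Y) \<Omega>"
    using same[of "\<lambda>x y u. (u,x,y)"] by simp
  moreover have "cond_mi_pmf (map_pmf ?ywxu \<Omega>') = cond_mi_pmf (map_pmf ?ywxu \<Omega>)"
    unfolding cond_mi_pmf_map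
    using H[OF rw] H[OF reweights_refl] keep same[of "\<lambda>x y u. (y,x,u)"] same[of "\<lambda>x y u. (x,u)"]
    by (simp add: rv_entropy_def)
  moreover have "markov_chain_pmf (map_pmf (X \<bowtie> (U \<bowtie> Y) \<bowtie> W) \<Omega>')"
    by (rule markov_chain_pmf_swap[OF outer(2)])
  moreover have "measure_pmf.prob \<Omega>' {\<omega>. f (X \<omega>) (Y \<omega>) \<noteq> g (X \<omega>) (U \<omega>) (W \<omega>)} \<le> \<epsilon>"
    using cost g unfolding prob_eq_pexp[OF fin] prob_eq_pexp[OF fin'] by simp
  ultimately have "auxiliary_rvs \<Omega>' X Y U W p f R0 RY \<epsilon>"
    using fin' m1 c1 c2 unfolding auxiliary_rvs_def by auto
  moreover have "card (?uy ` set_pmf \<Omega>) \<le> card (U ` set_pmf \<Omega>) * CARD('y)"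
  proof -
    have "card (?uy ` set_pmf \<Omega>) \<le> card (U ` set_pmf \<Omega> \<times> (UNIV :: 'y set))"
      using fin by (intro card_mono) auto
    then show ?thesis by (simp add: card_cartesian_product)
  qed
  ultimately show ?thesis using card reweights_set_pmf[OF rw] by (intro exI[of _ \<Omega>']) auto
qed

text \<open>On the support, the Markov condition depends only on the partitions induced by the three
  variables.\<close>

lemma markov_chain_pmf_relabel:
  assumes mk: "markov_chain_pmf (map_pmf (A \<bowtie> B \<bowtie> C) M)"
    and A: "\<And>\<omega> \<omega>'. \<omega> \<in> set_pmf M \<Longrightarrow> \<omega>' \<in> set_pmf M \<Longrightarrow> A \<omega> = A \<omega>' \<longleftrightarrow> A' \<omega> = A' \<omega>'"
    and B: "\<And>\<omega> \<omega>'. \<omega> \<in> set_pmf M \<Longrightarrow> \<omega>' \<in> set_pmf M \<Longrightarrow> B \<omega> = B \<omega>' \<longleftrightarrow> B' \<omega> = B' \<omega>'"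
    and C: "\<And>\<omega> \<omega>'. \<omega> \<in> set_pmf M \<Longrightarrow> \<omega>' \<in> set_pmf M \<Longrightarrow> C \<omega> = C \<omega>' \<longleftrightarrow> C' \<omega> = C' \<omega>'"
  shows "markov_chain_pmf (map_pmf (A' \<bowtie> B' \<bowtie> C') M)"
proof -
  have eq: "pmf (map_pmf (A \<bowtie> B \<bowtie> C) M) (a,b,c) * pmf (map_pmf B M) b
    = pmf (map_pmf (A \<bowtie> B) M) (a,b) * pmf (map_pmf (B \<bowtie> C) M) (b,c)" for a b c
    using mk by (simp add: markov_chain_pmf_def map_pmf_comp)
  have transfer: "pmf (map_pmf Z M) z = pmf (map_pmf Z' M) z'"
    if "\<And>\<omega>. \<omega> \<in> set_pmf M \<Longrightarrow> Z \<omega> = z \<longleftrightarrow> Z' \<omega> = z'" for Z :: "_ \<Rightarrow> 'z" and z and Z' :: "_ \<Rightarrow> 'z2" and z'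
    unfolding pmf_map using that
    by (intro antisym measure_pmf.finite_measure_mono_AE) (auto simp: AE_measure_pmf_iff)
  have "pmf (map_pmf (A' \<bowtie> B' \<bowtie> C') M) (a,b,c) * pmf (map_pmf B' M) b
    = pmf (map_pmf (A' \<bowtie> B') M) (a,b) * pmf (map_pmf (B' \<bowtie> C') M) (b,c)" for a b c
  proof (cases "a \<in> A' ` set_pmf M \<and> b \<in> B' ` set_pmf M \<and> c \<in> C' ` set_pmf M")
    case True
    then obtain \<omega>1 \<omega>2 \<omega>3 where w: "\<omega>1 \<in> set_pmf M" "\<omega>2 \<in> set_pmf M" "\<omega>3 \<in> set_pmf M"
      and abc: "a = A' \<omega>1" "b = B' \<omega>2" "c = C' \<omega>3" by auto
    have "pmf (map_pmf (A' \<bowtie> B' \<bowtie> C') M) (a,b,c) = pmf (map_pmf (A \<bowtie> B \<bowtie> C) M) (A \<omega>1, B \<omega>2, C \<omega>3)"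
      "pmf (map_pmf (A' \<bowtie> B') M) (a,b) = pmf (map_pmf (A \<bowtie> B) M) (A \<omega>1, B \<omega>2)"
      "pmf (map_pmf (B' \<bowtie> C') M) (b,c) = pmf (map_pmf (B \<bowtie> C) M) (B \<omega>2, C \<omega>3)"
      "pmf (map_pmf B' M) b = pmf (map_pmf B M) (B \<omega>2)"
      unfolding abc by (rule transfer; simp add: A[OF _ w(1)] B[OF _ w(2)] C[OF _ w(3)])+
    then show ?thesis by (simp add: eq)
  next
    case False
    then have "(a,b,c) \<notin> (A' \<bowtie> B' \<bowtie> C') ` set_pmf M"
      and "(a,b) \<notin> (A' \<bowtie> B') ` set_pmf M \<or> (b,c) \<notin> (B' \<bowtie> C') ` set_pmf M" by auto
    then show ?thesis by (auto simp: pmf_map_outside)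
  qed
  then show ?thesis by (simp add: markov_chain_pmf_def map_pmf_comp)
qed

lemma auxiliary_rvs_relabel:
  assumes aux: "auxiliary_rvs \<Omega> X Y U W p f R0 RY \<epsilon>"
    and hu: "inj_on hu (U ` set_pmf \<Omega>)" and hw: "inj_on hw (W ` set_pmf \<Omega>)"
  shows "auxiliary_rvs \<Omega> X Y (\<lambda>\<omega>. hu (U \<omega>)) (\<lambda>\<omega>. hw (W \<omega>)) p f R0 RY \<epsilon>"
proof -
  have fin: "finite (set_pmf \<Omega>)"
    and m1: "markov_chain_pmf (map_pmf (U \<bowtie> X \<bowtie> Y) \<Omega>)"
    and m2: "markov_chain_pmf (map_pmf (X \<bowtie> (U \<bowtie> Y) \<bowtie> W) \<Omega>)"
    using aux by (simp_all add: auxiliary_rvs_def)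
  obtain g where g: "measure_pmf.prob \<Omega> {\<omega>. f (X \<omega>) (Y \<omega>) \<noteq> g (X \<omega>) (U \<omega>) (W \<omega>)} \<le> \<epsilon>"
    using aux by (auto simp: auxiliary_rvs_def)
  have u: "hu (U \<omega>) = hu (U \<omega>') \<longleftrightarrow> U \<omega> = U \<omega>'" and w: "hw (W \<omega>) = hw (W \<omega>') \<longleftrightarrow> W \<omega> = W \<omega>'"
    if "\<omega> \<in> set_pmf \<Omega>" "\<omega>' \<in> set_pmf \<Omega>" for \<omega> \<omega>'
    using that hu hw by (auto simp: inj_on_eq_iff)
  have "cond_mi_pmf (map_pmf (\<lambda>\<omega>. (X \<omega>, hu (U \<omega>), Y \<omega>)) \<Omega>) = cond_mi_pmf (map_pmf (X \<bowtie> U \<bowtie> Y) \<Omega>)"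
    unfolding cond_mi_pmf_map by (intro arg_cong2[of _ _ _ _ "(+)"] arg_cong2[of _ _ _ _ "(-)"] rv_entropy_cong[OF fin]) (auto simp: u)
  moreover have "cond_mi_pmf (map_pmf (\<lambda>\<omega>. (Y \<omega>, hw (W \<omega>), (X \<omega>, hu (U \<omega>)))) \<Omega>)
      = cond_mi_pmf (map_pmf (Y \<bowtie> W \<bowtie> (X \<bowtie> U)) \<Omega>)"
    unfolding cond_mi_pmf_map by (intro arg_cong2[of _ _ _ _ "(+)"] arg_cong2[of _ _ _ _ "(-)"] rv_entropy_cong[OF fin]) (auto simp: u w)
  moreover have "markov_chain_pmf (map_pmf (\<lambda>\<omega>. (hu (U \<omega>), X \<omega>, Y \<omega>)) \<Omega>)"
    by (rule markov_chain_pmf_relabel[OF m1]) (auto simp: u)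
  moreover have "markov_chain_pmf (map_pmf (\<lambda>\<omega>. (X \<omega>, (hu (U \<omega>), Y \<omega>), hw (W \<omega>))) \<Omega>)"
    by (rule markov_chain_pmf_relabel[OF m2]) (auto simp: u w)
  moreover have "\<exists>g. measure_pmf.prob \<Omega> {\<omega>. f (X \<omega>) (Y \<omega>) \<noteq> g (X \<omega>) (hu (U \<omega>)) (hw (W \<omega>))} \<le> \<epsilon>"
  proof (rule exI[of _ "\<lambda>x u w. g x (inv_into (U ` set_pmf \<Omega>) hu u) (inv_into (W ` set_pmf \<Omega>) hw w)"],
      rule order_trans[OF prob_mono_support g])
    fix \<omega> assume "\<omega> \<in> set_pmf \<Omega>"
      "f (X \<omega>) (Y \<omega>) \<noteq> g (X \<omega>) (inv_into (U ` set_pmf \<Omega>) hu (hu (U \<omega>))) (inv_into (W ` set_pmf \<Omega>) hw (hw (W \<omega>)))"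
    then show "f (X \<omega>) (Y \<omega>) \<noteq> g (X \<omega>) (U \<omega>) (W \<omega>)" using hu hw by (simp add: inv_into_f_f)
  qed
  ultimately show ?thesis using aux by (simp add: auxiliary_rvs_def)
qed

lemma ex_inj_on_lessThan:
  assumes "finite A" "card A \<le> k"
  shows "\<exists>h :: 'a \<Rightarrow> nat. inj_on h A \<and> h ` A \<subseteq> {..<k}"
proof -
  obtain h where "bij_betw h A {0..<card A}" using ex_bij_betw_finite_nat[OF assms(1)] by blast
  then show ?thesis using assms(2) by (intro exI[of _ h]) (auto simp: bij_betw_def)
qed

text \<open>\<open>U\<close> is reduced first, since the bound for \<open>W\<close> involves the
  number of values of \<open>U\<close>; reducing \<open>W\<close> afterwards adds no value of
  \<open>U\<close>.\<close>

lemma auxiliary_alphabet_bounds: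
  fixes X :: "'o \<Rightarrow> 'x::finite" and Y :: "'o \<Rightarrow> 'y::finite"
  assumes aux: "auxiliary_rvs \<Omega> X Y U W p f R0 RY \<epsilon>"
  shows "\<exists>q :: ('x \<times> 'y \<times> nat \<times> nat) pmf.
     set_pmf q \<subseteq> UNIV \<times> UNIV \<times> {..<CARD('x) + 2} \<times> {..<(CARD('x) + 2) * CARD('y) + 1} \<and>
     auxiliary_rvs q (\<lambda>(x,y,u,w). x) (\<lambda>(x,y,u,w). y) (\<lambda>(x,y,u,w). u) (\<lambda>(x,y,u,w). w) p f R0 RY \<epsilon>"
proof -
  let ?ku = "CARD('x) + 2" and ?kw = "(CARD('x) + 2) * CARD('y) + 1"
  obtain \<Omega>1 where 1: "auxiliary_rvs \<Omega>1 X Y U W p f R0 RY \<epsilon>" "card (U ` set_pmf \<Omega>1) \<le> ?ku"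
    using auxiliary_rvs_reduce_U[OF aux] by blast
  obtain \<Omega>2 where 2: "auxiliary_rvs \<Omega>2 X Y U W p f R0 RY \<epsilon>" "U ` set_pmf \<Omega>2 \<subseteq> U ` set_pmf \<Omega>1"
    "card (W ` set_pmf \<Omega>2) \<le> card (U ` set_pmf \<Omega>1) * CARD('y) + 1"
    using auxiliary_rvs_reduce_W[OF 1(1)] by blast
  have fin: "finite (set_pmf \<Omega>1)" "finite (set_pmf \<Omega>2)" using 1(1) 2(1) by (auto simp: auxiliary_rvs_def)
  have "card (U ` set_pmf \<Omega>2) \<le> ?ku" using 1(2) card_mono[OF _ 2(2)] fin by simp
  then obtain hu :: "_ \<Rightarrow> nat" where hu: "inj_on hu (U ` set_pmf \<Omega>2)" "hu ` U ` set_pmf \<Omega>2 \<subseteq> {..<?ku}"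
    using ex_inj_on_lessThan[of "U ` set_pmf \<Omega>2" ?ku] fin by auto
  have "card (W ` set_pmf \<Omega>2) \<le> ?kw" using 2(3) mult_le_mono1[OF 1(2), of "CARD('y)"] by linarith
  then obtain hw :: "_ \<Rightarrow> nat" where hw: "inj_on hw (W ` set_pmf \<Omega>2)" "hw ` W ` set_pmf \<Omega>2 \<subseteq> {..<?kw}"
    using ex_inj_on_lessThan[of "W ` set_pmf \<Omega>2" ?kw] fin by auto
  define q where "q = map_pmf (\<lambda>\<omega>. (X \<omega>, Y \<omega>, hu (U \<omega>), hw (W \<omega>))) \<Omega>2"
  have "auxiliary_rvs q (\<lambda>(x,y,u,w). x) (\<lambda>(x,y,u,w). y) (\<lambda>(x,y,u,w). u) (\<lambda>(x,y,u,w). w) p f R0 RY \<epsilon>"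
    using auxiliary_rvs_relabel[OF 2(1) hu(1) hw(1)]
    unfolding auxiliary_rvs_def q_def by (simp add: map_pmf_comp vimage_def)
  moreover have "set_pmf q \<subseteq> UNIV \<times> UNIV \<times> {..<?ku} \<times> {..<?kw}"
    using hu(2) hw(2) by (auto simp: q_def)
  ultimately show ?thesis by blast
qed

lemma auxiliary_rvs_projections:
  "auxiliary_rvs q (\<lambda>(x,y,u,w). x) (\<lambda>(x,y,u,w). y) (\<lambda>(x,y,u,w). u) (\<lambda>(x,y,u,w). w) p f R0 RY \<epsilon> \<longleftrightarrow>
    finite (set_pmf q) \<and> map_pmf (\<lambda>(x,y,u,w). (x,y)) q = p \<and>
    markov_chain_pmf (map_pmf (\<lambda>(x,y,u,w). (u,x,y)) q) \<and>
    markov_chain_pmf (map_pmf (\<lambda>(x,y,u,w). (x,(u,y),w)) q) \<and>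
    cond_mi_pmf (map_pmf (\<lambda>(x,y,u,w). (x,u,y)) q) \<le> R0 \<and>
    cond_mi_pmf (map_pmf (\<lambda>(x,y,u,w). (y,w,(x,u))) q) \<le> RY \<and>
    (\<exists>g. measure_pmf.prob q {(x,y,u,w). f x y \<noteq> g x u w} \<le> \<epsilon>)"
  unfolding auxiliary_rvs_def by (simp add: case_prod_unfold)

section \<open>Limits of distributions on a finite set\<close>

lemma finite_coordinates_subsequence:
  fixes F :: "nat \<Rightarrow> 'a \<Rightarrow> real"
  assumes "finite S" and "\<And>k a. F k a \<in> {0..1}"
  shows "\<exists>r l. strict_mono r \<and> (\<forall>a\<in>S. (\<lambda>k. F (r k) a) \<longlonglongrightarrow> l a)"
  using assms(1)
proof induction
  case empty
  show ?case by (intro exI[of _ id]) (auto simp: strict_mono_def)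
next
  case (insert b S)
  then obtain r l where r: "strict_mono r" "\<forall>a\<in>S. (\<lambda>k. F (r k) a) \<longlonglongrightarrow> l a" by blast
  have "seq_compact {0..1::real}" by (intro compact_imp_seq_compact compact_Icc)
  moreover have "\<forall>k. F (r k) b \<in> {0..1}" using assms(2) by blast
  ultimately obtain c r' where "c \<in> {0..1::real}" and r': "strict_mono r'" "((\<lambda>k. F (r k) b) \<circ> r') \<longlonglongrightarrow> c"
    by (rule seq_compactE)
  have "(\<lambda>k. F ((r \<circ> r') k) a) \<longlonglongrightarrow> (l(b := c)) a" if "a \<in> insert b S" for a
  proof (cases "a = b")
    case True
    then show ?thesis using r'(2) by (simp add: o_def)
  next
    case False
    then have "(\<lambda>k. F (r k) a) \<longlonglongrightarrow> l a" using that r(2) by auto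
    from LIMSEQ_subseq_LIMSEQ[OF this r'(1)] show ?thesis using False by (simp add: o_def)
  qed
  moreover have "strict_mono (r \<circ> r')" using r(1) r'(1) by (rule strict_mono_o)
  ultimately show ?case by blast
qed

text \<open>One finite set carries all supports, so pointwise convergence loses no mass and passes
  to all marginals.\<close>

definition pmf_limit :: "'a set \<Rightarrow> (nat \<Rightarrow> 'a pmf) \<Rightarrow> 'a pmf \<Rightarrow> bool" where
  "pmf_limit S Q q \<longleftrightarrow> finite S \<and> (\<forall>k. set_pmf (Q k) \<subseteq> S) \<and> set_pmf q \<subseteq> S \<and>
     (\<forall>a. (\<lambda>k. pmf (Q k) a) \<longlonglongrightarrow> pmf q a)"

lemma pmf_limitD: "pmf_limit S Q q \<Longrightarrow> (\<lambda>k. pmf (Q k) a) \<longlonglongrightarrow> pmf q a"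
  unfolding pmf_limit_def by blast

lemma pmf_limit_subsequence:
  fixes Q :: "nat \<Rightarrow> 'a pmf"
  assumes fin: "finite S" and Q: "\<And>k. set_pmf (Q k) \<subseteq> S"
  shows "\<exists>(r :: nat \<Rightarrow> nat) q. strict_mono r \<and> pmf_limit S (\<lambda>k. Q (r k)) q"
proof -
  obtain r l where r: "strict_mono (r :: nat \<Rightarrow> nat)" "\<forall>a\<in>S. (\<lambda>k. pmf (Q (r k)) a) \<longlonglongrightarrow> l a"
    using finite_coordinates_subsequence[OF fin, of "\<lambda>k. pmf (Q k)"] by (auto simp: pmf_le_1)
  define m where "m a = (if a \<in> S then l a else 0)" for a
  have lim: "(\<lambda>k. pmf (Q (r k)) a) \<longlonglongrightarrow> m a" for a
  proof (cases "a \<in> S")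
    case False
    then have "pmf (Q (r k)) a = 0" for k using Q[of "r k"] by (auto simp: set_pmf_iff)
    then show ?thesis using False by (simp add: m_def)
  qed (use r in \<open>auto simp: m_def\<close>)
  have nn: "m a \<ge> 0" for a by (rule LIMSEQ_le_const[OF lim]) auto
  have "(\<lambda>k. \<Sum>a\<in>S. pmf (Q (r k)) a) \<longlonglongrightarrow> (\<Sum>a\<in>S. m a)" by (intro tendsto_sum lim)
  moreover have "(\<Sum>a\<in>S. pmf (Q (r k)) a) = 1" for k by (rule sum_pmf_eq_1[OF fin Q])
  ultimately have one: "(\<Sum>a\<in>S. m a) = 1" by (simp add: LIMSEQ_const_iff)
  have "(\<integral>\<^sup>+a. ennreal (m a) \<partial>count_space UNIV) = (\<Sum>a\<in>S. ennreal (m a))"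
    using fin by (intro nn_integral_count_space') (auto simp: m_def)
  also have "\<dots> = 1" using nn one by (simp add: sum_ennreal)
  finally have pm: "pmf (embed_pmf m) a = m a" for a using nn by (simp add: pmf_embed_pmf)
  have "set_pmf (embed_pmf m) \<subseteq> S" by (auto simp: set_pmf_iff pm m_def split: if_splits)
  then show ?thesis using r(1) fin Q lim
    by (intro exI[of _ r] exI[of _ "embed_pmf m"]) (auto simp: pmf_limit_def pm)
qed

lemma pmf_limit_map:
  assumes "pmf_limit S Q q"
  shows "pmf_limit (h ` S) (\<lambda>k. map_pmf h (Q k)) (map_pmf h q)"
proof -
  have fin: "finite S" and sub: "\<And>k. set_pmf (Q k) \<subseteq> S" "set_pmf q \<subseteq> S"
    and lim: "\<And>a. (\<lambda>k. pmf (Q k) a) \<longlonglongrightarrow> pmf q a" using assms by (auto simp: pmf_limit_def)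
  have eq: "pmf (map_pmf h M) b = (\<Sum>a\<in>{a\<in>S. h a = b}. pmf M a)" if "set_pmf M \<subseteq> S" for M b
    unfolding pmf_map_sum[OF finite_subset[OF that fin]] using that fin
    by (intro sum.mono_neutral_left) (auto simp: set_pmf_iff)
  have "(\<lambda>k. pmf (map_pmf h (Q k)) b) \<longlonglongrightarrow> pmf (map_pmf h q) b" for b
    unfolding eq[OF sub(1)] eq[OF sub(2)] by (intro tendsto_sum lim)
  then show ?thesis using fin sub by (auto simp: pmf_limit_def)
qed

text \<open>Gives continuity of \<open>t * ln t\<close> at 0, where atoms may disappear in the
  limit. The bound is the linear estimate of the logarithm applied to
  \<open>1 / sqrt t\<close>.\<close>

lemma abs_mult_ln_le:
  fixes t :: real
  assumes "0 \<le> t" "t \<le> 1"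
  shows "\<bar>t * ln t\<bar> \<le> 2 * sqrt t"
proof (cases "t = 0")
  case False
  then have t: "t > 0" using assms by simp
  have "- ln t = 2 * ln (1 / sqrt t)" using t by (simp add: ln_div ln_sqrt)
  also have "\<dots> \<le> 2 * (1 / sqrt t)" using ln_bound[of "1 / sqrt t"] t by simp
  finally have "t * (- ln t) \<le> t * (2 * (1 / sqrt t))" using t by (intro mult_left_mono) auto
  also have "\<dots> = 2 * (t / sqrt t)" by simp
  also have "\<dots> = 2 * sqrt t" using t by (simp only: real_div_sqrt less_imp_le)
  finally show ?thesis using t assms by (simp add: abs_mult mult_nonneg_nonpos)
qed simp

lemma tendsto_mult_log:
  fixes X :: "nat \<Rightarrow> real"
  assumes lim: "X \<longlonglongrightarrow> x" and X: "\<And>k. 0 \<le> X k" "\<And>k. X k \<le> 1"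
  shows "(\<lambda>k. X k * log 2 (X k)) \<longlonglongrightarrow> x * log 2 x"
proof (cases "x = 0")
  case False
  then show ?thesis using lim by (intro tendsto_intros) auto
next
  case True
  have "(\<lambda>k. X k * ln (X k)) \<longlonglongrightarrow> 0"
  proof (rule Lim_null_comparison)
    show "\<forall>\<^sub>F k in sequentially. norm (X k * ln (X k)) \<le> 2 * sqrt (X k)"
      using abs_mult_ln_le X by simp
    show "(\<lambda>k. 2 * sqrt (X k)) \<longlonglongrightarrow> 0"
      using tendsto_mult[OF tendsto_const[of 2] tendsto_real_sqrt[OF lim]] True by simp
  qed
  then have "(\<lambda>k. X k * ln (X k) / ln 2) \<longlonglongrightarrow> 0 / ln 2" by (intro tendsto_divide) auto
  then show ?thesis using True by (simp add: log_def)
qed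

lemma pmf_limit_entropy:
  assumes "pmf_limit S Q q"
  shows "(\<lambda>k. entropy_pmf (Q k)) \<longlonglongrightarrow> entropy_pmf q"
proof -
  have fin: "finite S" and sub: "\<And>k. set_pmf (Q k) \<subseteq> S" "set_pmf q \<subseteq> S"
    and lim: "\<And>a. (\<lambda>k. pmf (Q k) a) \<longlonglongrightarrow> pmf q a" using assms by (auto simp: pmf_limit_def)
  have eq: "entropy_pmf M = - (\<Sum>a\<in>S. pmf M a * log 2 (pmf M a))" if "set_pmf M \<subseteq> S" for M
    unfolding entropy_pmf_def using that fin
    by (intro arg_cong[of _ _ uminus] sum.mono_neutral_left) (auto simp: set_pmf_iff)
  show ?thesis
    unfolding eq[OF sub(1)] eq[OF sub(2)]
    by (intro tendsto_minus tendsto_sum tendsto_mult_log lim) (auto simp: pmf_le_1)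
qed

lemma pmf_limit_cond_mi:
  assumes "pmf_limit S Q q"
  shows "(\<lambda>k. cond_mi_pmf (Q k)) \<longlonglongrightarrow> cond_mi_pmf q"
  unfolding cond_mi_pmf_def
  by (intro tendsto_intros pmf_limit_entropy[OF pmf_limit_map[OF assms]] pmf_limit_entropy[OF assms])

text \<open>In product form the Markov condition is a polynomial identity in the atoms, hence closed
  under limits.\<close>

lemma pmf_limit_markov_chain:
  assumes "pmf_limit S Q q" and "\<And>k. markov_chain_pmf (Q k)"
  shows "markov_chain_pmf q"
  unfolding markov_chain_pmf_def
proof (intro allI)
  fix a b c
  have lim: "(\<lambda>k. pmf (Q k) (a,b,c)) \<longlonglongrightarrow> pmf q (a,b,c)" by (rule pmf_limitD[OF assms(1)])
  have lima: "(\<lambda>k. pmf (map_pmf (\<lambda>(a,b,c). (a,b)) (Q k)) (a,b)) \<longlonglongrightarrow> pmf (map_pmf (\<lambda>(a,b,c). (a,b)) q) (a,b)"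
    and limb: "(\<lambda>k. pmf (map_pmf (\<lambda>(a,b,c). b) (Q k)) b) \<longlonglongrightarrow> pmf (map_pmf (\<lambda>(a,b,c). b) q) b"
    and limc: "(\<lambda>k. pmf (map_pmf (\<lambda>(a,b,c). (b,c)) (Q k)) (b,c)) \<longlonglongrightarrow> pmf (map_pmf (\<lambda>(a,b,c). (b,c)) q) (b,c)"
    by (rule pmf_limitD[OF pmf_limit_map[OF assms(1)]])+
  have eq: "pmf (Q k) (a,b,c) * pmf (map_pmf (\<lambda>(a,b,c). b) (Q k)) b
      = pmf (map_pmf (\<lambda>(a,b,c). (a,b)) (Q k)) (a,b) * pmf (map_pmf (\<lambda>(a,b,c). (b,c)) (Q k)) (b,c)" for k
    using assms(2)[of k] unfolding markov_chain_pmf_def by blast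
  show "pmf q (a,b,c) * pmf (map_pmf (\<lambda>(a,b,c). b) q) b
     = pmf (map_pmf (\<lambda>(a,b,c). (a,b)) q) (a,b) * pmf (map_pmf (\<lambda>(a,b,c). (b,c)) q) (b,c)"
    using tendsto_mult[OF lim limb] tendsto_mult[OF lima limc]
    unfolding eq by (rule LIMSEQ_unique)
qed

section \<open>The rate region\<close>

text \<open>If two letters \<open>y1\<close>, \<open>y2\<close> occurred with the same
  \<open>(x,u,w)\<close> but different values of \<open>f\<close>, then \<open>(u,y1)\<close> and
  \<open>(u,y2)\<close> would be adjacent through \<open>k = (x,u)\<close> although both lie in the
  independent set \<open>\<sigma> w\<close>.\<close>

lemma valid_aux_decoder:
  fixes p :: "('x \<times> 'y) pmf" and f :: "'x \<Rightarrow> 'y \<Rightarrow> 'f"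
  assumes va: "valid_aux p f ku kw q \<sigma>"
  shows "\<exists>g. \<forall>(x,y,u,w)\<in>set_pmf q. f x y = g x u w"
proof -
  have same: "f x y1 = f x y2" if 1: "(x,y1,u,w) \<in> set_pmf q" and 2: "(x,y2,u,w) \<in> set_pmf q" for x y1 y2 u w
  proof (rule ccontr)
    assume ne: "f x y1 \<noteq> f x y2"
    let ?M = "map_pmf (\<lambda>(x,y,u,w). ((u,y),(x,u),(x,y))) q"
    have "((u,y1),(x,u),(x,y1)) \<in> set_pmf ?M" "((u,y2),(x,u),(x,y2)) \<in> set_pmf ?M"
      using 1 2 by (force simp: set_map_pmf)+
    then have "pmf ?M ((u,y1),(x,u),(x,y1)) * pmf ?M ((u,y2),(x,u),(x,y2)) > 0"
      by (simp add: pmf_positive)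
    then have "char_graph_adj ?M (\<lambda>(x,y). f x y) (u,y1) (u,y2)"
      unfolding char_graph_adj_def using ne by fastforce
    moreover have "(u,y1) \<in> \<sigma> w" "(u,y2) \<in> \<sigma> w" "w < kw" using va 1 2 by (auto simp: valid_aux_def)
    ultimately show False using va by (auto simp: valid_aux_def independent_set_def)
  qed
  define g where "g x u w = f x (SOME y. (x,y,u,w) \<in> set_pmf q)" for x u w
  have "f x y = g x u w" if "(x,y,u,w) \<in> set_pmf q" for x y u w
    unfolding g_def by (rule same[OF that], rule someI[of _ y], rule that)
  then show ?thesis by (intro exI[of _ g]) auto
qed

lemma region_char_subset_rate_region:
  fixes p :: "('x::finite \<times> 'y::finite) pmf" and f :: "'x \<Rightarrow> 'y \<Rightarrow> 'f"
  shows "region_char p f bu bw \<subseteq> {r \<in> rate_region p f. fst (snd r) > entropy_pmf (map_pmf fst p)}"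
proof
  fix r assume "r \<in> region_char p f bu bw"
  then obtain R0 RX RY ku kw q \<sigma> where r: "r = (R0, RX, RY)" and RX: "RX > entropy_pmf (map_pmf fst p)"
    and va: "valid_aux p f ku kw q \<sigma>"
    and R0: "R0 \<ge> cond_mi_pmf (map_pmf (\<lambda>(x,y,u,w). (x,u,y)) q)"
    and RY: "RY \<ge> cond_mi_pmf (map_pmf (\<lambda>(x,y,u,w). (y,w,(x,u))) q)"
    by (auto simp: region_char_def)
  obtain g where g: "\<And>x y u w. (x,y,u,w) \<in> set_pmf q \<Longrightarrow> f x y = g x u w"
    using valid_aux_decoder[OF va] by blast
  have "set_pmf q \<subseteq> UNIV \<times> UNIV \<times> {..<ku} \<times> {..<kw}" using va by (auto simp: valid_aux_def)
  then have fin: "finite (set_pmf q)" by (rule finite_subset) auto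
  \<comment> \<open>A margin \<open>d\<close> makes both rate inequalities strict; letting it tend
    to 0 stays within the closure.\<close>
  have ach: "achievable p f (R0 + d, RX, RY + d)" if "d > 0" for d
    using va R0 RY that by (intro achievable_of_auxiliary[OF fin _ _ _ g RX]) (auto simp: valid_aux_def)
  have "(\<lambda>k. (R0 + 1 / real (Suc k), RX, RY + 1 / real (Suc k))) \<longlonglongrightarrow> (R0 + 0, RX, RY + 0)"
    using LIMSEQ_inverse_real_of_nat
    by (intro tendsto_Pair tendsto_add tendsto_const) (simp_all add: inverse_eq_divide)
  then have "r \<in> rate_region p f"
    unfolding rate_region_def closure_sequential r using ach
    by (intro exI[of _ "\<lambda>k. (R0 + 1 / real (Suc k), RX, RY + 1 / real (Suc k))"]) auto
  then show "r \<in> {r \<in> rate_region p f. fst (snd r) > entropy_pmf (map_pmf fst p)}"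
    using RX by (simp add: r)
qed

lemma valid_aux_of_determined:
  fixes q :: "('x \<times> 'y \<times> nat \<times> nat) pmf"
  assumes p: "map_pmf (\<lambda>(x,y,u,w). (x,y)) q = p"
    and supp: "\<And>x y u w. (x,y,u,w) \<in> set_pmf q \<Longrightarrow> u < ku \<and> w < kw"
    and m1: "markov_chain_pmf (map_pmf (\<lambda>(x,y,u,w). (u,x,y)) q)"
    and m2: "markov_chain_pmf (map_pmf (\<lambda>(x,y,u,w). (x,(u,y),w)) q)"
    and det: "\<And>x y1 y2 u w. (x,y1,u,w) \<in> set_pmf q \<Longrightarrow> (x,y2,u,w) \<in> set_pmf q \<Longrightarrow> f x y1 = f x y2"
  shows "valid_aux p f ku kw q (\<lambda>w. {(u,y). u < ku \<and> (\<exists>x. (x,y,u,w) \<in> set_pmf q)})"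
proof -
  \<comment> \<open>An edge of the graph is witnessed by points whose \<open>W\<close>-values may
    differ from \<open>w\<close>. The chain X - (U,Y) - W allows the \<open>x\<close> of one support
    point to be combined with the \<open>w\<close> of another that has the same
    \<open>(u,y)\<close>, which moves both endpoints to the common value \<open>w\<close>.\<close>
  have mix: "(x,y,u,w) \<in> set_pmf q" if "(x,y,u,w') \<in> set_pmf q" "(x',y,u,w) \<in> set_pmf q" for x x' y u w w'
  proof -
    let ?M = "map_pmf (\<lambda>(x,y,u,w). (x,(u,y),w)) q"
    have "(x,(u,y)) \<in> set_pmf (map_pmf (\<lambda>(a,b,c). (a,b)) ?M)" "((u,y),w) \<in> set_pmf (map_pmf (\<lambda>(a,b,c). (b,c)) ?M)"
      using that by (force simp: set_map_pmf)+
    then have "pmf (map_pmf (\<lambda>(a,b,c). (a,b)) ?M) (x,(u,y)) * pmf (map_pmf (\<lambda>(a,b,c). (b,c)) ?M) ((u,y),w) > 0"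
      by (simp only: pmf_positive mult_pos_pos)
    then have "pmf ?M (x,(u,y),w) \<noteq> 0"
      using m2[unfolded markov_chain_pmf_def, rule_format, of x "(u,y)" w] by auto
    then show ?thesis by (auto simp: set_pmf_iff[symmetric])
  qed
  have "independent_set ({..<ku} \<times> UNIV)
        (char_graph_adj (map_pmf (\<lambda>(x,y,u,w). ((u,y),(x,u),(x,y))) q) (\<lambda>(x,y). f x y))
        {(u,y). u < ku \<and> (\<exists>x. (x,y,u,w) \<in> set_pmf q)}" for w
    unfolding independent_set_def
  proof (intro conjI ballI notI)
    fix a b assume a: "a \<in> {(u,y). u < ku \<and> (\<exists>x. (x,y,u,w) \<in> set_pmf q)}"
      and b: "b \<in> {(u,y). u < ku \<and> (\<exists>x. (x,y,u,w) \<in> set_pmf q)}"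
      and adj: "char_graph_adj (map_pmf (\<lambda>(x,y,u,w). ((u,y),(x,u),(x,y))) q) (\<lambda>(x,y). f x y) a b"
    let ?M = "map_pmf (\<lambda>(x,y,u,w). ((u,y),(x,u),(x,y))) q"
    obtain k s1 s2 where *: "pmf ?M (a,k,s1) * pmf ?M (b,k,s2) > 0" "(\<lambda>(x,y). f x y) s1 \<noteq> (\<lambda>(x,y). f x y) s2"
      using adj unfolding char_graph_adj_def by blast
    then have "pmf ?M (a,k,s1) \<noteq> 0" "pmf ?M (b,k,s2) \<noteq> 0" by auto
    then have "(a,k,s1) \<in> set_pmf ?M" "(b,k,s2) \<in> set_pmf ?M" by (simp_all only: set_pmf_iff not_False_eq_True)
    then obtain x u y1 w1 y2 w2 where ab: "a = (u,y1)" "b = (u,y2)" "s1 = (x,y1)" "s2 = (x,y2)"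
      and mem: "(x,y1,u,w1) \<in> set_pmf q" "(x,y2,u,w2) \<in> set_pmf q" by (auto simp: set_map_pmf)
    obtain x1 x2 where "(x1,y1,u,w) \<in> set_pmf q" "(x2,y2,u,w) \<in> set_pmf q" using a b by (auto simp: ab)
    then have "(x,y1,u,w) \<in> set_pmf q" "(x,y2,u,w) \<in> set_pmf q" using mem mix by blast+
    then have "f x y1 = f x y2" by (rule det)
    then show False using *(2) by (simp add: ab)
  qed auto
  then show ?thesis using p supp m1 m2 unfolding valid_aux_def by auto
qed

text \<open>A diagonal argument: the k-th achievable triple of an approximating sequence is paired
  with a code of error at most 1/(k+1), so rates and errors converge together along the subsequence
  of distributions.\<close>

lemma rate_region_subset_region_char:
  fixes p :: "('x::finite \<times> 'y::finite) pmf" and f :: "'x \<Rightarrow> 'y \<Rightarrow> 'f"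
  shows "{r \<in> rate_region p f. fst (snd r) > entropy_pmf (map_pmf fst p)}
     \<subseteq> region_char p f (CARD('x) + 2) ((CARD('x) + 2) * CARD('y) + 1)"
proof
  let ?ku = "CARD('x) + 2" and ?kw = "(CARD('x) + 2) * CARD('y) + 1"
  define S :: "('x \<times> 'y \<times> nat \<times> nat) set" where "S = UNIV \<times> UNIV \<times> {..<?ku} \<times> {..<?kw}"
  have finS: "finite S" by (simp add: S_def)
  fix r assume r: "r \<in> {r \<in> rate_region p f. fst (snd r) > entropy_pmf (map_pmf fst p)}"
  obtain R0 RX RY where rr: "r = (R0, RX, RY)" by (cases r)
  have "(R0, RX, RY) \<in> closure {r. achievable p f r}" using r by (simp add: rr rate_region_def)
  then obtain s where s: "\<And>k. achievable p f (s k)" "s \<longlonglongrightarrow> (R0, RX, RY)"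
    unfolding closure_sequential by auto
  have lim0: "(\<lambda>k. fst (s k)) \<longlonglongrightarrow> R0" using tendsto_fst[OF s(2)] by simp
  have limY: "(\<lambda>k. snd (snd (s k))) \<longlonglongrightarrow> RY" using tendsto_snd[OF tendsto_snd[OF s(2)]] by simp
  have "\<exists>q. set_pmf q \<subseteq> S \<and>
      auxiliary_rvs q (\<lambda>(x,y,u,w). x) (\<lambda>(x,y,u,w). y) (\<lambda>(x,y,u,w). u) (\<lambda>(x,y,u,w). w) p f
        (fst (s k)) (snd (snd (s k))) (1 / real (Suc k))" for k
  proof -
    obtain A B C where sk: "s k = (A, B, C)" by (cases "s k")
    have "achievable p f (A, B, C)" using s(1)[of k] by (simp add: sk)
    moreover have "1 / real (Suc k) > 0" by simp
    ultimately obtain N where N: "\<forall>n\<ge>N. \<exists>\<phi>0 \<phi>X \<phi>Y \<psi>. is_code n A B C \<phi>0 \<phi>X \<phi>Y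
        \<and> code_error p f n \<phi>0 \<phi>X \<phi>Y \<psi> \<le> 1 / real (Suc k)"
      unfolding achievable_def prod.case by blast
    \<comment> \<open>\<open>Suc N\<close> provides a positive block length, as required by the
      uniform time index.\<close>
    obtain \<phi>0 \<phi>X \<phi>Y \<psi> where code: "is_code (Suc N) A B C \<phi>0 \<phi>X \<phi>Y"
      "code_error p f (Suc N) \<phi>0 \<phi>X \<phi>Y \<psi> \<le> 1 / real (Suc k)"
      using N[rule_format, of "Suc N"] by auto
    have finp: "finite (set_pmf p)" by simp
    obtain q0 :: "('x \<times> 'y \<times> (nat \<times> nat \<times> 'x list \<times> 'y list) \<times> nat) pmf" where
      "auxiliary_rvs q0 (\<lambda>(x,y,u,w). x) (\<lambda>(x,y,u,w). y) (\<lambda>(x,y,u,w). u) (\<lambda>(x,y,u,w). w) p f A C (1 / real (Suc k))"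
      using single_letter_converse[OF finp _ code] unfolding auxiliary_rvs_projections by blast
    from auxiliary_alphabet_bounds[OF this] show ?thesis by (simp add: sk S_def)
  qed
  then obtain Q where Q: "\<And>k. set_pmf (Q k) \<subseteq> S"
    "\<And>k. auxiliary_rvs (Q k) (\<lambda>(x,y,u,w). x) (\<lambda>(x,y,u,w). y) (\<lambda>(x,y,u,w). u) (\<lambda>(x,y,u,w). w) p f
        (fst (s k)) (snd (snd (s k))) (1 / real (Suc k))" by metis
  obtain t q where t: "strict_mono t" and lim: "pmf_limit S (\<lambda>k. Q (t k)) q"
    using pmf_limit_subsequence[OF finS, of Q] Q(1) by blast
  note aux = Q(2)[unfolded auxiliary_rvs_projections]
  have limq: "(\<lambda>k. pmf (Q (t k)) a) \<longlonglongrightarrow> pmf q a" for a by (rule pmf_limitD[OF lim])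
  have p: "map_pmf (\<lambda>(x,y,u,w). (x,y)) q = p"
  proof (rule pmf_eqI)
    fix z
    have "(\<lambda>k. pmf (map_pmf (\<lambda>(x,y,u,w). (x,y)) (Q (t k))) z) \<longlonglongrightarrow> pmf (map_pmf (\<lambda>(x,y,u,w). (x,y)) q) z"
      by (rule pmf_limitD[OF pmf_limit_map[OF lim]])
    then show "pmf (map_pmf (\<lambda>(x,y,u,w). (x,y)) q) z = pmf p z" using aux by (simp add: LIMSEQ_const_iff)
  qed
  have m1: "markov_chain_pmf (map_pmf (\<lambda>(x,y,u,w). (u,x,y)) q)"
    by (rule pmf_limit_markov_chain[OF pmf_limit_map[OF lim]]) (use aux in blast)
  have m2: "markov_chain_pmf (map_pmf (\<lambda>(x,y,u,w). (x,(u,y),w)) q)"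
    by (rule pmf_limit_markov_chain[OF pmf_limit_map[OF lim]]) (use aux in blast)
  have c1: "cond_mi_pmf (map_pmf (\<lambda>(x,y,u,w). (x,u,y)) q) \<le> R0"
    using LIMSEQ_subseq_LIMSEQ[OF lim0 t] aux
    by (intro LIMSEQ_le[OF pmf_limit_cond_mi[OF pmf_limit_map[OF lim]]]) (auto simp: o_def)
  have c2: "cond_mi_pmf (map_pmf (\<lambda>(x,y,u,w). (y,w,(x,u))) q) \<le> RY"
    using LIMSEQ_subseq_LIMSEQ[OF limY t] aux
    by (intro LIMSEQ_le[OF pmf_limit_cond_mi[OF pmf_limit_map[OF lim]]]) (auto simp: o_def)
  have det: "f x y1 = f x y2" if mem: "(x,y1,u,w) \<in> set_pmf q" "(x,y2,u,w) \<in> set_pmf q" for x y1 y2 u w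
  proof (rule ccontr)
    assume ne: "f x y1 \<noteq> f x y2"
    \<comment> \<open>A guess \<open>g x u w\<close> cannot equal both values of \<open>f\<close>,
      so at least one of the two atoms lies in the error event.\<close>
    have "min (pmf (Q k) (x,y1,u,w)) (pmf (Q k) (x,y2,u,w)) \<le> 1 / real (Suc k)" for k
    proof -
      obtain g where g: "measure_pmf.prob (Q k) {(x,y,u,w). f x y \<noteq> g x u w} \<le> 1 / real (Suc k)"
        using aux by blast
      have "\<exists>y\<in>{y1,y2}. f x y \<noteq> g x u w" using ne by auto
      then obtain y where y: "y \<in> {y1,y2}" "f x y \<noteq> g x u w" by blast
      have "pmf (Q k) (x,y,u,w) \<le> measure_pmf.prob (Q k) {(x,y,u,w). f x y \<noteq> g x u w}"
        unfolding measure_pmf_single[symmetric] using y by (intro measure_pmf.finite_measure_mono) auto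
      then show ?thesis using g y(1) by auto
    qed
    then have bound: "min (pmf (Q (t k)) (x,y1,u,w)) (pmf (Q (t k)) (x,y2,u,w)) \<le> 1 / real (Suc (t k))" for k .
    have "(\<lambda>k. 1 / real (Suc (t k))) \<longlonglongrightarrow> 0"
      using LIMSEQ_subseq_LIMSEQ[OF LIMSEQ_inverse_real_of_nat t] by (simp add: o_def inverse_eq_divide)
    then have "min (pmf q (x,y1,u,w)) (pmf q (x,y2,u,w)) \<le> 0"
      using bound by (intro LIMSEQ_le[OF tendsto_min[OF limq limq]]) auto
    then show False using pmf_positive[OF mem(1)] pmf_positive[OF mem(2)] by (auto simp: min_le_iff_disj)
  qed
  have "valid_aux p f ?ku ?kw q (\<lambda>w. {(u,y). u < ?ku \<and> (\<exists>x. (x,y,u,w) \<in> set_pmf q)})"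
  proof (rule valid_aux_of_determined[OF p _ m1 m2 det])
    show "(x,y,u,w) \<in> set_pmf q \<Longrightarrow> u < ?ku \<and> w < ?kw" for x y u w
      using lim by (auto simp: pmf_limit_def S_def)
  qed
  then show "r \<in> region_char p f ?ku ?kw"
    using r c1 c2 unfolding region_char_def rr by auto
qed

text \<open>One inclusion holds for arbitrary alphabet bounds and the other for the stated ones;
  together they close the circle for both equalities.\<close>

theorem theorem5:
  fixes p :: "('x::finite \<times> 'y::finite) pmf" and f :: "'x \<Rightarrow> 'y \<Rightarrow> 'f::finite"
  shows "{r \<in> rate_region p f. fst (snd r) > entropy_pmf (map_pmf fst p)}
           = {r. \<exists>bu bw. r \<in> region_char p f bu bw}
       \<and> {r \<in> rate_region p f. fst (snd r) > entropy_pmf (map_pmf fst p)}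
           = region_char p f (CARD('x) + 2) ((CARD('x) + 2) * CARD('y) + 1)"
  using rate_region_subset_region_char[of p f] region_char_subset_rate_region[of p f] by blast

end
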